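(* Consider the logistic bandit model, the radii $\omega_n,\alpha_n,\bar\omega_n$ and the optimistic rule described in the context. Fix $y>0$ and $\rho\ge1$. Suppose that with probability at least $1-Ce^{-y}$ the inequalities $$\max\left\{\|(A^\star_n+\rho I)^{1/2}(f^\star-\hat f_n)\|,\ \|(\hat A_n+\rho I)^{1/2}(f^\star-\hat f_n)\|\right\}\le\omega_n\quad\text{and}\quad \|f^\star-\hat f_n\|\le\alpha_n$$ hold simultaneously for all $n\ge1$ (where $\omega_n$ and $\bar\omega_n$ are replaced by their running maxima in $n$ if they are not already nondecreasing). Then the regret of the optimistic rule satisfies, with probability at least $1-Ce^{-y}$, for all $n\ge1$, $$R_n\le 12\,\bar\omega_n\sqrt{\nu_\star\, n\,\gamma(\rho^{-1}A^\star_n)}+64\,e^{b}\,\bar\omega_n^2\,\gamma(\rho^{-1}A^\star_n).$$ In particular, when $$\beta_n(\rho,y)=\sqrt\rho+\frac{78\,\gamma(\rho^{-1}V_n)+4y}{\sqrt\rho}+\sqrt{18\,\gamma(\rho^{-1}V_n)+6y},\qquad V_n=\sum_{j=1}^nX_j\otimes X_j,$$ one may take $C=2$.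
   Context: Model. $\mathcal H$ is a real separable Hilbert space with closed unit ball $B$ and identity operator $I$; $(\Omega,\mathcal F,\mathbb P)$ is a probability space with filtration $(\mathcal F_n)_{n\ge0}$. Let $\mu(u)=1/(1+e^{-u})$ and $\mathrm V(u)=\mu(u)(1-\mu(u))$. The arm set $\mathcal X\subset B$ is compact. The chosen arms $(X_n)_{n\ge1}$ are $\mathcal X$-valued and predictable ($X_n$ is $\mathcal F_{n-1}$-measurable); the responses $(Y_n)_{n\ge1}$ are adapted with values in $[0,1]$ (not necessarily Bernoulli) and satisfy $\mathbb E[Y_n\mid\mathcal F_{n-1}]=\mu(\langle f^\star,X_n\rangle)$ a.s. for a fixed $f^\star\in\mathcal H$ with $\|f^\star\|\le b$, where $b>0$ is known. Information gain. For a positive semidefinite trace class operator $A$, $\gamma(A)=\frac12\log\det(I+A)$ (Fredholm determinant). $x\otimes x$ is the operator $z\mapsto\langle x,z\rangle x$. Concentration radius. With $\epsilon_j=Y_j-\mu(\langle f^\star,X_j\rangle)$, $M_n=\sum_{j=1}^n\epsilon_jX_j$ and $Q_n=\sum_{j=1}^n\mathbb E[\epsilon_j^2\mid\mathcal F_{j-1}]X_j\otimes X_j$, the radius $\beta_n(\rho,y)\ge0$ is any quantity, nondecreasing in $n$, such that $\mathbb P[\bigcap_{n\ge1}\{\|(Q_n+\rho I)^{-1/2}M_n\|\le\beta_n(\rho,y)\}]\ge1-Ce^{-y}$ for a constant $C$. Estimator and radii. For $f\in\mathcal H$, $A_n(f)=\sum_{j=1}^n\mathrm V(\langle f,X_j\rangle)X_j\otimes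 X_j$. With $\ell(u,y)=-y\log\mu(u)-(1-y)\log(1-\mu(u))$, let $\hat f_n\in\arg\min_{f\in\mathcal H}\left\{\sum_{i=1}^n\ell(\langle f,X_i\rangle,Y_i)+\frac\rho2\|f\|^2\right\}$. Set $A^\star_n=A_n(f^\star)$, $\hat A_n=A_n(\hat f_n)$, and $$u_n=\frac{\beta_n(\rho,y)}{\sqrt\rho}+b,\quad \omega_n=u_n(6+2u_n^3)\sqrt\rho,\quad \alpha_n=u_n(1+u_n),\quad \bar\omega_n=\omega_n(1+\alpha_n).$$ Optimistic rule. Let $\bar{\mathcal E}_0=\{f\in\mathcal H:\|f\|\le b\}$ and, for $n\ge1$, $\bar{\mathcal E}_n=\{f\in\mathcal H:\|(\hat A_n+(\rho+\omega_n^2)I)^{1/2}(f-\hat f_n)\|\le\bar\omega_n\}$. At each round $n\ge1$ the rule chooses $X_n\in\arg\max_{x\in\mathcal X}\max_{f\in\bar{\mathcal E}_{n-1}}\langle f,x\rangle$. Regret. With $x^\star\in\arg\max_{x\in\mathcal X}\langle f^\star,x\rangle$, the regret is $R_n=\sum_{j=1}^n\left(\mu(\langle f^\star,x^\star\rangle)-\mu(\langle f^\star,X_j\rangle)\right)$, and $\nu_\star=\mathrm V(\langle f^\star,x^\star\rangle)$. *)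

theory Defs
  imports "HOL-Probability.Probability"
begin

section \<open>Operators on a real Hilbert space\<close>

definition rank_one :: "'h::real_inner \<Rightarrow> 'h \<Rightarrow>\<^sub>L 'h" where
  "rank_one x = blinfun_scaleR_left x o\<^sub>L blinfun_inner_right x"

lemma rank_one_apply: "blinfun_apply (rank_one x) z = inner x z *\<^sub>R x"
  by (simp add: rank_one_def)

definition psd_op :: "('h::real_inner \<Rightarrow>\<^sub>L 'h) \<Rightarrow> bool" where
  "psd_op A \<longleftrightarrow> (\<forall>x y. inner (A x) y = inner x (A y)) \<and> (\<forall>x. 0 \<le> inner x (A x))"

text \<open>The positive semidefinite square root; it exists and is unique for positive semidefinite
  operators on a Hilbert space, and is only meant to be used for those.\<close>

definition op_sqrt :: "('h::real_inner \<Rightarrow>\<^sub>L 'h) \<Rightarrow> ('h \<Rightarrow>\<^sub>L 'h)" where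
  "op_sqrt A = (SOME S. psd_op S \<and> S o\<^sub>L S = A)"

definition op_inv :: "('h::real_normed_vector \<Rightarrow>\<^sub>L 'h) \<Rightarrow> ('h \<Rightarrow>\<^sub>L 'h)" where
  "op_inv A = (SOME B. A o\<^sub>L B = id_blinfun \<and> B o\<^sub>L A = id_blinfun)"

definition eigenspace :: "('h::real_normed_vector \<Rightarrow>\<^sub>L 'h) \<Rightarrow> real \<Rightarrow> 'h set" where
  "eigenspace A l = {z. A z = l *\<^sub>R z}"

text \<open>\<open>fredholm_det A\<close> is \<open>det (I + A)\<close> for a positive semidefinite trace class operator \<open>A\<close>: the
  product of \<open>1 + l\<close> over the nonzero eigenvalues \<open>l\<close> of \<open>A\<close>, repeated according to multiplicity.
  All factors exceed \<open>1\<close>, so the (possibly infinite) product is the exponential of the sum of the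
  logarithms. Eigenspaces of a compact operator for nonzero eigenvalues are finite-dimensional.\<close>

definition fredholm_det :: "('h::real_normed_vector \<Rightarrow>\<^sub>L 'h) \<Rightarrow> real" where
  "fredholm_det A =
     exp (\<Sum>\<^sub>\<infinity>l\<in>{l. l \<noteq> 0 \<and> eigenspace A l \<noteq> {0}}. real (dim (eigenspace A l)) * ln (1 + l))"

definition info_gain :: "('h::real_normed_vector \<Rightarrow>\<^sub>L 'h) \<Rightarrow> real" where
  "info_gain A = ln (fredholm_det A) / 2"


section \<open>Logistic link, design operators and estimator along a path\<close>

definition logistic :: "real \<Rightarrow> real" where
  "logistic u = 1 / (1 + exp (- u))"

definition logistic_var :: "real \<Rightarrow> real" where
  "logistic_var u = logistic u * (1 - logistic u)"

definition log_loss :: "real \<Rightarrow> real \<Rightarrow> real" where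
  "log_loss u y = - y * ln (logistic u) - (1 - y) * ln (1 - logistic u)"

text \<open>In this section \<open>x 1, x 2, \<dots>\<close> is a sequence of arms and \<open>r 1, r 2, \<dots>\<close> a sequence of
  responses; both are later instantiated with the paths of the random sequences.\<close>

definition design_op :: "(nat \<Rightarrow> 'h::real_inner) \<Rightarrow> nat \<Rightarrow> ('h \<Rightarrow>\<^sub>L 'h)" where
  "design_op x n = (\<Sum>j=1..n. rank_one (x j))"

definition hess_op :: "(nat \<Rightarrow> 'h::real_inner) \<Rightarrow> nat \<Rightarrow> 'h \<Rightarrow> ('h \<Rightarrow>\<^sub>L 'h)" where
  "hess_op x n f = (\<Sum>j=1..n. logistic_var (inner f (x j)) *\<^sub>R rank_one (x j))"

definition ridge_loss ::
  "real \<Rightarrow> (nat \<Rightarrow> 'h::real_inner) \<Rightarrow> (nat \<Rightarrow> real) \<Rightarrow> nat \<Rightarrow> 'h \<Rightarrow> real" where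
  "ridge_loss \<rho> x r n f = (\<Sum>i=1..n. log_loss (inner f (x i)) (r i)) + \<rho> / 2 * (norm f)\<^sup>2"


section \<open>Radii\<close>

text \<open>The argument \<open>\<beta>\<close> is the value of the concentration radius at the round in question.\<close>

definition u_rad :: "real \<Rightarrow> real \<Rightarrow> real \<Rightarrow> real" where
  "u_rad \<rho> b \<beta> = \<beta> / sqrt \<rho> + b"

definition omega :: "real \<Rightarrow> real \<Rightarrow> real \<Rightarrow> real" where
  "omega \<rho> b \<beta> = u_rad \<rho> b \<beta> * (6 + 2 * u_rad \<rho> b \<beta> ^ 3) * sqrt \<rho>"

definition alpha :: "real \<Rightarrow> real \<Rightarrow> real \<Rightarrow> real" where
  "alpha \<rho> b \<beta> = u_rad \<rho> b \<beta> * (1 + u_rad \<rho> b \<beta>)"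

definition omega_bar :: "real \<Rightarrow> real \<Rightarrow> real \<Rightarrow> real" where
  "omega_bar \<rho> b \<beta> = omega \<rho> b \<beta> * (1 + alpha \<rho> b \<beta>)"

text \<open>Since concentration radii are nonnegative and nondecreasing in \<open>n\<close>, so are the derived radii;
  hence they coincide with their running maxima.\<close>

lemma radii_mono:
  assumes "0 \<le> s" "s \<le> t" "0 < \<rho>" "0 \<le> b"
  shows "u_rad \<rho> b s \<le> u_rad \<rho> b t" "omega \<rho> b s \<le> omega \<rho> b t"
    "alpha \<rho> b s \<le> alpha \<rho> b t" "omega_bar \<rho> b s \<le> omega_bar \<rho> b t"
proof -
  have nn: "0 \<le> u_rad \<rho> b s"
    using assms by (simp add: u_rad_def)
  show u: "u_rad \<rho> b s \<le> u_rad \<rho> b t"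
    using assms by (simp add: u_rad_def divide_right_mono)
  show o: "omega \<rho> b s \<le> omega \<rho> b t"
    unfolding omega_def using nn u assms
    by (intro mult_right_mono mult_mono add_left_mono mult_left_mono power_mono) auto
  show a: "alpha \<rho> b s \<le> alpha \<rho> b t"
    unfolding alpha_def using nn u by (intro mult_mono) auto
  have "0 \<le> omega \<rho> b t" "0 \<le> alpha \<rho> b s"
    using nn u assms by (auto simp: omega_def alpha_def)
  then show "omega_bar \<rho> b s \<le> omega_bar \<rho> b t"
    unfolding omega_bar_def using o a by (intro mult_mono) auto
qed

definition beta_explicit :: "real \<Rightarrow> real \<Rightarrow> (nat \<Rightarrow> 'h::real_inner) \<Rightarrow> nat \<Rightarrow> real" where
  "beta_explicit \<rho> y x n =
     (let g = info_gain (inverse \<rho> *\<^sub>R design_op x n)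
      in sqrt \<rho> + (78 * g + 4 * y) / sqrt \<rho> + sqrt (18 * g + 6 * y))"

definition conf_ineqs ::
  "real \<Rightarrow> real \<Rightarrow> 'h::real_inner \<Rightarrow> (nat \<Rightarrow> 'h) \<Rightarrow> (nat \<Rightarrow> 'h) \<Rightarrow> (nat \<Rightarrow> real) \<Rightarrow> nat \<Rightarrow> bool" where
  "conf_ineqs \<rho> b fstar x fhat \<beta> n \<longleftrightarrow>
     max (norm (op_sqrt (hess_op x n fstar + \<rho> *\<^sub>R id_blinfun) (fstar - fhat n)))
         (norm (op_sqrt (hess_op x n (fhat n) + \<rho> *\<^sub>R id_blinfun) (fstar - fhat n)))
       \<le> omega \<rho> b (\<beta> n) \<and>
     norm (fstar - fhat n) \<le> alpha \<rho> b (\<beta> n)"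

definition conf_set ::
  "real \<Rightarrow> real \<Rightarrow> (nat \<Rightarrow> 'h::real_inner) \<Rightarrow> (nat \<Rightarrow> 'h) \<Rightarrow> (nat \<Rightarrow> real) \<Rightarrow> nat \<Rightarrow> 'h set" where
  "conf_set \<rho> b x fhat \<beta> n =
     (if n = 0 then {f. norm f \<le> b}
      else {f. norm (op_sqrt (hess_op x n (fhat n) + (\<rho> + (omega \<rho> b (\<beta> n))\<^sup>2) *\<^sub>R id_blinfun)
                       (f - fhat n)) \<le> omega_bar \<rho> b (\<beta> n)})"

definition regret :: "'h::real_inner \<Rightarrow> 'h \<Rightarrow> (nat \<Rightarrow> 'h) \<Rightarrow> nat \<Rightarrow> real" where
  "regret fstar xstar x n =
     (\<Sum>j=1..n. logistic (inner fstar xstar) - logistic (inner fstar (x j)))"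

definition regret_bound ::
  "real \<Rightarrow> real \<Rightarrow> 'h::real_inner \<Rightarrow> 'h \<Rightarrow> (nat \<Rightarrow> 'h) \<Rightarrow> (nat \<Rightarrow> real) \<Rightarrow> nat \<Rightarrow> bool" where
  "regret_bound \<rho> b fstar xstar x \<beta> n \<longleftrightarrow>
     (let \<nu> = logistic_var (inner fstar xstar);
          g = info_gain (inverse \<rho> *\<^sub>R hess_op x n fstar);
          w = omega_bar \<rho> b (\<beta> n)
      in regret fstar xstar x n \<le> 12 * w * sqrt (\<nu> * real n * g) + 64 * exp b * w\<^sup>2 * g)"


section \<open>The logistic bandit model\<close>

text \<open>``With probability at least \<open>p\<close>'': the event in question contains a measurable event of
  probability at least \<open>p\<close> (its own measurability is not required).\<close>

definition with_prob_ge :: "'w measure \<Rightarrow> real \<Rightarrow> ('w \<Rightarrow> bool) \<Rightarrow> bool" where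
  "with_prob_ge M p P \<longleftrightarrow> (\<exists>E\<in>sets M. (\<forall>\<omega>\<in>E. P \<omega>) \<and> p \<le> measure M E)"

locale logistic_bandit = prob_space M + filtration "space M" F
  for M :: "'w measure" and F :: "nat \<Rightarrow> 'w measure" +
  fixes \<X> :: "'h::{real_inner, banach, second_countable_topology} set"
    and X :: "nat \<Rightarrow> 'w \<Rightarrow> 'h"
    and Y :: "nat \<Rightarrow> 'w \<Rightarrow> real"
    and fstar :: 'h
    and b :: real
  assumes subalg: "\<And>n. subalgebra M (F n)"
    and arms_compact: "compact \<X>"
    and arms_ball: "\<X> \<subseteq> cball 0 1"
    and X_arm: "\<And>n \<omega>. 1 \<le> n \<Longrightarrow> \<omega> \<in> space M \<Longrightarrow> X n \<omega> \<in> \<X>"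
    and X_predictable: "\<And>n. 1 \<le> n \<Longrightarrow> X n \<in> borel_measurable (F (n - 1))"
    and Y_range: "\<And>n \<omega>. 1 \<le> n \<Longrightarrow> \<omega> \<in> space M \<Longrightarrow> Y n \<omega> \<in> {0..1}"
    and Y_adapted: "\<And>n. 1 \<le> n \<Longrightarrow> Y n \<in> borel_measurable (F n)"
    and Y_cond_mean: "\<And>n. 1 \<le> n \<Longrightarrow>
      AE \<omega> in M. real_cond_exp M (F (n - 1)) (Y n) \<omega> = logistic (inner fstar (X n \<omega>))"
    and b_pos: "0 < b"
    and fstar_bound: "norm fstar \<le> b"

definition noise ::
  "'h::real_inner \<Rightarrow> (nat \<Rightarrow> 'w \<Rightarrow> 'h) \<Rightarrow> (nat \<Rightarrow> 'w \<Rightarrow> real) \<Rightarrow> nat \<Rightarrow> 'w \<Rightarrow> real" where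
  "noise fstar X Y j \<omega> = Y j \<omega> - logistic (inner fstar (X j \<omega>))"

definition noise_mart ::
  "'h::real_inner \<Rightarrow> (nat \<Rightarrow> 'w \<Rightarrow> 'h) \<Rightarrow> (nat \<Rightarrow> 'w \<Rightarrow> real) \<Rightarrow> nat \<Rightarrow> 'w \<Rightarrow> 'h" where
  "noise_mart fstar X Y n \<omega> = (\<Sum>j=1..n. noise fstar X Y j \<omega> *\<^sub>R X j \<omega>)"

definition noise_qvar ::
  "'w measure \<Rightarrow> (nat \<Rightarrow> 'w measure) \<Rightarrow> 'h::real_inner \<Rightarrow> (nat \<Rightarrow> 'w \<Rightarrow> 'h) \<Rightarrow> (nat \<Rightarrow> 'w \<Rightarrow> real)
     \<Rightarrow> nat \<Rightarrow> 'w \<Rightarrow> ('h \<Rightarrow>\<^sub>L 'h)" where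
  "noise_qvar M F fstar X Y n \<omega> =
     (\<Sum>j=1..n. real_cond_exp M (F (j - 1)) (\<lambda>\<omega>'. (noise fstar X Y j \<omega>')\<^sup>2) \<omega> *\<^sub>R rank_one (X j \<omega>))"

text \<open>The radius may be random (as \<open>beta_explicit\<close> is); \<open>\<rho>\<close> and \<open>y\<close> are fixed.\<close>

definition concentration_radius ::
  "'w measure \<Rightarrow> (nat \<Rightarrow> 'w measure) \<Rightarrow> 'h::real_inner \<Rightarrow> (nat \<Rightarrow> 'w \<Rightarrow> 'h) \<Rightarrow> (nat \<Rightarrow> 'w \<Rightarrow> real)
     \<Rightarrow> real \<Rightarrow> real \<Rightarrow> real \<Rightarrow> (nat \<Rightarrow> 'w \<Rightarrow> real) \<Rightarrow> bool" where
  "concentration_radius M F fstar X Y \<rho> y C \<beta> \<longleftrightarrow>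
     (\<forall>\<omega>\<in>space M. (\<forall>n\<ge>1. 0 \<le> \<beta> n \<omega>) \<and> mono_on {1..} (\<lambda>n. \<beta> n \<omega>)) \<and>
     with_prob_ge M (1 - C * exp (- y)) (\<lambda>\<omega>. \<forall>n\<ge>1.
       norm (op_inv (op_sqrt (noise_qvar M F fstar X Y n \<omega> + \<rho> *\<^sub>R id_blinfun))
               (noise_mart fstar X Y n \<omega>)) \<le> \<beta> n \<omega>)"

text \<open>The inner maximum is written as a supremum; the confidence sets are bounded, closed and
  convex, so it is attained.\<close>

definition optimistic_rule ::
  "'w measure \<Rightarrow> 'h::real_inner set \<Rightarrow> (nat \<Rightarrow> 'w \<Rightarrow> 'h) \<Rightarrow> real \<Rightarrow> real \<Rightarrow> (nat \<Rightarrow> 'w \<Rightarrow> 'h)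
     \<Rightarrow> (nat \<Rightarrow> 'w \<Rightarrow> real) \<Rightarrow> bool" where
  "optimistic_rule M \<X> X \<rho> b fhat \<beta> \<longleftrightarrow>
     (\<forall>n\<ge>1. \<forall>\<omega>\<in>space M.
        is_arg_max
          (\<lambda>x. SUP f\<in>conf_set \<rho> b (\<lambda>j. X j \<omega>) (\<lambda>j. fhat j \<omega>) (\<lambda>j. \<beta> j \<omega>) (n - 1). inner f x)
          (\<lambda>x. x \<in> \<X>) (X n \<omega>))"

end

theory Submission
  imports Defs
begin

text \<open>Concentration. Let \<open>Z n = Q n + \<rho> I\<close> and \<open>s n = \<langle>M n, inverse (Z n) (M n)\<rangle>\<close>. Since the square root
  turns the quadratic growth of \<open>s\<close> into bounded increments,
  \<open>exp (sqrt \<rho> / 4 * sqrt (\<rho> + s n) - \<rho> / 4 - 5 / 32 * (\<Sum>j\<le>n. w j * \<langle>X j, inverse (Z j) (X j)\<rangle>))\<close> is a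
  supermartingale, where \<open>w j\<close> is the conditional variance of the noise. Ville's inequality and the
  elliptical potential bound (concavity of \<open>log det\<close>) give a radius below \<open>beta_explicit\<close>.

  Confidence. By self-concordance the Hessians at \<open>fstar\<close> and \<open>fhat\<close> are at most
  \<open>1 + \<parallel>fstar - fhat\<parallel>\<close> times the secant operator of the gradient of the ridge loss. The noise bound then
  becomes a quadratic inequality for \<open>\<parallel>fstar - fhat\<parallel>\<close>.

  Regret. Optimism bounds the prediction gap at \<open>X j\<close> by \<open>2.7 * omega_bar\<close> times the norm of \<open>X j\<close> in the
  inverse of \<open>A (j - 1) + \<rho> I\<close>. A second order expansion of the link, the bound of the variance at \<open>X j\<close>
  by \<open>\<nu>\<close> plus the instantaneous regret, and the potential bound give a quadratic inequality for the
  square root of the regret.\<close>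


section \<open>Finite-rank positive semidefinite operators\<close>

text \<open>Every operator involved is a multiple of the identity plus finitely many rank one terms,
  so the possibly infinite-dimensional space enters only through finite spans, where eigenbases give
  square roots and determinants. \<open>op_sqrt\<close> and \<open>op_inv\<close> are choices by
  \<open>SOME\<close>; exhibiting a witness gives access to them, and from then on only quadratic
  forms are handled. The obstacle to an exponential supermartingale in s itself is the increment
  \<open>2 * e * a\<close>, where \<open>a\<close> can be of order \<open>sqrt s\<close>; the slope
  of \<open>sqrt (\<rho> + s)\<close> cancels exactly this growth. The passage from Q to the Hessian
  at \<open>fstar\<close> rests on responses in [0,1]: there Y^2 \<le> Y, so the conditional
  variance is at most the logistic variance, and larger weights mean a smaller resolvent. Hence one
  event serves both concentration and confidence, and the confidence and regret arguments are
  deterministic and run path by path.\<close>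

definition orthonormal :: "'h::real_inner set \<Rightarrow> bool" where
  "orthonormal E \<longleftrightarrow> finite E \<and> pairwise orthogonal E \<and> (\<forall>e\<in>E. norm e = 1)"

lemma orthonormal_finite: "orthonormal E \<Longrightarrow> finite E"
  by (simp add: orthonormal_def)

lemma orthonormal_inner:
  assumes "orthonormal E" "e \<in> E" "f \<in> E"
  shows "e \<bullet> f = (if e = f then 1 else 0)"
  using assms by (auto simp: orthonormal_def pairwise_def orthogonal_def norm_eq_1)

lemma orthonormal_independent: "orthonormal E \<Longrightarrow> independent E"
  by (rule pairwise_orthogonal_independent) (auto simp: orthonormal_def)

lemma orthonormal_subset: "orthonormal E \<Longrightarrow> D \<subseteq> E \<Longrightarrow> orthonormal D"
  unfolding orthonormal_def by (auto intro: finite_subset pairwise_mono)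

lemma orthonormal_coeff:
  assumes "orthonormal E" "f \<in> E"
  shows "f \<bullet> (\<Sum>e\<in>E. c e *\<^sub>R e) = c f"
proof -
  have "f \<bullet> (\<Sum>e\<in>E. c e *\<^sub>R e) = (\<Sum>e\<in>E. if e = f then c e else 0)"
    unfolding inner_sum_right by (intro sum.cong) (auto simp: orthonormal_inner[OF assms(1)] assms(2))
  then show ?thesis
    using assms(2) orthonormal_finite[OF assms(1)] by simp
qed

lemma orthonormal_expansion:
  assumes "orthonormal E" "z \<in> span E"
  shows "(\<Sum>e\<in>E. (e \<bullet> z) *\<^sub>R e) = z"
proof -
  obtain c where "z = (\<Sum>e\<in>E. c e *\<^sub>R e)"
    using assms span_finite[OF orthonormal_finite[OF assms(1)]] by auto
  then show ?thesis
    using orthonormal_coeff[OF assms(1)] by simp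
qed

lemma orthonormal_parseval:
  assumes "orthonormal E" "z \<in> span E"
  shows "z \<bullet> w = (\<Sum>e\<in>E. (e \<bullet> z) * (e \<bullet> w))"
proof -
  have "z \<bullet> w = (\<Sum>e\<in>E. (e \<bullet> z) *\<^sub>R e) \<bullet> w"
    using orthonormal_expansion[OF assms] by simp
  then show ?thesis
    by (simp add: inner_sum_left)
qed

text \<open>Gram-Schmidt, normalised. The cardinality bound makes the induction on
  \<open>card S\<close> in \<open>symmetric_eigenbasis\<close> descend.\<close>

lemma orthonormal_basis_span:
  fixes S :: "'h::real_inner set"
  assumes "finite S"
  obtains E where "orthonormal E" "span E = span S" "card E \<le> card S"
proof -
  obtain C where C: "finite C" "card C \<le> card S" "span C = span S" "pairwise orthogonal C"
    using basis_orthogonal[OF assms] by blast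
  let ?n = "\<lambda>v::'h. v /\<^sub>R norm v"
  let ?E = "?n ` (C - {0})"
  have "orthonormal ?E"
    using C by (auto simp: orthonormal_def pairwise_def orthogonal_def)
  moreover have "span ?E = span S"
  proof -
    have "?E \<subseteq> span C"
      by (auto intro: span_scale span_base)
    moreover have "C \<subseteq> span ?E"
    proof
      fix v assume v: "v \<in> C"
      show "v \<in> span ?E"
      proof (cases "v = 0")
        case False
        then have "?n v \<in> span ?E" using v by (auto intro: span_base)
        then have "norm v *\<^sub>R ?n v \<in> span ?E" by (rule span_scale)
        then show ?thesis using False by simp
      qed (simp add: span_zero)
    qed
    ultimately show ?thesis
      unfolding C(3)[symmetric] by (intro subset_antisym span_minimal subspace_span)
  qed
  moreover have "card ?E \<le> card S"
    using card_image_le[of "C - {0}" ?n] card_Diff1_le[of C 0] C(1,2) by simp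
  ultimately show ?thesis
    using that by blast
qed

text \<open>Compactness has to come from coordinates, since the unit sphere of the whole space need
  not be compact: combinations with coefficients in [-1,1] are a continuous image of a cube, built
  one basis vector at a time.\<close>

lemma compact_span_sphere:
  fixes S :: "'h::real_inner set"
  assumes "finite S"
  shows "compact (span S \<inter> sphere 0 1)"
proof -
  obtain E where E: "orthonormal E" "span E = span S"
    using orthonormal_basis_span[OF assms] by metis
  let ?K = "\<lambda>E :: 'h set. {\<Sum>e\<in>E. c e *\<^sub>R e |c. \<forall>e. \<bar>c e\<bar> \<le> (1::real)}"
  have "compact (?K E)"
    using orthonormal_finite[OF E(1)]
  proof (induction E)
    case empty
    have "?K {} = {0}" by (auto intro: exI[of _ "\<lambda>_. 0"])
    then show ?case by simp
  next
    case (insert e F)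
    have "?K (insert e F) = (\<lambda>(t, z). t *\<^sub>R e + z) ` ({-1..1} \<times> ?K F)" (is "?L = ?R")
    proof
      show "?L \<subseteq> ?R"
      proof clarify
        fix c :: "'h \<Rightarrow> real" assume c: "\<forall>e. \<bar>c e\<bar> \<le> 1"
        have "(c e, \<Sum>f\<in>F. c f *\<^sub>R f) \<in> {-1..1} \<times> ?K F"
          using c by (auto simp: abs_le_iff minus_le_iff)
        then show "(\<Sum>f\<in>insert e F. c f *\<^sub>R f) \<in> ?R"
          using insert by (intro image_eqI[of _ _ "(c e, \<Sum>f\<in>F. c f *\<^sub>R f)"]) auto
      qed
      show "?R \<subseteq> ?L"
      proof clarify
        fix t :: real and c :: "'h \<Rightarrow> real"
        assume *: "t \<in> {-1..1}" "\<forall>e. \<bar>c e\<bar> \<le> 1"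
        have "(\<Sum>f\<in>F. (c(e := t)) f *\<^sub>R f) = (\<Sum>f\<in>F. c f *\<^sub>R f)"
          using insert by (intro sum.cong) auto
        then show "\<exists>ca. t *\<^sub>R e + (\<Sum>e\<in>F. c e *\<^sub>R e) = (\<Sum>e\<in>insert e F. ca e *\<^sub>R e) \<and> (\<forall>e. \<bar>ca e\<bar> \<le> 1)"
          using insert * by (intro exI[of _ "c(e := t)"]) auto
      qed
    qed
    moreover have "compact ?R"
      by (intro compact_continuous_image compact_Times insert.IH)
         (auto simp: case_prod_unfold intro!: continuous_intros)
    ultimately show ?case by simp
  qed
  moreover have "closed (sphere 0 1 :: 'h set)"
    unfolding sphere_def by (intro closed_Collect_eq continuous_intros)
  ultimately have "compact (?K E \<inter> sphere 0 1)"
    by (rule compact_Int_closed)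
  moreover have "?K E \<inter> sphere 0 1 = span S \<inter> sphere 0 1"
  proof (intro set_eqI iffI)
    fix z assume "z \<in> ?K E \<inter> sphere 0 1"
    then obtain c where z: "z = (\<Sum>e\<in>E. c e *\<^sub>R e)" "z \<in> sphere 0 1"
      by blast
    have "z \<in> span E"
      unfolding z(1) by (intro span_sum span_scale span_base)
    then show "z \<in> span S \<inter> sphere 0 1"
      using z(2) E(2) by blast
  next
    fix z assume z: "z \<in> span S \<inter> sphere 0 1"
    \<comment> \<open>\<open>?K\<close> constrains the coefficient at every vector, so it is set to
      0 outside \<open>E\<close>.\<close>
    define c where "c e = (if e \<in> E then e \<bullet> z else 0)" for e
    have "(\<Sum>e\<in>E. c e *\<^sub>R e) = (\<Sum>e\<in>E. (e \<bullet> z) *\<^sub>R e)"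
      by (rule sum.cong) (simp_all add: c_def)
    then have "z = (\<Sum>e\<in>E. c e *\<^sub>R e)"
      using orthonormal_expansion[OF E(1), of z] z E(2) by simp
    moreover have "\<forall>e. \<bar>c e\<bar> \<le> 1"
    proof
      fix e show "\<bar>c e\<bar> \<le> 1"
        using E(1) z Cauchy_Schwarz_ineq2[of e z] by (auto simp: orthonormal_def c_def)
    qed
    ultimately show "z \<in> ?K E \<inter> sphere 0 1"
      using z by blast
  qed
  ultimately show ?thesis by simp
qed

text \<open>A maximiser of the quadratic form on the unit sphere of the span is an eigenvector:
  otherwise a small move of \<open>v\<close> against the residual \<open>l *\<^sub>R v - A v\<close>
  would raise the Rayleigh quotient.\<close>

lemma symmetric_eigenvector:
  fixes A :: "'h::real_inner \<Rightarrow>\<^sub>L 'h"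
  assumes sym: "\<And>x y. A x \<bullet> y = x \<bullet> A y"
    and "finite S" and inv: "\<And>z. z \<in> span S \<Longrightarrow> A z \<in> span S" and ne: "span S \<noteq> {0}"
  obtains v l where "v \<in> span S" "norm v = 1" "A v = l *\<^sub>R v"
proof -
  have "span S \<inter> sphere 0 1 \<noteq> {}"
  proof -
    obtain z where z: "z \<in> span S" "z \<noteq> 0"
      using ne span_zero by blast
    then have "z /\<^sub>R norm z \<in> span S \<inter> sphere 0 1"
      by (auto intro: span_scale)
    then show ?thesis by blast
  qed
  moreover have "continuous_on (span S \<inter> sphere 0 1) (\<lambda>z. z \<bullet> A z)"
    by (intro continuous_intros)
  ultimately obtain v where v: "v \<in> span S" "norm v = 1"
    and max: "\<And>z. z \<in> span S \<Longrightarrow> norm z = 1 \<Longrightarrow> z \<bullet> A z \<le> v \<bullet> A v"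
    using continuous_attains_sup[OF compact_span_sphere[OF assms(2)]] by fastforce
  define l where "l = v \<bullet> A v"
  have max': "z \<bullet> A z \<le> l * (z \<bullet> z)" if z: "z \<in> span S" for z
  proof (cases "z = 0")
    case False
    have "(z /\<^sub>R norm z) \<bullet> A (z /\<^sub>R norm z) \<le> l"
      unfolding l_def using z False by (intro max) (auto intro: span_scale)
    then have "z \<bullet> A z / (norm z)\<^sup>2 \<le> l"
      by (simp add: blinfun.scaleR_right power2_eq_square divide_inverse mult_ac)
    then show ?thesis
      using False by (simp add: divide_le_eq power2_norm_eq_inner)
  qed (simp add: blinfun.zero_right)
  define d where "d = l *\<^sub>R v - A v"
  have d: "d \<in> span S"
    unfolding d_def using v(1) by (intro span_diff span_scale inv)
  have vv: "v \<bullet> v = 1" using v(2) by (simp add: norm_eq_1)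
  have "0 \<le> l * (d \<bullet> d) - d \<bullet> A d" using max'[OF d] by simp
  \<comment> \<open>The Rayleigh inequality at \<open>v + t *\<^sub>R d\<close>. The constant term
    vanishes by the choice of \<open>l\<close>, and the linear term is exactly
    \<open>2 * t * (d \<bullet> d)\<close>.\<close>
  have quad: "0 \<le> 2 * t * (d \<bullet> d) + t\<^sup>2 * (l * (d \<bullet> d) - d \<bullet> A d)" for t
  proof -
    have "0 \<le> l * ((v + t *\<^sub>R d) \<bullet> (v + t *\<^sub>R d)) - (v + t *\<^sub>R d) \<bullet> A (v + t *\<^sub>R d)"
      using max'[of "v + t *\<^sub>R d"] v(1) d by (auto intro: span_add span_scale)
    also have "\<dots> = l * (v \<bullet> v) - v \<bullet> A v + 2 * t * (l * (v \<bullet> d) - d \<bullet> A v)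
        + t\<^sup>2 * (l * (d \<bullet> d) - d \<bullet> A d)"
      using sym[of v d]
      by (simp add: blinfun.add_right blinfun.scaleR_right inner_add power2_eq_square algebra_simps inner_commute)
    also have "l * (v \<bullet> v) - v \<bullet> A v = 0" by (simp add: vv l_def)
    also have "l * (v \<bullet> d) - d \<bullet> A v = d \<bullet> d"
      by (simp add: d_def inner_diff inner_commute algebra_simps)
    finally show ?thesis by simp
  qed
  have "d = 0"
  proof (rule ccontr)
    assume "d \<noteq> 0"
    then have pos: "d \<bullet> d > 0" by simp
    define k where "k = l * (d \<bullet> d) - d \<bullet> A d"
    have k: "k \<ge> 0" unfolding k_def by fact
    \<comment> \<open>Negative, and so small that the quadratic term cannot outweigh the linear one;
      \<open>1 + k\<close> avoids division by 0.\<close>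
    define t where "t = - (d \<bullet> d) / (1 + k)"
    have "t < 0" "t * k \<ge> - (d \<bullet> d)"
      unfolding t_def using pos k by (auto simp: field_simps)
    then have "t * (2 * (d \<bullet> d) + t * k) < 0"
      using pos by (intro mult_neg_pos) (use pos in linarith)+
    then show False
      using quad[of t] by (simp add: k_def power2_eq_square algebra_simps)
  qed
  then show ?thesis
    using that[of v l] v by (simp add: d_def)
qed

text \<open>Deflation: by symmetry the orthogonal complement of \<open>v\<close> inside the span is
  again invariant, and it is spanned by fewer vectors, the projections of all basis vectors but
  one.\<close>

lemma symmetric_eigenbasis:
  fixes A :: "'h::real_inner \<Rightarrow>\<^sub>L 'h"
  assumes sym: "\<And>x y. A x \<bullet> y = x \<bullet> A y"
    and "finite S" and "\<And>z. z \<in> span S \<Longrightarrow> A z \<in> span S"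
  shows "\<exists>E. orthonormal E \<and> span E = span S \<and> (\<forall>e\<in>E. \<exists>l. A e = l *\<^sub>R e)"
  using assms(2,3)
proof (induction "card S" arbitrary: S rule: less_induct)
  case less
  show ?case
  proof (cases "span S = {0}")
    case True
    then show ?thesis
      by (intro exI[of _ "{}"]) (auto simp: orthonormal_def)
  next
    case False
    obtain v l where v: "v \<in> span S" "norm v = 1" "A v = l *\<^sub>R v"
      using symmetric_eigenvector[OF sym less.prems False] by metis
    then have vv: "v \<bullet> v = 1" by (simp add: norm_eq_1)
    obtain B where B: "orthonormal B" "span B = span S" "card B \<le> card S"
      using orthonormal_basis_span[OF less.prems(1)] by metis
    have vB: "(\<Sum>e\<in>B. (e \<bullet> v) *\<^sub>R e) = v"
      using orthonormal_expansion[OF B(1)] v(1) B(2) by simp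
    \<comment> \<open>The dropped vector needs a nonzero coefficient in \<open>v\<close>: projecting
      the expansion of \<open>v\<close> gives 0, a relation that can then be solved for
      \<open>P e0\<close>.\<close>
    then obtain e0 where e0: "e0 \<in> B" "e0 \<bullet> v \<noteq> 0"
      using v(2) by (metis (no_types, lifting) norm_zero scaleR_eq_0_iff sum.neutral zero_neq_one)
    define P where "P = (\<lambda>z. z - (z \<bullet> v) *\<^sub>R v)"
    have linP: "linear P"
      unfolding P_def by (rule linearI) (auto simp: inner_add algebra_simps)
    have Pspan: "P z \<in> span S" "P z \<bullet> v = 0" if "z \<in> span S" for z
      unfolding P_def using that v(1) vv by (auto intro: span_diff span_scale simp: inner_diff)
    define S' where "S' = P ` (B - {e0})"
    have finB: "finite B" using B(1) by (rule orthonormal_finite)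
    have "card S' < card B"
      unfolding S'_def using finB e0(1) by (meson card_Diff1_less card_image_le finite_Diff order_le_less_trans)
    then have cardS': "card S' < card S" using B(3) by simp
    have finS': "finite S'" using finB by (simp add: S'_def)
    have S'_le: "S' \<subseteq> {z \<in> span S. z \<bullet> v = 0}"
      using Pspan span_base[of _ B] B(2) by (auto simp: S'_def)
    have perp: "subspace {z \<in> span S. z \<bullet> v = 0}"
      unfolding subspace_def by (auto intro: span_zero span_add span_scale simp: inner_add)
    have spanS': "span S' = {z \<in> span S. z \<bullet> v = 0}"
    proof
      show "span S' \<subseteq> {z \<in> span S. z \<bullet> v = 0}"
        using S'_le perp by (rule span_minimal)
      have Pe0: "P e0 \<in> span S'"
      proof -
        have "0 = P v" by (simp add: P_def vv)
        also have "\<dots> = P (\<Sum>e\<in>B. (e \<bullet> v) *\<^sub>R e)" using vB by simp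
        also have "\<dots> = (\<Sum>e\<in>B. (e \<bullet> v) *\<^sub>R P e)"
          by (simp add: linear_sum[OF linP] linear_scale[OF linP])
        also have "\<dots> = (e0 \<bullet> v) *\<^sub>R P e0 + (\<Sum>e\<in>B - {e0}. (e \<bullet> v) *\<^sub>R P e)"
          using finB e0(1) by (rule sum.remove)
        finally have "(e0 \<bullet> v) *\<^sub>R P e0 = - (\<Sum>e\<in>B - {e0}. (e \<bullet> v) *\<^sub>R P e)"
          by (simp add: eq_neg_iff_add_eq_0)
        also have "\<dots> \<in> span S'"
          unfolding S'_def by (intro span_neg span_sum span_scale span_base) auto
        finally have "(1 / (e0 \<bullet> v)) *\<^sub>R ((e0 \<bullet> v) *\<^sub>R P e0) \<in> span S'" by (rule span_scale)
        then show ?thesis using e0(2) by simp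
      qed
      have "P ` B \<subseteq> span S'"
        using Pe0 by (auto simp: S'_def intro: span_base)
      then have "span (P ` B) \<subseteq> span S'" by (simp add: span_minimal)
      then have "P z \<in> span S'" if "z \<in> span S" for z
        using that B(2) linear_span_image[OF linP, of B] by auto
      then show "{z \<in> span S. z \<bullet> v = 0} \<subseteq> span S'"
        by (force simp: P_def)
    qed
    have "A z \<in> span S'" if "z \<in> span S'" for z
      using that less.prems(2) v(3) sym[of z v] by (auto simp: spanS')
    then obtain E where E: "orthonormal E" "span E = span S'" "\<And>e. e \<in> E \<Longrightarrow> \<exists>l. A e = l *\<^sub>R e"
      using less.hyps[OF cardS' finS'] by blast
    have Ev: "e \<bullet> v = 0" if "e \<in> E" for e
      using that E(2) spanS' span_base by blast
    have "orthonormal (insert v E)"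
      using E(1) v(2) Ev
      by (auto simp: orthonormal_def pairwise_insert orthogonal_def inner_commute)
    moreover have "span (insert v E) = span S"
    proof
      show "span (insert v E) \<subseteq> span S"
        using v(1) E(2) spanS' span_base[of _ E] by (intro span_minimal) auto
      show "span S \<subseteq> span (insert v E)"
      proof
        fix z assume "z \<in> span S"
        then have "P z \<in> span E" using Pspan E(2) spanS' by auto
        then show "z \<in> span (insert v E)"
          unfolding span_insert P_def by auto
      qed
    qed
    moreover have "\<forall>e\<in>insert v E. \<exists>l. A e = l *\<^sub>R e"
      using E(3) v(3) by auto
    ultimately show ?thesis by blast
  qed
qed

section \<open>Spectral decomposition and square root\<close>

lemma psd_opD:
  assumes "psd_op A"
  shows "A x \<bullet> y = x \<bullet> A y" "0 \<le> x \<bullet> A x"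
  using assms by (auto simp: psd_op_def)

text \<open>The formula holds on the whole space and not only on the span: \<open>A z\<close> is
  expanded instead of \<open>z\<close>, and symmetry moves \<open>A\<close> onto the
  eigenvectors.\<close>

lemma psd_spectral:
  fixes A :: "'h::real_inner \<Rightarrow>\<^sub>L 'h"
  assumes psd: "psd_op A" and "finite S" and range: "\<And>z. A z \<in> span S"
  obtains E l where "orthonormal E" "span E = span S" "\<And>e. e \<in> E \<Longrightarrow> 0 \<le> l e"
    "\<And>z. A z = (\<Sum>e\<in>E. (l e * (e \<bullet> z)) *\<^sub>R e)"
proof -
  obtain E where E: "orthonormal E" "span E = span S" "\<And>e. e \<in> E \<Longrightarrow> \<exists>l. A e = l *\<^sub>R e"
    using symmetric_eigenbasis[of A S] psd_opD(1)[OF psd] assms(2) range by metis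
  define l where "l e = e \<bullet> A e" for e
  have l: "A e = l e *\<^sub>R e" if e: "e \<in> E" for e
    using E(3)[OF e] orthonormal_inner[OF E(1) e e] by (auto simp: l_def)
  have "A z = (\<Sum>e\<in>E. (l e * (e \<bullet> z)) *\<^sub>R e)" for z
  proof -
    have "A z = (\<Sum>e\<in>E. (e \<bullet> A z) *\<^sub>R e)"
      using orthonormal_expansion[OF E(1), of "A z"] range E(2) by simp
    also have "\<dots> = (\<Sum>e\<in>E. (l e * (e \<bullet> z)) *\<^sub>R e)"
      by (intro sum.cong) (auto simp: psd_opD(1)[OF psd, symmetric] l)
    finally show ?thesis .
  qed
  moreover have "0 \<le> l e" for e
    using psd_opD(2)[OF psd] by (simp add: l_def)
  ultimately show ?thesis
    using that E(1,2) by blast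
qed

text \<open>The properties by which \<open>SOME\<close> selects follow once one root is exhibited:
  \<open>sqrt c\<close> on the complement of the eigenbasis and \<open>sqrt (c + l e)\<close> along
  each \<open>e\<close>.\<close>

lemma op_sqrt_psd:
  fixes A :: "'h::real_inner \<Rightarrow>\<^sub>L 'h"
  assumes psd: "psd_op A" and "finite S" "\<And>z. A z \<in> span S" and c: "0 \<le> c"
  shows "psd_op (op_sqrt (A + c *\<^sub>R id_blinfun))"
    "op_sqrt (A + c *\<^sub>R id_blinfun) o\<^sub>L op_sqrt (A + c *\<^sub>R id_blinfun) = A + c *\<^sub>R id_blinfun"
proof -
  obtain E l where E: "orthonormal E" and l: "\<And>e. e \<in> E \<Longrightarrow> 0 \<le> l e"
    and A: "\<And>z. A z = (\<Sum>e\<in>E. (l e * (e \<bullet> z)) *\<^sub>R e)"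
    using psd_spectral[OF assms(1-3)] by metis
  define s where "s e = sqrt (c + l e)" for e
  define R where "R = sqrt c *\<^sub>R id_blinfun + (\<Sum>e\<in>E. (s e - sqrt c) *\<^sub>R rank_one e)"
  have R: "R z = sqrt c *\<^sub>R z + (\<Sum>e\<in>E. ((s e - sqrt c) * (e \<bullet> z)) *\<^sub>R e)" for z
    unfolding R_def
    by (simp add: blinfun.add_left blinfun.scaleR_left blinfun.sum_left rank_one_apply)
  have "psd_op R"
    unfolding psd_op_def
  proof (intro conjI allI)
    show "R u \<bullet> v = u \<bullet> R v" for u v
      by (simp add: R inner_add inner_sum_left inner_sum_right inner_commute mult_ac)
    show "0 \<le> u \<bullet> R u" for u
    proof -
      have "u \<bullet> R u = sqrt c * (u \<bullet> u) + (\<Sum>e\<in>E. (s e - sqrt c) * (e \<bullet> u)\<^sup>2)"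
        by (simp add: R inner_add inner_sum_right inner_commute power2_eq_square mult_ac)
      also have "\<dots> \<ge> 0"
        using c l by (intro add_nonneg_nonneg sum_nonneg mult_nonneg_nonneg) (auto simp: s_def)
      finally show ?thesis .
    qed
  qed
  moreover have "R o\<^sub>L R = A + c *\<^sub>R id_blinfun"
  proof (rule blinfun_eqI)
    fix z
    have eR: "e \<bullet> R z = s e * (e \<bullet> z)" if e: "e \<in> E" for e
      unfolding R inner_add orthonormal_coeff[OF E e] by (simp add: algebra_simps)
    have "(R o\<^sub>L R) z = sqrt c *\<^sub>R R z + (\<Sum>e\<in>E. ((s e - sqrt c) * (s e * (e \<bullet> z))) *\<^sub>R e)"
      using eR by (simp add: R[of "R z"])
    also have "\<dots> = c *\<^sub>R z + (\<Sum>e\<in>E. (sqrt c * (s e - sqrt c) * (e \<bullet> z) + (s e - sqrt c) * (s e * (e \<bullet> z))) *\<^sub>R e)"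
      using c by (simp add: R scaleR_add_right scaleR_sum_right sum.distrib scaleR_add_left mult_ac)
    also have "(\<Sum>e\<in>E. (sqrt c * (s e - sqrt c) * (e \<bullet> z) + (s e - sqrt c) * (s e * (e \<bullet> z))) *\<^sub>R e) = A z"
      unfolding A
    proof (intro sum.cong arg_cong2[of _ _ _ _ scaleR] refl)
      fix e assume e: "e \<in> E"
      have "(s e)\<^sup>2 = c + l e" "(sqrt c)\<^sup>2 = c" using c l[OF e] by (auto simp: s_def)
      then have "sqrt c * (s e - sqrt c) + (s e - sqrt c) * s e = l e"
        by (simp add: algebra_simps power2_eq_square)
      then show "sqrt c * (s e - sqrt c) * (e \<bullet> z) + (s e - sqrt c) * (s e * (e \<bullet> z)) = l e * (e \<bullet> z)"
        by (metis distrib_right mult.assoc)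
    qed
    finally show "(R o\<^sub>L R) z = (A + c *\<^sub>R id_blinfun) z"
      by (simp add: blinfun.add_left blinfun.scaleR_left)
  qed
  ultimately have "psd_op R \<and> R o\<^sub>L R = A + c *\<^sub>R id_blinfun" by blast
  then have "psd_op (op_sqrt (A + c *\<^sub>R id_blinfun)) \<and>
      op_sqrt (A + c *\<^sub>R id_blinfun) o\<^sub>L op_sqrt (A + c *\<^sub>R id_blinfun) = A + c *\<^sub>R id_blinfun"
    unfolding op_sqrt_def by (rule someI)
  then show "psd_op (op_sqrt (A + c *\<^sub>R id_blinfun))"
    "op_sqrt (A + c *\<^sub>R id_blinfun) o\<^sub>L op_sqrt (A + c *\<^sub>R id_blinfun) = A + c *\<^sub>R id_blinfun"
    by auto
qed


subsection \<open>Information gain\<close>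

text \<open>Grouping the eigenbasis by eigenvalue turns the sum weighted by multiplicities into a
  plain finite sum. For \<open>m \<noteq> 0\<close> an eigenvector lies in the span of
  \<open>E\<close> because the range of \<open>A\<close> does.\<close>

lemma info_gain_eigenbasis:
  fixes A :: "'h::real_inner \<Rightarrow>\<^sub>L 'h"
  assumes E: "orthonormal E" and l: "\<And>e. e \<in> E \<Longrightarrow> 0 \<le> l e"
    and A: "\<And>z. A z = (\<Sum>e\<in>E. (l e * (e \<bullet> z)) *\<^sub>R e)"
  shows "2 * info_gain A = (\<Sum>e\<in>E. ln (1 + l e))"
proof -
  have fin: "finite E" using E by (rule orthonormal_finite)
  have Ae: "A e = l e *\<^sub>R e" if e: "e \<in> E" for e
  proof -
    have "A e = (\<Sum>f\<in>E. if f = e then l e *\<^sub>R e else 0)"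
      unfolding A using orthonormal_inner[OF E _ e] by (intro sum.cong) auto
    then show ?thesis using fin e by simp
  qed
  have eig: "eigenspace A m = span {e \<in> E. l e = m}" if m: "m \<noteq> 0" for m
  proof
    have "subspace (eigenspace A m)"
      unfolding subspace_def eigenspace_def
      by (auto simp: blinfun.zero_right blinfun.add_right blinfun.scaleR_right algebra_simps)
    then show "span {e \<in> E. l e = m} \<subseteq> eigenspace A m"
      by (intro span_minimal) (auto simp: eigenspace_def Ae)
    show "eigenspace A m \<subseteq> span {e \<in> E. l e = m}"
    proof
      fix z assume "z \<in> eigenspace A m"
      then have z: "A z = m *\<^sub>R z" by (simp add: eigenspace_def)
      have "e \<bullet> z = 0" if e: "e \<in> E" and "l e \<noteq> m" for e
        using orthonormal_coeff[OF E e, of "\<lambda>e. l e * (e \<bullet> z)"] z that(2) A[of z] by simp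
      then have "A z = (\<Sum>e\<in>E. if l e = m then (m * (e \<bullet> z)) *\<^sub>R e else 0)"
        unfolding A by (intro sum.cong) auto
      also have "\<dots> = (\<Sum>e\<in>{e \<in> E. l e = m}. (m * (e \<bullet> z)) *\<^sub>R e)"
        using fin by (simp add: sum.inter_filter)
      also have "\<dots> \<in> span {e \<in> E. l e = m}"
        by (intro span_sum span_scale span_base)
      finally have "(1 / m) *\<^sub>R A z \<in> span {e \<in> E. l e = m}" by (rule span_scale)
      then show "z \<in> span {e \<in> E. l e = m}" using z m by simp
    qed
  qed
  have dim: "dim (eigenspace A m) = card {e \<in> E. l e = m}" if "m \<noteq> 0" for m
    unfolding eig[OF that] dim_span
    by (intro dim_eq_card_independent orthonormal_independent orthonormal_subset[OF E]) auto
  have "{m. m \<noteq> 0 \<and> eigenspace A m \<noteq> {0}} = l ` E - {0}"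
  proof (intro set_eqI iffI)
    fix m assume "m \<in> {m. m \<noteq> 0 \<and> eigenspace A m \<noteq> {0}}"
    then have "m \<noteq> 0" "span {e \<in> E. l e = m} \<noteq> {0}" using eig by auto
    moreover from this have "{e \<in> E. l e = m} \<noteq> {}" by (metis span_empty)
    ultimately show "m \<in> l ` E - {0}" by blast
  next
    fix m assume "m \<in> l ` E - {0}"
    then obtain e where e: "e \<in> E" "l e = m" "m \<noteq> 0" by blast
    then have "e \<in> eigenspace A m" "e \<noteq> 0" using Ae E by (auto simp: eigenspace_def orthonormal_def)
    then show "m \<in> {m. m \<noteq> 0 \<and> eigenspace A m \<noteq> {0}}" using e(3) by blast
  qed
  then have "ln (fredholm_det A) = (\<Sum>m\<in>l ` E - {0}. real (dim (eigenspace A m)) * ln (1 + m))"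
    using fin by (simp add: fredholm_det_def)
  also have "\<dots> = (\<Sum>m\<in>l ` E - {0}. \<Sum>e\<in>{e \<in> E. l e = m}. ln (1 + l e))"
    by (intro sum.cong) (auto simp: dim)
  \<comment> \<open>Including the eigenvalue 0 adds only terms \<open>ln (1 + 0)\<close>.\<close>
  also have "\<dots> = (\<Sum>m\<in>l ` E. \<Sum>e\<in>{e \<in> E. l e = m}. ln (1 + l e))"
    using fin by (intro sum.mono_neutral_left) auto
  also have "\<dots> = (\<Sum>e\<in>E. ln (1 + l e))"
    using fin by (rule sum.image_gen[symmetric])
  finally show ?thesis by (simp add: info_gain_def)
qed

lemma info_gain_nonneg:
  fixes A :: "'h::real_inner \<Rightarrow>\<^sub>L 'h"
  assumes "psd_op A" "finite S" "\<And>z. A z \<in> span S"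
  shows "0 \<le> info_gain A"
proof -
  obtain E l where E: "orthonormal E" and l: "\<And>e. e \<in> E \<Longrightarrow> 0 \<le> l e"
    and A: "\<And>z. A z = (\<Sum>e\<in>E. (l e * (e \<bullet> z)) *\<^sub>R e)"
    using psd_spectral[OF assms] by metis
  have "0 \<le> (\<Sum>e\<in>E. ln (1 + l e))"
    by (intro sum_nonneg) (auto simp: l)
  then show ?thesis
    using info_gain_eigenbasis[OF E l A] by simp
qed

text \<open>Concavity of \<open>log det\<close>, proved by comparing two eigenbases: the squared inner products
  \<open>(e \<bullet> e')\<^sup>2\<close> form a doubly stochastic matrix, so \<open>ln a - ln a' \<le> a / a' - 1\<close> may be averaged
  over pairs of eigenvalues.\<close>

lemma info_gain_increment:
  fixes A A' :: "'h::real_inner \<Rightarrow>\<^sub>L 'h"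
  assumes psd: "psd_op A" "psd_op A'" and S: "finite S"
    and range: "\<And>z. A z \<in> span S" "\<And>z. A' z \<in> span S" and x: "x \<in> span S"
    and le: "\<And>z. z \<bullet> A z + w * (x \<bullet> z)\<^sup>2 \<le> z \<bullet> A' z"
    and y: "y + A' y = x"
  shows "2 * info_gain A + w * (x \<bullet> y) \<le> 2 * info_gain A'"
proof -
  obtain E l where E: "orthonormal E" "span E = span S" and l: "\<And>e. e \<in> E \<Longrightarrow> 0 \<le> l e"
    and A: "\<And>z. A z = (\<Sum>e\<in>E. (l e * (e \<bullet> z)) *\<^sub>R e)"
    using psd_spectral[OF psd(1) S range(1)] by metis
  obtain F k where F: "orthonormal F" "span F = span S" and k: "\<And>f. f \<in> F \<Longrightarrow> 0 \<le> k f"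
    and A': "\<And>z. A' z = (\<Sum>f\<in>F. (k f * (f \<bullet> z)) *\<^sub>R f)"
    using psd_spectral[OF psd(2) S range(2)] by metis
  have inE: "e \<in> span F" if "e \<in> E" for e using that E(2) F(2) span_base by blast
  have inF: "f \<in> span E" if "f \<in> F" for f using that E(2) F(2) span_base by blast
  define p where "p e f = (e \<bullet> f)\<^sup>2" for e f :: 'h
  have pF: "(\<Sum>f\<in>F. p e f) = 1" if e: "e \<in> E" for e
    using orthonormal_parseval[OF F(1) inE[OF e], of e] orthonormal_inner[OF E(1) e e]
    by (simp add: p_def power2_eq_square inner_commute)
  have pE: "(\<Sum>e\<in>E. p e f) = 1" if f: "f \<in> F" for f
    using orthonormal_parseval[OF E(1) inF[OF f], of f] orthonormal_inner[OF F(1) f f]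
    by (simp add: p_def power2_eq_square)
  \<comment> \<open>In the basis \<open>F\<close> the equation for \<open>y\<close> is diagonal,
    which gives the form \<open>fx\<close> of \<open>x \<bullet> y\<close>.\<close>
  have fy: "(1 + k f) * (f \<bullet> y) = f \<bullet> x" if f: "f \<in> F" for f
    using orthonormal_coeff[OF F(1) f, of "\<lambda>f. k f * (f \<bullet> y)"] A'[of y] y[symmetric]
    by (simp add: inner_add algebra_simps)
  have fx: "(\<Sum>f\<in>F. (f \<bullet> x)\<^sup>2 / (1 + k f)) = x \<bullet> y"
  proof -
    have "x \<bullet> y = (\<Sum>f\<in>F. (f \<bullet> x) * (f \<bullet> y))"
      using x F by (intro orthonormal_parseval) auto
    also have "\<dots> = (\<Sum>f\<in>F. (f \<bullet> x)\<^sup>2 / (1 + k f))"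
    proof (intro sum.cong refl)
      fix f assume f: "f \<in> F"
      have "f \<bullet> y = (f \<bullet> x) / (1 + k f)"
        using fy[OF f] k[OF f] by (simp add: field_simps)
      then show "(f \<bullet> x) * (f \<bullet> y) = (f \<bullet> x)\<^sup>2 / (1 + k f)"
        by (simp add: power2_eq_square)
    qed
    finally show ?thesis by simp
  qed
  \<comment> \<open>Each sum is multiplied by a row or column sum of \<open>p\<close>, which is 1,
    so that both run over all pairs.\<close>
  have "(\<Sum>e\<in>E. ln (1 + l e)) - (\<Sum>f\<in>F. ln (1 + k f))
      = (\<Sum>e\<in>E. \<Sum>f\<in>F. p e f * ln (1 + l e)) - (\<Sum>f\<in>F. \<Sum>e\<in>E. p e f * ln (1 + k f))"
    by (simp add: sum_distrib_right[symmetric] pE pF)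
  also have "\<dots> = (\<Sum>f\<in>F. \<Sum>e\<in>E. p e f * (ln (1 + l e) - ln (1 + k f)))"
    by (subst sum.swap) (simp add: sum_subtractf[symmetric] algebra_simps)
  also have "\<dots> \<le> (\<Sum>f\<in>F. \<Sum>e\<in>E. p e f * ((1 + l e) / (1 + k f) - 1))"
  proof (intro sum_mono mult_left_mono)
    fix f e assume "f \<in> F" "e \<in> E"
    then have "0 < 1 + l e" "0 < 1 + k f" using l[of e] k[of f] by auto
    then show "ln (1 + l e) - ln (1 + k f) \<le> (1 + l e) / (1 + k f) - 1"
      using ln_diff_le[of "1 + l e" "1 + k f"] diff_divide_distrib[of "1 + l e" "1 + k f" "1 + k f"]
      by simp
  qed (simp add: p_def)
  also have "\<dots> \<le> (\<Sum>f\<in>F. - w * ((f \<bullet> x)\<^sup>2 / (1 + k f)))"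
  proof (rule sum_mono)
    fix f assume f: "f \<in> F"
    have kf: "0 < 1 + k f" using k[OF f] by simp
    \<comment> \<open>The \<open>p\<close>-average of the eigenvalues of \<open>A\<close> is its
      quadratic form at \<open>f\<close>; here the comparison \<open>le\<close> enters.\<close>
    have "(\<Sum>e\<in>E. p e f * l e) = f \<bullet> A f"
      by (simp add: A inner_sum_right p_def power2_eq_square inner_commute mult_ac)
    also have "\<dots> \<le> f \<bullet> A' f - w * (f \<bullet> x)\<^sup>2"
      using le[of f] by (simp add: inner_commute)
    also have "f \<bullet> A' f = k f"
      using orthonormal_coeff[OF F(1) f, of "\<lambda>g. k g * (g \<bullet> f)"] orthonormal_inner[OF F(1) f f]
      by (simp add: A')
    finally have "(\<Sum>e\<in>E. p e f * (1 + l e)) \<le> 1 + k f - w * (f \<bullet> x)\<^sup>2"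
      by (simp add: distrib_left sum.distrib pE[OF f])
    then have "(\<Sum>e\<in>E. p e f * (1 + l e)) / (1 + k f) \<le> (1 + k f - w * (f \<bullet> x)\<^sup>2) / (1 + k f)"
      using kf by (intro divide_right_mono) auto
    moreover have "(\<Sum>e\<in>E. p e f * ((1 + l e) / (1 + k f) - 1))
        = (\<Sum>e\<in>E. p e f * (1 + l e)) / (1 + k f) - 1"
      by (simp add: right_diff_distrib sum_subtractf pE[OF f] sum_divide_distrib)
    ultimately show "(\<Sum>e\<in>E. p e f * ((1 + l e) / (1 + k f) - 1)) \<le> - w * ((f \<bullet> x)\<^sup>2 / (1 + k f))"
      using kf by (simp add: diff_divide_distrib)
  qed
  also have "\<dots> = - w * (x \<bullet> y)"
    unfolding fx[symmetric] by (simp only: sum_distrib_left)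
  finally show ?thesis
    using info_gain_eigenbasis[OF E(1) l A] info_gain_eigenbasis[OF F(1) k A'] by simp
qed


section \<open>Weighted design operators and their resolvents\<close>

definition wdesign :: "(nat \<Rightarrow> real) \<Rightarrow> (nat \<Rightarrow> 'h::real_inner) \<Rightarrow> nat \<Rightarrow> ('h \<Rightarrow>\<^sub>L 'h)" where
  "wdesign w x n = (\<Sum>j=1..n. w j *\<^sub>R rank_one (x j))"

lemma design_op_eq_wdesign: "design_op x n = wdesign (\<lambda>_. 1) x n"
  by (simp add: design_op_def wdesign_def)

lemma hess_op_eq_wdesign: "hess_op x n f = wdesign (\<lambda>j. logistic_var (f \<bullet> x j)) x n"
  by (simp add: hess_op_def wdesign_def)

lemma wdesign_apply: "wdesign w x n z = (\<Sum>j=1..n. (w j * (x j \<bullet> z)) *\<^sub>R x j)"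
  by (simp add: wdesign_def blinfun.sum_left blinfun.scaleR_left rank_one_apply)

lemma wdesign_Suc: "wdesign w x (Suc n) = wdesign w x n + w (Suc n) *\<^sub>R rank_one (x (Suc n))"
  by (simp add: wdesign_def)

lemma inner_wdesign: "u \<bullet> wdesign w x n v = (\<Sum>j=1..n. w j * (x j \<bullet> u) * (x j \<bullet> v))"
  by (simp add: wdesign_apply inner_sum_right inner_commute mult_ac)

lemma quad_wdesign: "v \<bullet> wdesign w x n v = (\<Sum>j=1..n. w j * (x j \<bullet> v)\<^sup>2)"
  by (simp add: inner_wdesign power2_eq_square mult_ac)

lemma psd_wdesign: "(\<And>j. 0 \<le> w j) \<Longrightarrow> psd_op (wdesign w x n)"
  unfolding psd_op_def
  by (auto simp: inner_commute[of "wdesign w x n _"] inner_wdesign mult_ac intro!: sum_nonneg)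

lemma wdesign_in_span: "wdesign w x n z \<in> span (x ` {1..n})"
  unfolding wdesign_apply by (intro span_sum span_scale span_base) auto

definition resolvent_arg ::
  "real \<Rightarrow> (nat \<Rightarrow> real) \<Rightarrow> (nat \<Rightarrow> 'h::real_inner) \<Rightarrow> nat \<Rightarrow> ('h \<Rightarrow>\<^sub>L 'h)" where
  "resolvent_arg \<rho> w x n = wdesign w x n + \<rho> *\<^sub>R id_blinfun"

text \<open>The inverse of \<open>resolvent_arg\<close> by the Sherman--Morrison recursion. The recursion makes the
  measurable dependence on the weights and arms evident.\<close>

fun resolvent ::
  "real \<Rightarrow> (nat \<Rightarrow> real) \<Rightarrow> (nat \<Rightarrow> 'h::real_inner) \<Rightarrow> nat \<Rightarrow> ('h \<Rightarrow>\<^sub>L 'h)" where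
  "resolvent \<rho> w x 0 = inverse \<rho> *\<^sub>R id_blinfun"
| "resolvent \<rho> w x (Suc n) = resolvent \<rho> w x n -
     (w (Suc n) / (1 + w (Suc n) * (x (Suc n) \<bullet> resolvent \<rho> w x n (x (Suc n))))) *\<^sub>R
       rank_one (resolvent \<rho> w x n (x (Suc n)))"

lemma resolvent_arg_Suc:
  "resolvent_arg \<rho> w x (Suc n) z = resolvent_arg \<rho> w x n z + (w (Suc n) * (x (Suc n) \<bullet> z)) *\<^sub>R x (Suc n)"
  by (simp add: resolvent_arg_def wdesign_Suc blinfun.add_left blinfun.scaleR_left rank_one_apply)

lemma quad_resolvent_arg:
  "v \<bullet> resolvent_arg \<rho> w x n v = (\<Sum>j=1..n. w j * (x j \<bullet> v)\<^sup>2) + \<rho> * (v \<bullet> v)"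
  by (simp add: resolvent_arg_def blinfun.add_left blinfun.scaleR_left inner_add quad_wdesign)

locale regularized_design =
  fixes \<rho> :: real and w :: "nat \<Rightarrow> real" and x :: "nat \<Rightarrow> 'h::real_inner"
  assumes \<rho>_pos: "0 < \<rho>" and w_nonneg: "\<And>j. 0 \<le> w j"
begin

abbreviation Z :: "nat \<Rightarrow> 'h \<Rightarrow>\<^sub>L 'h" where "Z n \<equiv> resolvent_arg \<rho> w x n"
abbreviation R :: "nat \<Rightarrow> 'h \<Rightarrow>\<^sub>L 'h" where "R n \<equiv> resolvent \<rho> w x n"

lemma Z_symmetric: "Z n u \<bullet> v = u \<bullet> Z n v"
  using psd_opD(1)[OF psd_wdesign[OF w_nonneg]]
  by (simp add: resolvent_arg_def blinfun.add_left blinfun.scaleR_left inner_add)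

lemma Z_ge: "\<rho> * (v \<bullet> v) \<le> v \<bullet> Z n v"
  unfolding quad_resolvent_arg using w_nonneg by (simp add: sum_nonneg)

lemma Z_nonneg: "0 \<le> v \<bullet> Z n v"
  using Z_ge[of v n] \<rho>_pos by (meson inner_ge_zero mult_nonneg_nonneg order_trans less_imp_le)

lemma Z_R: "Z n (R n v) = v"
proof (induction n arbitrary: v)
  case 0
  show ?case
    using \<rho>_pos by (simp add: resolvent_arg_def wdesign_def blinfun.scaleR_left)
next
  case (Suc n)
  let ?x = "x (Suc n)" and ?w = "w (Suc n)"
  \<comment> \<open>Symmetry turns the rank one correction, built from \<open>R n ?x\<close>, into a
    multiple of \<open>?x \<bullet> R n v\<close>.\<close>
  have sym: "R n u \<bullet> z = u \<bullet> R n z" for u z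
    using Z_symmetric[of n "R n u" "R n z"] Suc.IH by simp
  define q where "q = ?x \<bullet> R n ?x"
  have "0 \<le> q"
    using Z_nonneg[of "R n ?x" n] Suc.IH by (simp add: q_def inner_commute)
  then have pos: "0 < 1 + ?w * q"
    using w_nonneg by (simp add: add_pos_nonneg)
  define c where "c = ?w / (1 + ?w * q) * (?x \<bullet> R n v)"
  have R: "R (Suc n) v = R n v - c *\<^sub>R R n ?x"
    by (simp add: blinfun.diff_left blinfun.scaleR_left rank_one_apply sym q_def c_def)
  have "Z (Suc n) (R (Suc n) v) = v - c *\<^sub>R ?x + (?w * (?x \<bullet> R n v - c * q)) *\<^sub>R ?x"
    unfolding R resolvent_arg_Suc
    by (simp add: blinfun.diff_right blinfun.scaleR_right Suc.IH inner_diff q_def)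
  also have "?w * (?x \<bullet> R n v - c * q) = c"
    using pos by (simp add: c_def field_simps)
  finally show ?case by simp
qed

lemma R_symmetric: "R n u \<bullet> v = u \<bullet> R n v"
  using Z_symmetric[of n "R n u" "R n v"] by (simp add: Z_R)

lemma R_Z: "R n (Z n v) = v"
proof -
  define d where "d = R n (Z n v) - v"
  have "Z n d = 0" by (simp add: d_def blinfun.diff_right Z_R)
  then have "\<rho> * (d \<bullet> d) \<le> 0" using Z_ge[of d n] by simp
  then have "d \<bullet> d \<le> 0" using \<rho>_pos by (simp add: mult_le_0_iff)
  then have "d = 0" by (metis inner_ge_zero inner_eq_zero_iff order_antisym)
  then show ?thesis by (simp add: d_def)
qed

lemma R_nonneg: "0 \<le> v \<bullet> R n v"
  using Z_nonneg[of "R n v" n] by (simp add: Z_R inner_commute)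

text \<open>Completing the square: the left side is concave in \<open>f\<close> with maximiser
  \<open>R n v\<close>. Choosing a test vector \<open>f\<close> transfers order relations between
  the operators \<open>Z\<close> to their inverses.\<close>

lemma R_variational: "2 * (v \<bullet> f) - f \<bullet> Z n f \<le> v \<bullet> R n v"
proof -
  have "0 \<le> (f - R n v) \<bullet> Z n (f - R n v)" by (rule Z_nonneg)
  also have "\<dots> = f \<bullet> Z n f - 2 * (v \<bullet> f) + v \<bullet> R n v"
    using Z_symmetric[of n "R n v" f]
    by (simp add: blinfun.diff_right Z_R inner_diff inner_commute)
  finally show ?thesis by simp
qed

lemma R_upper: "v \<bullet> R n v \<le> (v \<bullet> v) / \<rho>"
proof -
  let ?r = "R n v"
  have "0 \<le> \<rho> * ((?r - v /\<^sub>R \<rho>) \<bullet> (?r - v /\<^sub>R \<rho>))" using \<rho>_pos by simp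
  also have "\<dots> = \<rho> * (?r \<bullet> ?r) - 2 * (v \<bullet> ?r) + (v \<bullet> v) / \<rho>"
    using \<rho>_pos by (simp add: inner_diff inner_commute field_simps)
  finally show ?thesis
    using Z_ge[of ?r n] by (simp add: Z_R inner_commute)
qed

text \<open>\<open>R_variational\<close> for multiples of \<open>f\<close>, at the scale that
  maximises its left side.\<close>

lemma dual_cauchy_schwarz: "(v \<bullet> f)\<^sup>2 \<le> (f \<bullet> Z n f) * (v \<bullet> R n v)"
proof -
  let ?a = "f \<bullet> Z n f"
  show ?thesis
  proof (cases "f = 0")
    case False
    then have a: "0 < ?a"
      using Z_ge[of f n] \<rho>_pos by (meson inner_gt_zero_iff mult_pos_pos less_le_trans)
    define t where "t = (v \<bullet> f) / ?a"
    have "2 * t * (v \<bullet> f) - t\<^sup>2 * ?a \<le> v \<bullet> R n v"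
      using R_variational[of v "t *\<^sub>R f" n]
      by (simp add: blinfun.scaleR_right power2_eq_square mult_ac)
    also have "2 * t * (v \<bullet> f) - t\<^sup>2 * ?a = (v \<bullet> f)\<^sup>2 / ?a"
      using a by (simp add: t_def power2_eq_square field_simps)
    finally show ?thesis
      using a by (simp add: divide_le_eq mult.commute)
  qed (simp add: blinfun.zero_right)
qed

text \<open>Relates the norms before an update, which the prediction gap needs, to those after it,
  which the potential bound controls.\<close>

lemma R_Suc_apply:
  "R (Suc n) (x (Suc n)) = R n (x (Suc n)) /\<^sub>R (1 + w (Suc n) * (x (Suc n) \<bullet> R n (x (Suc n))))"
proof -
  let ?x = "x (Suc n)" and ?w = "w (Suc n)"
  define q where "q = ?x \<bullet> R n ?x"
  have pos: "0 < 1 + ?w * q"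
    using w_nonneg R_nonneg by (simp add: add_pos_nonneg q_def)
  have "R (Suc n) ?x = (1 - ?w / (1 + ?w * q) * q) *\<^sub>R R n ?x"
    by (simp add: blinfun.diff_left blinfun.scaleR_left rank_one_apply R_symmetric q_def algebra_simps)
  also have "1 - ?w / (1 + ?w * q) * q = inverse (1 + ?w * q)"
    using pos by (simp add: field_simps)
  finally show ?thesis by (simp add: q_def)
qed

lemma op_sqrt_Z: "psd_op (op_sqrt (Z n))" "op_sqrt (Z n) o\<^sub>L op_sqrt (Z n) = Z n"
proof -
  show "psd_op (op_sqrt (Z n))"
    unfolding resolvent_arg_def
    by (rule op_sqrt_psd(1)[OF psd_wdesign[OF w_nonneg] _ wdesign_in_span]) (use \<rho>_pos in auto)
  show "op_sqrt (Z n) o\<^sub>L op_sqrt (Z n) = Z n"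
    unfolding resolvent_arg_def
    by (rule op_sqrt_psd(2)[OF psd_wdesign[OF w_nonneg] _ wdesign_in_span]) (use \<rho>_pos in auto)
qed

lemma norm_op_sqrt: "(norm (op_sqrt (Z n) v))\<^sup>2 = v \<bullet> Z n v"
proof -
  have "(norm (op_sqrt (Z n) v))\<^sup>2 = v \<bullet> (op_sqrt (Z n) o\<^sub>L op_sqrt (Z n)) v"
    using psd_opD(1)[OF op_sqrt_Z(1)] by (simp add: power2_norm_eq_inner)
  then show ?thesis by (simp add: op_sqrt_Z(2))
qed

lemma norm_op_inv_op_sqrt: "(norm (op_inv (op_sqrt (Z n)) v))\<^sup>2 = v \<bullet> R n v"
proof -
  define S where "S = op_sqrt (Z n)"
  have S: "psd_op S" "S o\<^sub>L S = Z n"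
    using op_sqrt_Z by (auto simp: S_def)
  have SS: "S (S z) = Z n z" for z using S(2) by (metis blinfun_apply_blinfun_compose)
  have "R n (S (S z)) = z" for z by (simp add: SS R_Z)
  moreover have "S (S (R n z)) = z" for z by (simp add: SS Z_R)
  \<comment> \<open>\<open>S\<close> commutes with its square, hence with the inverse
    \<open>R n\<close>; so \<open>S o\<^sub>L R n\<close> is a two-sided inverse and a witness for
    the \<open>SOME\<close> in \<open>op_inv\<close>.\<close>
  ultimately have "R n (S z) = S (R n z)" for z by metis
  then have "S o\<^sub>L (S o\<^sub>L R n) = id_blinfun \<and> (S o\<^sub>L R n) o\<^sub>L S = id_blinfun"
    by (auto intro!: blinfun_eqI simp: SS Z_R)
  then have inv: "S o\<^sub>L op_inv S = id_blinfun \<and> op_inv S o\<^sub>L S = id_blinfun"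
    unfolding op_inv_def by (rule someI)
  then have *: "S (op_inv S z) = z" for z by (metis blinfun_apply_blinfun_compose id_blinfun.rep_eq)
  have "(norm (op_inv S v))\<^sup>2 = op_inv S v \<bullet> S (op_inv S (op_inv S v))"
    by (simp add: power2_norm_eq_inner *)
  also have "\<dots> = v \<bullet> op_inv S (op_inv S v)"
    using psd_opD(1)[OF S(1), of "op_inv S v"] by (simp add: *)
  also have "op_inv S (op_inv S v) = R n v"
    using R_Z[of n "op_inv S (op_inv S v)"] by (simp add: SS[symmetric] *)
  finally show ?thesis by (simp add: S_def)
qed

section \<open>Information gain of weighted designs\<close>

lemma psd_scaled: "psd_op (inverse \<rho> *\<^sub>R wdesign w x n)"
proof -
  have "psd_op (wdesign w x n)" using w_nonneg by (rule psd_wdesign)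
  then show ?thesis using \<rho>_pos by (simp add: psd_op_def blinfun.scaleR_left)
qed

lemma scaled_in_span: "m \<le> n \<Longrightarrow> (inverse \<rho> *\<^sub>R wdesign w x m) z \<in> span (x ` {1..n})"
  using wdesign_in_span[of w x m z] span_mono[of "x ` {1..m}" "x ` {1..n}"]
  by (auto simp: blinfun.scaleR_left image_mono intro!: span_scale)

lemma info_gain_wdesign_nonneg: "0 \<le> info_gain (inverse \<rho> *\<^sub>R wdesign w x n)"
  by (rule info_gain_nonneg[OF psd_scaled _ scaled_in_span[OF order_refl]]) simp

text \<open>Telescoping of \<open>info_gain_increment\<close>. The resolvent at round
  \<open>j\<close> already contains \<open>x j\<close>, because concavity bounds an increment of log
  det from below by the derivative at the later point.\<close>

lemma elliptical_potential:
  "(\<Sum>j=1..n. w j * (x j \<bullet> R j (x j))) \<le> 2 * info_gain (inverse \<rho> *\<^sub>R wdesign w x n)"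
proof (induction n)
  case 0
  then show ?case using info_gain_wdesign_nonneg[of 0] by simp
next
  case (Suc n)
  let ?x = "x (Suc n)"
  \<comment> \<open>\<open>Z (Suc n)\<close> is \<rho> times the identity plus the scaled design, so
    the rescaled equation is solved by \<rho> times the resolvent.\<close>
  let ?y = "\<rho> *\<^sub>R R (Suc n) ?x"
  have "2 * info_gain (inverse \<rho> *\<^sub>R wdesign w x n) + w (Suc n) / \<rho> * (?x \<bullet> ?y)
      \<le> 2 * info_gain (inverse \<rho> *\<^sub>R wdesign w x (Suc n))"
  proof (rule info_gain_increment[OF psd_scaled psd_scaled])
    show "finite (x ` {1..Suc n})" by simp
    show "(inverse \<rho> *\<^sub>R wdesign w x n) z \<in> span (x ` {1..Suc n})"
      "(inverse \<rho> *\<^sub>R wdesign w x (Suc n)) z \<in> span (x ` {1..Suc n})" for z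
      by (intro scaled_in_span; simp)+
    show "?x \<in> span (x ` {1..Suc n})" by (intro span_base) auto
    show "z \<bullet> (inverse \<rho> *\<^sub>R wdesign w x n) z + w (Suc n) / \<rho> * (?x \<bullet> z)\<^sup>2
        \<le> z \<bullet> (inverse \<rho> *\<^sub>R wdesign w x (Suc n)) z" for z
      by (simp add: blinfun.scaleR_left quad_wdesign divide_inverse algebra_simps)
    show "?y + (inverse \<rho> *\<^sub>R wdesign w x (Suc n)) ?y = ?x"
      using Z_R[of "Suc n" ?x] \<rho>_pos
      by (simp add: resolvent_arg_def blinfun.add_left blinfun.scaleR_left blinfun.scaleR_right add.commute)
  qed
  then show ?case using Suc \<rho>_pos by simp
qed

end

text \<open>\<open>R_variational\<close> for the smaller weights, tested at the maximiser that
  belongs to the larger ones.\<close>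

lemma resolvent_antimono:
  assumes "0 < \<rho>" "\<And>j. 0 \<le> w j" "\<And>j. w j \<le> w' j"
  shows "v \<bullet> resolvent \<rho> w' x n v \<le> v \<bullet> resolvent \<rho> w x n v"
proof -
  interpret a: regularized_design \<rho> w x by unfold_locales (use assms in auto)
  interpret b: regularized_design \<rho> w' x by unfold_locales (use assms order_trans in blast)+
  let ?f = "b.R n v"
  have "?f \<bullet> a.Z n ?f \<le> ?f \<bullet> b.Z n ?f"
    unfolding quad_resolvent_arg by (intro add_mono sum_mono mult_right_mono assms order_refl) auto
  then show ?thesis
    using a.R_variational[of v ?f n] by (simp add: b.Z_R inner_commute)
qed

text \<open>\<open>info_gain_increment\<close> with the zero vector as rank one term. Growth in the
  weights and in the number of rounds is covered at once.\<close>

lemma info_gain_wdesign_mono: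
  assumes "0 < \<rho>" "\<And>j. 0 \<le> w j" "\<And>j. w j \<le> w' j" "m \<le> n"
  shows "info_gain (inverse \<rho> *\<^sub>R wdesign w x m) \<le> info_gain (inverse \<rho> *\<^sub>R wdesign w' x n)"
proof -
  interpret a: regularized_design \<rho> w x by unfold_locales (use assms in auto)
  interpret b: regularized_design \<rho> w' x by unfold_locales (use assms order_trans in blast)+
  have "2 * info_gain (inverse \<rho> *\<^sub>R wdesign w x m) + 0 * (0 \<bullet> (0::'a))
      \<le> 2 * info_gain (inverse \<rho> *\<^sub>R wdesign w' x n)"
  proof (rule info_gain_increment[OF a.psd_scaled b.psd_scaled])
    show "finite (x ` {1..n})" by simp
    show "z \<bullet> (inverse \<rho> *\<^sub>R wdesign w x m) z + 0 * (0 \<bullet> z)\<^sup>2 \<le> z \<bullet> (inverse \<rho> *\<^sub>R wdesign w' x n) z" for z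
    proof -
      have "z \<bullet> wdesign w x m z \<le> (\<Sum>j=1..m. w' j * (x j \<bullet> z)\<^sup>2)"
        unfolding quad_wdesign by (intro sum_mono mult_right_mono assms) auto
      also have "\<dots> \<le> z \<bullet> wdesign w' x n z"
        unfolding quad_wdesign using assms(4) b.w_nonneg by (intro sum_mono2) auto
      finally show ?thesis using assms(1) by (simp add: blinfun.scaleR_left)
    qed
  qed (use assms(4) a.scaled_in_span b.scaled_in_span in \<open>auto simp: span_zero blinfun.zero_right\<close>)
  then show ?thesis by simp
qed

section \<open>The logistic link\<close>

lemma logistic_pos: "0 < logistic u" and logistic_less_one: "logistic u < 1"
  by (simp_all add: logistic_def add_pos_pos)

lemma logistic_minus: "logistic (- u) = 1 - logistic u"
proof -
  have "1 + exp u \<noteq> 0" "1 + exp (- u) \<noteq> 0" by (metis add_pos_pos exp_gt_zero less_irrefl zero_less_one)+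
  then show ?thesis by (simp add: logistic_def exp_minus field_simps)
qed

lemma logistic_var_minus: "logistic_var (- u) = logistic_var u"
  by (simp add: logistic_var_def logistic_minus)

lemma logistic_var_pos: "0 < logistic_var u"
  using logistic_pos[of u] logistic_less_one[of u] by (simp add: logistic_var_def)

lemma logistic_var_le: "logistic_var u \<le> 1 / 4"
proof -
  have "1 / 4 - logistic_var u = (logistic u - 1 / 2)\<^sup>2"
    by (simp add: logistic_var_def power2_eq_square algebra_simps)
  then show ?thesis by (metis diff_ge_0_iff_ge zero_le_power2)
qed

lemma logistic_var_eq: "logistic_var u = exp (- u) / (1 + exp (- u))\<^sup>2"
proof -
  have "1 + exp (- u) \<noteq> 0" by (metis add_pos_pos exp_gt_zero less_irrefl zero_less_one)
  then show ?thesis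
    by (simp add: logistic_var_def logistic_def power2_eq_square field_simps)
qed

lemma DERIV_logistic: "(logistic has_real_derivative logistic_var u) (at u)"
proof -
  have nz: "1 + exp (- u) \<noteq> 0" by (metis add_pos_pos exp_gt_zero less_irrefl zero_less_one)
  have "((\<lambda>u. 1 / (1 + exp (- u))) has_real_derivative exp (- u) / (1 + exp (- u))\<^sup>2) (at u)"
    by (rule derivative_eq_intros refl nz | simp add: power2_eq_square)+
  then show ?thesis
    by (simp add: logistic_var_eq logistic_def[abs_def])
qed

lemma DERIV_log_loss: "((\<lambda>u. log_loss u y) has_real_derivative (logistic u - y)) (at u)"
proof -
  note pos = logistic_pos[of u] logistic_less_one[of u]
  have "((\<lambda>u. - y * ln (logistic u) - (1 - y) * ln (1 - logistic u)) has_real_derivative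
      (- y * (logistic_var u / logistic u) - (1 - y) * (- logistic_var u / (1 - logistic u)))) (at u)"
    using pos by (auto intro!: derivative_eq_intros DERIV_logistic simp: mult.commute)
  also have "- y * (logistic_var u / logistic u) - (1 - y) * (- logistic_var u / (1 - logistic u))
      = logistic u - y"
    using pos by (simp add: logistic_var_def field_simps)
  finally show ?thesis by (simp add: log_loss_def)
qed

lemma logistic_mvt:
  assumes "s < t"
  obtains \<xi> where "s < \<xi>" "\<xi> < t" "logistic t - logistic s = (t - s) * logistic_var \<xi>"
  using MVT2[OF assms, of logistic logistic_var] DERIV_logistic by blast

lemma logistic_mono: "s \<le> t \<Longrightarrow> logistic s \<le> logistic t"
  using logistic_mvt[of s t] logistic_var_pos
  by (metis diff_ge_0_iff_ge less_eq_real_def mult_nonneg_nonneg)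

lemma logistic_lipschitz:
  assumes "s \<le> t"
  shows "logistic t - logistic s \<le> (t - s) / 4"
proof (cases "s = t")
  case False
  then obtain \<xi> where "logistic t - logistic s = (t - s) * logistic_var \<xi>"
    using logistic_mvt[of s t] assms by auto
  then show ?thesis
    using mult_left_mono[OF logistic_var_le[of \<xi>], of "t - s"] assms by simp
qed simp

text \<open>As a function of the mean m the variance is m (1 - m), with slopes in [-1,1]. This lets
  the variance of a played arm be charged to its instantaneous regret.\<close>

lemma logistic_var_diff: "\<bar>logistic_var s - logistic_var t\<bar> \<le> \<bar>logistic s - logistic t\<bar>"
proof -
  have "logistic_var s - logistic_var t = (logistic s - logistic t) * (1 - logistic s - logistic t)"
    by (simp add: logistic_var_def algebra_simps)
  moreover have "\<bar>1 - logistic s - logistic t\<bar> \<le> 1"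
    using logistic_pos[of s] logistic_pos[of t] logistic_less_one[of s] logistic_less_one[of t] by linarith
  ultimately show ?thesis
    by (simp add: abs_mult mult_left_le)
qed

text \<open>One mean value step; the variance at the intermediate point exceeds that at
  \<open>s\<close> by at most the increase of the mean, itself at most \<open>d / 4\<close>.\<close>

lemma logistic_taylor:
  assumes "0 \<le> d"
  shows "logistic (s + d) - logistic s \<le> logistic_var s * d + d\<^sup>2 / 4"
proof (cases "d = 0")
  case False
  then obtain \<xi> where \<xi>: "s < \<xi>" "\<xi> < s + d" "logistic (s + d) - logistic s = d * logistic_var \<xi>"
    using logistic_mvt[of s "s + d"] assms by auto
  have "logistic_var \<xi> \<le> logistic_var s + (logistic \<xi> - logistic s)"
    using logistic_var_diff[of \<xi> s] logistic_mono[of s \<xi>] \<xi>(1) by simp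
  also have "\<dots> \<le> logistic_var s + d / 4"
    using logistic_lipschitz[of s \<xi>] \<xi>(1,2) by simp
  finally have "d * logistic_var \<xi> \<le> d * (logistic_var s + d / 4)"
    using assms by (rule mult_left_mono)
  then show ?thesis
    using \<xi>(3) by (simp add: power2_eq_square algebra_simps)
qed simp

text \<open>In the form a / (1 + a)^2 with a = exp (- s), the shift multiplies the numerator by
  \<open>exp (- z)\<close> and can only decrease the denominator.\<close>

lemma logistic_var_shift_ge:
  assumes "0 \<le> z"
  shows "exp (- z) * logistic_var s \<le> logistic_var (s + z)"
proof -
  define a r where "a = exp (- s)" and "r = exp (- z)"
  have a: "0 < a" and r: "0 < r" "r \<le> 1" using assms by (auto simp: a_def r_def)
  have "a * r \<le> a" using a r by simp
  then have "(1 + a * r)\<^sup>2 \<le> (1 + a)\<^sup>2"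
    using a r by (intro power_mono) auto
  then have "a * r / (1 + a)\<^sup>2 \<le> a * r / (1 + a * r)\<^sup>2"
    using a r by (intro divide_left_mono mult_pos_pos zero_less_power add_pos_pos) auto
  moreover have "exp (- (s + z)) = a * r" by (simp add: a_def r_def exp_diff exp_minus field_simps exp_add)
  ultimately show ?thesis
    by (simp add: logistic_var_eq a_def[symmetric] r_def[symmetric] mult.commute)
qed

text \<open>Self-concordance made additive by exp (- d) \<ge> 1 - d. The error keeps the weight at
  \<open>s\<close>, so that it can later be measured with the weights at
  \<open>fstar\<close>.\<close>

lemma logistic_var_self_concordant: "logistic_var s \<le> logistic_var t + \<bar>s - t\<bar> * logistic_var s"
proof -
  have *: "exp (- \<bar>s - t\<bar>) * logistic_var s \<le> logistic_var t"
  proof (cases "s \<le> t")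
    case True
    then show ?thesis using logistic_var_shift_ge[of "t - s" s] by simp
  next
    case False
    then show ?thesis
      using logistic_var_shift_ge[of "s - t" "- s"] logistic_var_minus[of s] logistic_var_minus[of t] by simp
  qed
  have "(1 - \<bar>s - t\<bar>) * logistic_var s \<le> exp (- \<bar>s - t\<bar>) * logistic_var s"
    using exp_ge_add_one_self[of "- \<bar>s - t\<bar>"] logistic_var_pos[of s] by (intro mult_right_mono) auto
  with * show ?thesis by (simp add: algebra_simps)
qed

lemma logistic_var_ge:
  assumes "\<bar>u\<bar> \<le> b"
  shows "exp (- b) / 4 \<le> logistic_var u"
proof -
  have "exp (- \<bar>u\<bar>) * logistic_var 0 \<le> logistic_var \<bar>u\<bar>"
    using logistic_var_shift_ge[of "\<bar>u\<bar>" 0] by simp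
  moreover have "logistic_var \<bar>u\<bar> = logistic_var u"
    by (simp add: abs_if logistic_var_minus)
  moreover have "logistic_var 0 = 1 / 4" by (simp add: logistic_var_eq)
  moreover have "exp (- b) \<le> exp (- \<bar>u\<bar>)" using assms by simp
  ultimately show ?thesis by (simp only:)
qed

lemma logistic_secant_pos:
  assumes "0 \<le> z"
  shows "logistic_var s * z \<le> (1 + z) * (logistic (s + z) - logistic s)"
proof -
  define a r where "a = exp (- s)" and "r = exp (- z)"
  have a: "0 < a" and r: "0 < r" "r \<le> 1" using assms by (auto simp: a_def r_def)
  have e: "exp (- (s + z)) = a * r" by (simp add: a_def r_def exp_diff exp_minus field_simps exp_add)
  have pos: "0 < 1 + a * r" "0 < 1 + a" using a r by (auto intro: add_pos_pos)
  \<comment> \<open>The origin of the factor \<open>1 + z\<close>. Replacing one denominator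
    \<open>1 + a\<close> by \<open>1 + a * r\<close> then yields the exact difference of logistic
    values.\<close>
  have "(1 + z) * r \<le> 1"
    using exp_ge_add_one_self[of z] by (simp add: r_def exp_minus field_simps)
  then have "z \<le> (1 + z) * (1 - r)" by (simp add: algebra_simps)
  then have "logistic_var s * z \<le> logistic_var s * ((1 + z) * (1 - r))"
    using logistic_var_pos[of s] by (intro mult_left_mono) auto
  also have "\<dots> = (1 + z) * (a * (1 - r) / ((1 + a) * (1 + a)))"
    by (simp add: logistic_var_eq a_def power2_eq_square)
  also have "\<dots> \<le> (1 + z) * (a * (1 - r) / ((1 + a * r) * (1 + a)))"
    using a r assms pos by (intro mult_left_mono divide_left_mono mult_right_mono) auto
  also have "a * (1 - r) / ((1 + a * r) * (1 + a)) = logistic (s + z) - logistic s"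
    unfolding logistic_def e a_def[symmetric] using pos by (simp add: divide_simps) (simp add: algebra_simps)
  finally show ?thesis .
qed

text \<open>The variance at an endpoint against the secant slope; \<open>t < s\<close> reduces to
  the other case by reflection. Usable from either endpoint, it serves the Hessians at
  \<open>fstar\<close> and at the estimator alike.\<close>

lemma logistic_secant:
  "logistic_var s * (t - s)\<^sup>2 \<le> (1 + \<bar>t - s\<bar>) * ((t - s) * (logistic t - logistic s))"
proof -
  have *: "logistic_var s * z\<^sup>2 \<le> (1 + z) * (z * (logistic (s + z) - logistic s))" if "0 \<le> z" for s z
    using mult_left_mono[OF logistic_secant_pos[OF that, of s] that]
    by (simp add: power2_eq_square mult_ac)
  show ?thesis
  proof (cases "s \<le> t")
    case True
    then show ?thesis using *[of "t - s" s] by simp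
  next
    case False
    then show ?thesis
      using *[of "s - t" "- s"]
      by (simp add: logistic_var_minus logistic_minus power2_commute algebra_simps)
  qed
qed

lemma logistic_secant_nonneg: "0 \<le> (t - s) * (logistic t - logistic s)"
  using logistic_mono[of s t] logistic_mono[of t s]
  by (cases "s \<le> t") (auto intro: mult_nonneg_nonneg mult_nonpos_nonpos)


section \<open>Confidence sets along a path\<close>

text \<open>The first order condition along the line \<open>f + t *\<^sub>R d\<close>, where
  one-variable calculus suffices.\<close>

lemma ridge_score_equation:
  assumes "is_arg_min (ridge_loss \<rho> x r n) (\<lambda>_. True) f"
  shows "(\<Sum>i=1..n. (logistic (f \<bullet> x i) - r i) * (x i \<bullet> d)) + \<rho> * (f \<bullet> d) = 0"
proof -
  define \<phi> where "\<phi> t = ridge_loss \<rho> x r n (f + t *\<^sub>R d)" for t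
  have sq: "(norm (f + t *\<^sub>R d))\<^sup>2 = f \<bullet> f + 2 * t * (f \<bullet> d) + t\<^sup>2 * (d \<bullet> d)" for t
    unfolding power2_norm_eq_inner
    by (simp add: inner_add inner_commute power2_eq_square algebra_simps)
  have loss: "((\<lambda>t. log_loss (f \<bullet> x i + t * (d \<bullet> x i)) (r i)) has_real_derivative
      (logistic (f \<bullet> x i) - r i) * (x i \<bullet> d)) (at 0)" for i
  proof -
    have "((\<lambda>t. log_loss (f \<bullet> x i + t * (d \<bullet> x i)) (r i)) has_real_derivative
        (logistic (f \<bullet> x i + 0 * (d \<bullet> x i)) - r i) * (d \<bullet> x i)) (at 0)"
      by (rule DERIV_chain2[OF DERIV_log_loss]) (auto intro!: derivative_eq_intros)
    then show ?thesis by (simp add: inner_commute)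
  qed
  have "(\<phi> has_real_derivative
      (\<Sum>i=1..n. (logistic (f \<bullet> x i) - r i) * (x i \<bullet> d)) + \<rho> / 2 * (2 * (f \<bullet> d))) (at 0)"
    unfolding \<phi>_def ridge_loss_def sq inner_add inner_scaleR_left
    by (rule DERIV_add DERIV_sum loss)+ (auto intro!: derivative_eq_intros)
  moreover have "\<forall>y. \<bar>0 - y\<bar> < 1 \<longrightarrow> \<phi> 0 \<le> \<phi> y"
    using assms by (auto simp: \<phi>_def is_arg_min_def not_less)
  ultimately show ?thesis
    using DERIV_local_min[of \<phi> _ 0 1] by simp
qed

text \<open>If D > u + u^2, then D^2 > u D + u^2 D, and u D is at least u^2. The bound has the shape
  of \<open>alpha\<close>.\<close>

lemma le_add_square_of_square_le:
  fixes D u :: real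
  assumes "0 \<le> u" "D\<^sup>2 \<le> u\<^sup>2 * (1 + D)"
  shows "D \<le> u * (1 + u)"
proof (rule ccontr)
  assume "\<not> ?thesis"
  then have D: "u + u\<^sup>2 < D" by (simp add: power2_eq_square algebra_simps)
  then have "0 < D" using assms(1) by (smt (verit) zero_le_power2)
  have "u * D \<ge> u * (u + u\<^sup>2)" using D assms(1) by (intro mult_left_mono) auto
  moreover have "D * (u + u\<^sup>2) < D * D" using D \<open>0 < D\<close> by (intro mult_strict_left_mono)
  moreover have "0 \<le> u ^ 3" using assms(1) by simp
  ultimately show False
    using assms(2) by (simp add: power2_eq_square power3_eq_cube algebra_simps)
qed

text \<open>With \<open>D\<close> the norm of the error and \<open>N\<close> its norm in the
  regularised Hessian at \<open>fstar\<close>, three inequalities are combined: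
  \<open>\<rho> * D\<^sup>2 \<le> G\<close>, \<open>G \<le> sqrt \<rho> * u * N\<close> and
  \<open>N\<^sup>2 \<le> (1 + D) * G\<close>. Eliminating \<open>N\<close> bounds \<open>G\<close>,
  then \<open>D\<close>, then both Hessian norms.\<close>

lemma conf_ineqs_of_noise_bound:
  fixes x :: "nat \<Rightarrow> 'h::real_inner"
  assumes \<rho>: "0 < \<rho>" and b: "norm fstar \<le> b" and \<beta>: "0 \<le> \<beta> n"
    and x: "\<And>j. 1 \<le> j \<Longrightarrow> norm (x j) \<le> 1"
    and min: "is_arg_min (ridge_loss \<rho> x r n) (\<lambda>_. True) (fhat n)"
    and noise: "m \<bullet> resolvent \<rho> (\<lambda>j. logistic_var (fstar \<bullet> x j)) x n m \<le> (\<beta> n)\<^sup>2"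
    and m: "m = (\<Sum>j=1..n. (r j - logistic (fstar \<bullet> x j)) *\<^sub>R x j)"
  shows "conf_ineqs \<rho> b fstar x fhat \<beta> n"
proof -
  let ?f = "fhat n"
  interpret a: regularized_design \<rho> "\<lambda>j. logistic_var (fstar \<bullet> x j)" x
    by unfold_locales (simp_all add: \<rho> logistic_var_pos less_imp_le)
  interpret c: regularized_design \<rho> "\<lambda>j. logistic_var (?f \<bullet> x j)" x
    by unfold_locales (simp_all add: \<rho> logistic_var_pos less_imp_le)
  define h where "h = fstar - ?f"
  define D where "D = norm h"
  define u where "u = u_rad \<rho> b (\<beta> n)"
  define g where "g j = (x j \<bullet> h) * (logistic (fstar \<bullet> x j) - logistic (?f \<bullet> x j))" for j
  \<comment> \<open>The pairing of \<open>h\<close> with the difference of the ridge gradients at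
    \<open>fstar\<close> and at the estimator, that is, the quadratic form of the secant
    operator.\<close>
  define G where "G = (\<Sum>j=1..n. g j) + \<rho> * (h \<bullet> h)"
  define N where "N = sqrt (h \<bullet> a.Z n h)"
  have b0: "0 \<le> b" using b norm_ge_zero order_trans by blast
  have u0: "0 \<le> u" using \<rho> \<beta> b0 by (simp add: u_def u_rad_def)
  have su: "sqrt \<rho> * u = \<beta> n + sqrt \<rho> * b" using \<rho> by (simp add: u_def u_rad_def field_simps)
  have D0: "0 \<le> D" by (simp add: D_def)
  have hh: "h \<bullet> h = D\<^sup>2" by (simp add: D_def power2_norm_eq_inner)
  have N0: "0 \<le> N" and N2: "N\<^sup>2 = h \<bullet> a.Z n h" using a.Z_nonneg[of h n] by (simp_all add: N_def)
  have xh: "x j \<bullet> h = fstar \<bullet> x j - ?f \<bullet> x j" for j by (simp add: h_def inner_diff inner_commute)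
  have g0: "0 \<le> g j" for j
    unfolding g_def xh by (rule logistic_secant_nonneg)
  have xhD: "\<bar>x j \<bullet> h\<bar> \<le> D" if "1 \<le> j" for j
    using Cauchy_Schwarz_ineq2[of "x j" h] mult_right_mono[OF x[OF that], of "norm h"] by (simp add: D_def)
  have "0 \<le> (\<Sum>j=1..n. g j)" by (intro sum_nonneg g0)
  then have G_ge: "\<rho> * D\<^sup>2 \<le> G" by (simp add: G_def hh)
  then have G0: "0 \<le> G" using \<rho> by (meson mult_nonneg_nonneg zero_le_power2 order_trans less_imp_le)
  \<comment> \<open>The gradient at the estimator vanishes; the one at \<open>fstar\<close> consists
    of the noise and the regularisation bias.\<close>
  have Geq: "G = \<rho> * (fstar \<bullet> h) - m \<bullet> h"
  proof -
    have "(\<Sum>j=1..n. g j) + m \<bullet> h = - (\<Sum>j=1..n. (logistic (?f \<bullet> x j) - r j) * (x j \<bullet> h))"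
      by (simp add: m g_def inner_sum_left sum.distrib[symmetric] sum_negf[symmetric] algebra_simps)
    also have "\<dots> = \<rho> * (?f \<bullet> h)"
      using ridge_score_equation[OF min, of h] by simp
    also have "\<dots> = \<rho> * (fstar \<bullet> h) - \<rho> * (h \<bullet> h)"
      by (simp add: h_def inner_diff algebra_simps)
    finally show ?thesis by (simp add: G_def)
  qed
  have rD: "sqrt \<rho> * D \<le> N"
    using a.Z_ge[of h n] \<rho> D0 N0 by (intro power2_le_imp_le[OF _ N0]) (simp add: N2 hh power_mult_distrib)
  \<comment> \<open>The noise costs \<open>\<beta> n * N\<close> by the dual Cauchy-Schwarz
    inequality, the bias \<open>sqrt \<rho> * b * N\<close> by
    \<open>sqrt \<rho> * D \<le> N\<close>; together this is the factor
    \<open>sqrt \<rho> * u\<close>.\<close>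
  have "G \<le> sqrt \<rho> * u * N"
  proof -
    have "(m \<bullet> h)\<^sup>2 \<le> N\<^sup>2 * (\<beta> n)\<^sup>2"
      using a.dual_cauchy_schwarz[of m h n] mult_left_mono[OF noise zero_le_power2[of N]]
      unfolding N2 by (rule order_trans)
    then have "\<bar>m \<bullet> h\<bar> \<le> N * \<beta> n"
      using N0 \<beta> by (metis abs_le_square_iff abs_of_nonneg mult_nonneg_nonneg power_mult_distrib)
    moreover have "\<rho> * (fstar \<bullet> h) \<le> \<rho> * (b * D)"
      using Cauchy_Schwarz_ineq2[of fstar h] mult_right_mono[OF b, of D] \<rho>
      by (intro mult_left_mono) (auto simp: D_def)
    moreover have "(sqrt \<rho> * b) * (sqrt \<rho> * D) = (sqrt \<rho> * sqrt \<rho>) * (b * D)"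
      by (simp only: mult_ac)
    moreover have "sqrt \<rho> * sqrt \<rho> = \<rho>" using \<rho> by simp
    moreover have "(sqrt \<rho> * b) * (sqrt \<rho> * D) \<le> (sqrt \<rho> * b) * N"
      using rD b0 \<rho> by (intro mult_left_mono) auto
    ultimately have "\<rho> * (fstar \<bullet> h) \<le> (sqrt \<rho> * b) * N" "- (m \<bullet> h) \<le> \<beta> n * N"
      by (metis order_trans, simp add: mult.commute)
    then show ?thesis unfolding Geq su distrib_right by linarith
  qed
  then have "G\<^sup>2 \<le> (sqrt \<rho> * u * N)\<^sup>2" using G0 by (intro power_mono)
  moreover have "(sqrt \<rho> * u * N)\<^sup>2 = \<rho> * u\<^sup>2 * N\<^sup>2" using \<rho> by (simp add: power_mult_distrib)
  ultimately have GN: "G * G \<le> \<rho> * u\<^sup>2 * N\<^sup>2" by (simp only: power2_eq_square[of G])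
  have quad_le: "h \<bullet> resolvent_arg \<rho> v x n h \<le> (1 + D) * G"
    if v: "\<And>j. 1 \<le> j \<Longrightarrow> v j * (x j \<bullet> h)\<^sup>2 \<le> (1 + \<bar>x j \<bullet> h\<bar>) * g j" for v
  proof -
    have "v j * (x j \<bullet> h)\<^sup>2 \<le> (1 + D) * g j" if "j \<in> {1..n}" for j
      using v[of j] mult_right_mono[of "1 + \<bar>x j \<bullet> h\<bar>" "1 + D" "g j"] xhD[of j] g0[of j] that by simp
    then have "(\<Sum>j=1..n. v j * (x j \<bullet> h)\<^sup>2) \<le> (1 + D) * (\<Sum>j=1..n. g j)"
      unfolding sum_distrib_left by (rule sum_mono)
    moreover have "\<rho> * (h \<bullet> h) \<le> (1 + D) * (\<rho> * (h \<bullet> h))"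
      using \<rho> D0 by (simp add: mult_left_le algebra_simps)
    ultimately show ?thesis
      unfolding quad_resolvent_arg G_def by (simp add: distrib_left)
  qed
  have qa: "h \<bullet> a.Z n h \<le> (1 + D) * G"
  proof (rule quad_le)
    fix j show "logistic_var (fstar \<bullet> x j) * (x j \<bullet> h)\<^sup>2 \<le> (1 + \<bar>x j \<bullet> h\<bar>) * g j"
      using logistic_secant[of "fstar \<bullet> x j" "?f \<bullet> x j"]
      by (simp add: g_def xh power2_commute[of "?f \<bullet> x j"] abs_minus_commute[of "?f \<bullet> x j"] algebra_simps)
  qed
  have qc: "h \<bullet> c.Z n h \<le> (1 + D) * G"
  proof (rule quad_le)
    fix j show "logistic_var (?f \<bullet> x j) * (x j \<bullet> h)\<^sup>2 \<le> (1 + \<bar>x j \<bullet> h\<bar>) * g j"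
      using logistic_secant[of "?f \<bullet> x j" "fstar \<bullet> x j"] by (simp add: g_def xh)
  qed
  have GG: "G * G \<le> \<rho> * u\<^sup>2 * ((1 + D) * G)"
  proof -
    have "0 \<le> \<rho> * u\<^sup>2" using \<rho> by simp
    then show ?thesis
      using GN mult_left_mono[OF qa, of "\<rho> * u\<^sup>2"] unfolding N2 by linarith
  qed
  have G_le: "G \<le> \<rho> * u\<^sup>2 * (1 + D)"
  proof (cases "G = 0")
    case False
    then show ?thesis using GG G0 by (simp add: mult.assoc[symmetric])
  next
    case True
    then show ?thesis using \<rho> D0 by simp
  qed
  have "\<rho> * D\<^sup>2 \<le> \<rho> * (u\<^sup>2 * (1 + D))" using G_ge G_le by (simp add: mult_ac)
  then have "D\<^sup>2 \<le> u\<^sup>2 * (1 + D)" using \<rho> by simp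
  then have D_le: "D \<le> u * (1 + u)" by (rule le_add_square_of_square_le[OF u0])
  have W: "(1 + D) * G \<le> ((1 + D) * (sqrt \<rho> * u))\<^sup>2"
  proof -
    have "((1 + D) * (sqrt \<rho> * u))\<^sup>2 = (1 + D) * (\<rho> * u\<^sup>2 * (1 + D))"
      using \<rho> by (simp add: power_mult_distrib power2_eq_square[of "1 + D"] mult_ac)
    then show ?thesis
      using mult_left_mono[OF G_le, of "1 + D"] D0 by simp
  qed
  \<comment> \<open>1 + D is at most 1 + u + u^2, and u and u^2 are each at most 1 + u^3; this gives
    3 + 2 u^3, within the factor 6 + 2 u^3 of \<open>omega\<close>.\<close>
  have om: "(1 + D) * (sqrt \<rho> * u) \<le> omega \<rho> b (\<beta> n)"
  proof -
    have "u\<^sup>2 \<le> 1 + u ^ 3" "u \<le> 1 + u ^ 3"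
    proof -
      show "u\<^sup>2 \<le> 1 + u ^ 3"
      proof (cases "u \<le> 1")
        case True then show ?thesis using u0 power_le_one[of u 2] by (simp add: add_increasing2)
      next
        case False
        then have "u\<^sup>2 \<le> u ^ 3" by (intro power_increasing) auto
        then show ?thesis by linarith
      qed
      show "u \<le> 1 + u ^ 3"
      proof (cases "u \<le> 1")
        case True then show ?thesis using u0 by (simp add: add_increasing2)
      next
        case False
        then have "u ^ 1 \<le> u ^ 3" by (intro power_increasing) auto
        then show ?thesis by simp
      qed
    qed
    then have "1 + D \<le> 6 + 2 * u ^ 3"
      using D_le u0 by (simp add: algebra_simps power2_eq_square)
    then have "(1 + D) * (sqrt \<rho> * u) \<le> (6 + 2 * u ^ 3) * (sqrt \<rho> * u)"
      using \<rho> u0 by (intro mult_right_mono) auto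
    then show ?thesis by (simp add: omega_def u_def mult_ac)
  qed
  have root: "norm (op_sqrt (resolvent_arg \<rho> v x n) h) \<le> omega \<rho> b (\<beta> n)"
    if "(norm (op_sqrt (resolvent_arg \<rho> v x n) h))\<^sup>2 = h \<bullet> resolvent_arg \<rho> v x n h"
      and "h \<bullet> resolvent_arg \<rho> v x n h \<le> (1 + D) * G" for v
  proof -
    have "norm (op_sqrt (resolvent_arg \<rho> v x n) h) \<le> (1 + D) * (sqrt \<rho> * u)"
    proof (rule power2_le_imp_le)
      show "(norm (op_sqrt (resolvent_arg \<rho> v x n) h))\<^sup>2 \<le> ((1 + D) * (sqrt \<rho> * u))\<^sup>2"
        using that W by linarith
      show "0 \<le> (1 + D) * (sqrt \<rho> * u)" using D0 u0 \<rho> by simp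
    qed
    then show ?thesis using om by linarith
  qed
  show ?thesis
    unfolding conf_ineqs_def hess_op_eq_wdesign
    using root[OF a.norm_op_sqrt qa] root[OF c.norm_op_sqrt qc] D_le
    by (simp add: resolvent_arg_def h_def D_def alpha_def u_def)
qed


section \<open>Regret along a path\<close>

text \<open>The deterministic content of one sample path. Of the arg max in the rule only the
  comparison with \<open>xstar\<close> is kept, and of the optimality of \<open>xstar\<close> only
  the comparison with the played arms.\<close>

locale optimistic_path =
  fixes \<rho> b :: real and fstar xstar :: "'h::real_inner"
    and x fhat :: "nat \<Rightarrow> 'h" and \<beta> :: "nat \<Rightarrow> real"
  assumes \<rho>1: "1 \<le> \<rho>" and b_pos: "0 < b" and fstar_le: "norm fstar \<le> b"
    and x_le: "\<And>j. 1 \<le> j \<Longrightarrow> norm (x j) \<le> 1"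
    and \<beta>_nonneg: "\<And>n. 1 \<le> n \<Longrightarrow> 0 \<le> \<beta> n"
    and \<beta>_mono: "\<And>m n. 1 \<le> m \<Longrightarrow> m \<le> n \<Longrightarrow> \<beta> m \<le> \<beta> n"
    and conf: "\<And>n. 1 \<le> n \<Longrightarrow> conf_ineqs \<rho> b fstar x fhat \<beta> n"
    and best: "\<And>j. 1 \<le> j \<Longrightarrow> fstar \<bullet> x j \<le> fstar \<bullet> xstar"
    and optimism: "\<And>n. 1 \<le> n \<Longrightarrow> (SUP f\<in>conf_set \<rho> b x fhat \<beta> (n - 1). f \<bullet> xstar)
      \<le> (SUP f\<in>conf_set \<rho> b x fhat \<beta> (n - 1). f \<bullet> x n)"
begin

abbreviation w :: "nat \<Rightarrow> real" where "w j \<equiv> logistic_var (fstar \<bullet> x j)"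

sublocale regularized_design \<rho> w x
  by unfold_locales (use \<rho>1 in \<open>simp_all add: logistic_var_pos less_imp_le\<close>)

abbreviation om :: "nat \<Rightarrow> real" where "om n \<equiv> omega \<rho> b (\<beta> n)"
abbreviation al :: "nat \<Rightarrow> real" where "al n \<equiv> alpha \<rho> b (\<beta> n)"
abbreviation ob :: "nat \<Rightarrow> real" where "ob n \<equiv> omega_bar \<rho> b (\<beta> n)"
abbreviation N :: "nat \<Rightarrow> 'h \<Rightarrow> real" where "N n v \<equiv> norm (op_sqrt (Z n) v)"

lemma norm_op_sqrt_sum: "(N n v)\<^sup>2 = (\<Sum>j=1..n. w j * (x j \<bullet> v)\<^sup>2) + \<rho> * (norm v)\<^sup>2"
  unfolding norm_op_sqrt quad_resolvent_arg by (simp add: power2_norm_eq_inner)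

lemma u_rad_ge: "1 \<le> n \<Longrightarrow> b \<le> u_rad \<rho> b (\<beta> n)"
  using \<beta>_nonneg \<rho>1 by (simp add: u_rad_def)

text \<open>Serves round 0, where the confidence set is a ball of radius \<open>b\<close> whose
  diameter has to fit under the later radii.\<close>

lemma omega_ge:
  assumes "1 \<le> n"
  shows "6 * b * sqrt \<rho> \<le> om n"
proof -
  let ?u = "u_rad \<rho> b (\<beta> n)"
  have u: "b \<le> ?u" "0 \<le> ?u" using u_rad_ge[OF assms] b_pos by auto
  have "b * 6 \<le> ?u * (6 + 2 * ?u ^ 3)"
    using u by (intro mult_mono) auto
  then have "b * 6 * sqrt \<rho> \<le> ?u * (6 + 2 * ?u ^ 3) * sqrt \<rho>"
    using \<rho>1 by (intro mult_right_mono) auto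
  then show ?thesis by (simp add: omega_def mult_ac)
qed

lemma omega_pos: "1 \<le> n \<Longrightarrow> 0 < om n"
  using omega_ge[of n] b_pos \<rho>1 by (smt (verit) mult_pos_pos real_sqrt_gt_zero)

lemma alpha_nonneg: "1 \<le> n \<Longrightarrow> 0 \<le> al n"
  using u_rad_ge[of n] b_pos by (simp add: alpha_def)

lemma omega_le_omega_bar: "1 \<le> n \<Longrightarrow> om n \<le> ob n"
  using omega_pos[of n] alpha_nonneg[of n] by (simp add: omega_bar_def algebra_simps)

lemma omega_bar_pos: "1 \<le> n \<Longrightarrow> 0 < ob n"
  using omega_pos[of n] omega_le_omega_bar[of n] by linarith

lemma omega_bar_mono: "1 \<le> m \<Longrightarrow> m \<le> n \<Longrightarrow> ob m \<le> ob n"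
  using radii_mono(4)[OF \<beta>_nonneg \<beta>_mono] \<rho>1 b_pos by simp

lemma conf_setD:
  assumes "1 \<le> n"
  defines "v \<equiv> \<lambda>j. logistic_var (fhat n \<bullet> x j)"
  shows "f \<in> conf_set \<rho> b x fhat \<beta> n \<longleftrightarrow>
      (\<Sum>j=1..n. v j * (x j \<bullet> (f - fhat n))\<^sup>2) + (\<rho> + (om n)\<^sup>2) * (norm (f - fhat n))\<^sup>2 \<le> (ob n)\<^sup>2"
proof -
  interpret c: regularized_design "\<rho> + (om n)\<^sup>2" v x
    by unfold_locales (use \<rho>1 in \<open>auto simp: v_def logistic_var_pos less_imp_le add_pos_nonneg\<close>)
  have "f \<in> conf_set \<rho> b x fhat \<beta> n \<longleftrightarrow> norm (op_sqrt (c.Z n) (f - fhat n)) \<le> ob n"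
    using assms(1) by (simp add: conf_set_def hess_op_eq_wdesign resolvent_arg_def v_def)
  also have "\<dots> \<longleftrightarrow> (norm (op_sqrt (c.Z n) (f - fhat n)))\<^sup>2 \<le> (ob n)\<^sup>2"
    using omega_bar_pos[OF assms(1)] by (simp add: power_mono_iff)
  finally show ?thesis
    unfolding c.norm_op_sqrt quad_resolvent_arg power2_norm_eq_inner[of "f - fhat n"] .
qed

text \<open>The two parts of the regulariser are paid by the two confidence inequalities: omega^2 +
  omega^2 alpha^2 is at most (omega (1 + alpha))^2.\<close>

lemma fstar_in_conf_set: "fstar \<in> conf_set \<rho> b x fhat \<beta> n"
proof (cases "n = 0")
  case True
  then show ?thesis using fstar_le by (simp add: conf_set_def)
next
  case False
  then have n: "1 \<le> n" by simp
  let ?v = "\<lambda>j. logistic_var (fhat n \<bullet> x j)" and ?h = "fstar - fhat n"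
  interpret c: regularized_design \<rho> ?v x
    by unfold_locales (use \<rho>1 in \<open>auto simp: logistic_var_pos less_imp_le\<close>)
  have "norm (op_sqrt (c.Z n) ?h) \<le> om n" "norm ?h \<le> al n"
    using conf[OF n] by (simp_all add: conf_ineqs_def hess_op_eq_wdesign resolvent_arg_def)
  then have "(norm (op_sqrt (c.Z n) ?h))\<^sup>2 \<le> (om n)\<^sup>2" "(norm ?h)\<^sup>2 \<le> (al n)\<^sup>2"
    by (auto intro: power_mono)
  then have "(\<Sum>j=1..n. ?v j * (x j \<bullet> ?h)\<^sup>2) + \<rho> * (norm ?h)\<^sup>2 + (om n)\<^sup>2 * (norm ?h)\<^sup>2
      \<le> (om n)\<^sup>2 + (om n)\<^sup>2 * (al n)\<^sup>2"
    unfolding c.norm_op_sqrt quad_resolvent_arg power2_norm_eq_inner[of ?h, symmetric]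
    by (intro add_mono mult_left_mono) auto
  also have "\<dots> \<le> (ob n)\<^sup>2"
    using alpha_nonneg[OF n] by (simp add: omega_bar_def power2_eq_square algebra_simps)
  finally show ?thesis
    unfolding conf_setD[OF n] by (simp add: algebra_simps)
qed

text \<open>The regulariser \<open>\<rho> + \<omega>\<^sup>2\<close> forces \<open>\<parallel>f - fhat\<parallel> \<le> 1 + \<alpha>\<close> on the confidence set; together with
  self-concordance this controls the error made by exchanging the weights at \<open>fhat\<close> for those
  at \<open>fstar\<close>.\<close>

lemma conf_set_radius_fhat:
  assumes n: "1 \<le> n" and f: "f \<in> conf_set \<rho> b x fhat \<beta> n"
  shows "N n (f - fhat n) \<le> 17 / 10 * ob n"
proof -
  let ?v = "\<lambda>j. logistic_var (fhat n \<bullet> x j)" and ?h = "fstar - fhat n" and ?k = "f - fhat n"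
  note om = omega_pos[OF n] and al = alpha_nonneg[OF n] and ob = omega_bar_pos[OF n]
  have v0: "0 \<le> ?v j" for j using logistic_var_pos less_imp_le by blast
  have sum0: "0 \<le> (\<Sum>j=1..n. ?v j * (x j \<bullet> ?k)\<^sup>2)"
    by (intro sum_nonneg mult_nonneg_nonneg v0) auto
  have f': "(\<Sum>j=1..n. ?v j * (x j \<bullet> ?k)\<^sup>2) + \<rho> * (norm ?k)\<^sup>2 + (om n)\<^sup>2 * (norm ?k)\<^sup>2 \<le> (ob n)\<^sup>2"
    using f unfolding conf_setD[OF n] by (simp add: algebra_simps)
  have "0 \<le> \<rho> * (norm ?k)\<^sup>2" using \<rho>1 by simp
  \<comment> \<open>As \<open>ob n\<close> is \<open>om n * (1 + al n)\<close>, the factor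
    \<open>om n\<close> cancels from the part of the constraint carried by the extra
    regulariser.\<close>
  then have "(om n)\<^sup>2 * (norm ?k)\<^sup>2 \<le> (om n)\<^sup>2 * (1 + al n)\<^sup>2"
    using f' sum0 by (simp add: omega_bar_def power_mult_distrib)
  then have "(norm ?k)\<^sup>2 \<le> (1 + al n)\<^sup>2" using om by simp
  then have k: "norm ?k \<le> 1 + al n" using al by (simp add: power2_le_iff_abs_le)
  have xk: "\<bar>x j \<bullet> ?k\<bar> \<le> 1 + al n" if "1 \<le> j" for j
    using Cauchy_Schwarz_ineq2[of "x j" ?k] mult_right_mono[OF x_le[OF that], of "norm ?k"] k by simp
  have hN: "N n ?h \<le> om n"
    using conf[OF n] by (simp add: conf_ineqs_def hess_op_eq_wdesign resolvent_arg_def)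
  define A where "A = L2_set (\<lambda>j. sqrt (w j) * (x j \<bullet> ?h)) {1..n}"
  define B where "B = L2_set (\<lambda>j. sqrt (w j) * (x j \<bullet> ?k)) {1..n}"
  have L2: "L2_set (\<lambda>j. sqrt (w j) * (x j \<bullet> z)) {1..n} \<le> N n z" for z
  proof -
    have "(\<Sum>j=1..n. w j * (x j \<bullet> z)\<^sup>2) \<le> (N n z)\<^sup>2"
      using \<rho>1 by (simp add: norm_op_sqrt quad_resolvent_arg)
    then show ?thesis
      unfolding L2_set_def by (intro real_le_lsqrt) (auto simp: power_mult_distrib w_nonneg intro!: sum_nonneg)
  qed
  have split: "w j * (\<bar>a\<bar> * \<bar>b\<bar>) = \<bar>sqrt (w j) * a\<bar> * \<bar>sqrt (w j) * b\<bar>" for j a b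
  proof -
    have "\<bar>sqrt (w j) * a\<bar> * \<bar>sqrt (w j) * b\<bar> = (sqrt (w j) * sqrt (w j)) * (\<bar>a\<bar> * \<bar>b\<bar>)"
      by (simp only: abs_mult abs_of_nonneg[OF real_sqrt_ge_zero[OF w_nonneg]] mult_ac)
    then show ?thesis by (simp add: w_nonneg)
  qed
  \<comment> \<open>Cauchy-Schwarz: the factor with \<open>?h\<close> is at most
    \<open>om n\<close>, so the cross term is only linear in the norm to be bounded.\<close>
  have "(\<Sum>j=1..n. w j * (\<bar>x j \<bullet> ?h\<bar> * \<bar>x j \<bullet> ?k\<bar>))
      = (\<Sum>j=1..n. \<bar>sqrt (w j) * (x j \<bullet> ?h)\<bar> * \<bar>sqrt (w j) * (x j \<bullet> ?k)\<bar>)"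
    by (simp only: split)
  also have "\<dots> \<le> A * B"
    unfolding A_def B_def by (rule L2_set_mult_ineq)
  also have "\<dots> \<le> om n * N n ?k"
    unfolding A_def B_def using L2[of ?h] L2[of ?k] hN om
    by (intro mult_mono) (auto intro: order_trans)
  finally have cross: "(\<Sum>j=1..n. w j * (\<bar>x j \<bullet> ?h\<bar> * \<bar>x j \<bullet> ?k\<bar>)) \<le> om n * N n ?k" .
  have "(N n ?k)\<^sup>2 = (\<Sum>j=1..n. w j * (x j \<bullet> ?k)\<^sup>2) + \<rho> * (norm ?k)\<^sup>2"
    by (rule norm_op_sqrt_sum)
  \<comment> \<open>Self-concordance exchanges the weights. In its error one factor
    \<open>\<bar>x j \<bullet> ?k\<bar>\<close> is replaced by the bound \<open>1 + al n\<close> and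
    the other stays in the cross term.\<close>
  also have "(\<Sum>j=1..n. w j * (x j \<bullet> ?k)\<^sup>2)
      \<le> (\<Sum>j=1..n. ?v j * (x j \<bullet> ?k)\<^sup>2 + (1 + al n) * (w j * (\<bar>x j \<bullet> ?h\<bar> * \<bar>x j \<bullet> ?k\<bar>)))"
  proof (rule sum_mono)
    fix j assume j: "j \<in> {1..n}"
    have "fstar \<bullet> x j - fhat n \<bullet> x j = x j \<bullet> ?h" by (simp add: inner_diff inner_commute)
    then have "w j \<le> ?v j + \<bar>x j \<bullet> ?h\<bar> * w j"
      using logistic_var_self_concordant[of "fstar \<bullet> x j" "fhat n \<bullet> x j"] by simp
    then have "w j * (x j \<bullet> ?k)\<^sup>2 \<le> ?v j * (x j \<bullet> ?k)\<^sup>2 + \<bar>x j \<bullet> ?h\<bar> * w j * (\<bar>x j \<bullet> ?k\<bar> * \<bar>x j \<bullet> ?k\<bar>)"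
      using mult_right_mono[of "w j" "?v j + \<bar>x j \<bullet> ?h\<bar> * w j" "(x j \<bullet> ?k)\<^sup>2"]
      by (simp add: distrib_right power2_eq_square)
    also have "\<bar>x j \<bullet> ?h\<bar> * w j * (\<bar>x j \<bullet> ?k\<bar> * \<bar>x j \<bullet> ?k\<bar>)
        \<le> \<bar>x j \<bullet> ?h\<bar> * w j * (\<bar>x j \<bullet> ?k\<bar> * (1 + al n))"
      using xk[of j] j w_nonneg[of j] by (intro mult_left_mono) auto
    finally show "w j * (x j \<bullet> ?k)\<^sup>2 \<le> ?v j * (x j \<bullet> ?k)\<^sup>2 + (1 + al n) * (w j * (\<bar>x j \<bullet> ?h\<bar> * \<bar>x j \<bullet> ?k\<bar>))"
      by (simp add: mult_ac)
  qed
  also have "\<dots> = (\<Sum>j=1..n. ?v j * (x j \<bullet> ?k)\<^sup>2)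
      + (1 + al n) * (\<Sum>j=1..n. w j * (\<bar>x j \<bullet> ?h\<bar> * \<bar>x j \<bullet> ?k\<bar>))"
    unfolding sum_distrib_left by (rule sum.distrib)
  also have "\<dots> \<le> (\<Sum>j=1..n. ?v j * (x j \<bullet> ?k)\<^sup>2) + (1 + al n) * (om n * N n ?k)"
    by (rule add_left_mono[OF mult_left_mono[OF cross]]) (use al in simp)
  also have "(1 + al n) * (om n * N n ?k) = ob n * N n ?k"
    by (simp add: omega_bar_def)
  finally have "(N n ?k)\<^sup>2 \<le> (ob n)\<^sup>2 + ob n * N n ?k"
    using f' mult_nonneg_nonneg[OF zero_le_power2[of "om n"] zero_le_power2[of "norm ?k"]] by linarith
  \<comment> \<open>For the ratio t of the two norms this is t^2 \<le> 1 + t, whose positive root,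
    about 1.618, is rounded up to 17/10.\<close>
  show ?thesis
  proof (rule ccontr)
    assume "\<not> ?thesis"
    then have gt: "17 / 10 * ob n < N n ?k" by simp
    have "0 < N n ?k" using gt ob by linarith
    then have "17 / 10 * ob n * N n ?k < N n ?k * N n ?k"
      using gt by (rule mult_strict_right_mono[rotated])
    moreover have "ob n * (17 / 10 * ob n) < ob n * N n ?k"
      using gt ob by (rule mult_strict_left_mono)
    moreover have "0 < ob n * ob n" using ob by simp
    ultimately show False
      using \<open>(N n ?k)\<^sup>2 \<le> _\<close> by (simp only: power2_eq_square)
  qed
qed

text \<open>Moving the centre to \<open>fstar\<close> costs one more \<open>omega\<close>, so 17/10
  becomes 27/10. The radius is taken at a later round \<open>n\<close> so that one factor serves all
  rounds up to \<open>n\<close>.\<close>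

lemma conf_set_radius_fstar:
  assumes "f \<in> conf_set \<rho> b x fhat \<beta> m" "m \<le> n" "1 \<le> n"
  shows "N m (f - fstar) \<le> 27 / 10 * ob n"
proof (cases "m = 0")
  case True
  have "norm (f - fstar) \<le> 2 * b"
    using assms(1) True norm_triangle_ineq4[of f fstar] fstar_le by (simp add: conf_set_def)
  then have "(norm (f - fstar))\<^sup>2 \<le> (2 * b)\<^sup>2" by (intro power_mono) auto
  then have "(N m (f - fstar))\<^sup>2 \<le> (2 * b * sqrt \<rho>)\<^sup>2"
    unfolding norm_op_sqrt_sum using \<rho>1 True by (simp add: power_mult_distrib mult.commute)
  then have "N m (f - fstar) \<le> 2 * b * sqrt \<rho>"
    by (rule power2_le_imp_le) (use b_pos \<rho>1 in simp)
  also have "\<dots> \<le> 6 * b * sqrt \<rho>" using b_pos \<rho>1 by simp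
  also have "\<dots> \<le> ob n" using omega_ge[OF assms(3)] omega_le_omega_bar[OF assms(3)] by simp
  finally show ?thesis using omega_bar_pos[OF assms(3)] by simp
next
  case False
  then have m: "1 \<le> m" by simp
  have "N m (f - fstar) = norm (op_sqrt (Z m) (f - fhat m) - op_sqrt (Z m) (fstar - fhat m))"
    by (simp add: blinfun.diff_right)
  also have "\<dots> \<le> N m (f - fhat m) + N m (fstar - fhat m)" by (rule norm_triangle_ineq4)
  also have "N m (fstar - fhat m) \<le> om m"
    using conf[OF m] by (simp add: conf_ineqs_def hess_op_eq_wdesign resolvent_arg_def)
  finally show ?thesis
    using conf_set_radius_fhat[OF m assms(1)] omega_le_omega_bar[OF m] omega_bar_mono[OF m assms(2)]
    by simp
qed

text \<open>Optimism: the true value of \<open>xstar\<close> is at most the optimistic value of the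
  played arm, which exceeds its true value by a single width, since the sets are measured from
  \<open>fstar\<close>.\<close>

lemma prediction_gap:
  assumes j: "1 \<le> j" "j \<le> n"
  shows "fstar \<bullet> xstar - fstar \<bullet> x j \<le> 27 / 10 * ob n * sqrt (x j \<bullet> R (j - 1) (x j))"
proof -
  let ?C = "conf_set \<rho> b x fhat \<beta> (j - 1)"
  have n: "1 \<le> n" using j by simp
  have dev: "\<bar>(f - fstar) \<bullet> z\<bar> \<le> 27 / 10 * ob n * sqrt (z \<bullet> R (j - 1) z)" if f: "f \<in> ?C" for f z
  proof -
    have "\<bar>(f - fstar) \<bullet> z\<bar> = sqrt ((z \<bullet> (f - fstar))\<^sup>2)" by (simp add: inner_commute)
    also have "\<dots> \<le> sqrt ((N (j - 1) (f - fstar))\<^sup>2 * (z \<bullet> R (j - 1) z))"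
      unfolding norm_op_sqrt by (intro real_sqrt_le_mono dual_cauchy_schwarz)
    also have "\<dots> = N (j - 1) (f - fstar) * sqrt (z \<bullet> R (j - 1) z)"
      by (simp add: real_sqrt_mult)
    also have "\<dots> \<le> 27 / 10 * ob n * sqrt (z \<bullet> R (j - 1) z)"
      using conf_set_radius_fstar[OF f _ n] j R_nonneg by (intro mult_right_mono) auto
    finally show ?thesis .
  qed
  \<comment> \<open>A supremum of reals dominates its members only when it is bounded; the width at
    \<open>xstar\<close> serves this purpose alone.\<close>
  have "bdd_above ((\<lambda>f. f \<bullet> xstar) ` ?C)"
  proof (rule bdd_aboveI2)
    fix f assume "f \<in> ?C"
    then show "f \<bullet> xstar \<le> fstar \<bullet> xstar + 27 / 10 * ob n * sqrt (xstar \<bullet> R (j - 1) xstar)"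
      using dev[of f xstar] unfolding inner_diff_left by linarith
  qed
  then have "fstar \<bullet> xstar \<le> (SUP f\<in>?C. f \<bullet> xstar)"
    by (intro cSUP_upper fstar_in_conf_set)
  also have "\<dots> \<le> (SUP f\<in>?C. f \<bullet> x j)" by (rule optimism[OF j(1)])
  also have "\<dots> \<le> fstar \<bullet> x j + 27 / 10 * ob n * sqrt (x j \<bullet> R (j - 1) (x j))"
  proof (rule cSUP_least)
    show "?C \<noteq> {}" using fstar_in_conf_set by blast
    fix f assume "f \<in> ?C"
    then show "f \<bullet> x j \<le> fstar \<bullet> x j + 27 / 10 * ob n * sqrt (x j \<bullet> R (j - 1) (x j))"
      using dev[of f "x j"] unfolding inner_diff_left by linarith
  qed
  finally show ?thesis by simp
qed

text \<open>The ratio of the norms before and after the update is 1 + w q with w \<le> 1/4 and, by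
  \<rho> \<ge> 1, q \<le> 1. Hence the constant 2 * 5/4.\<close>

lemma elliptical_potential_predictable:
  "(\<Sum>j=1..n. w j * (x j \<bullet> R (j - 1) (x j))) \<le> 5 / 2 * info_gain (inverse \<rho> *\<^sub>R hess_op x n fstar)"
proof -
  have "w j * (x j \<bullet> R (j - 1) (x j)) \<le> 5 / 4 * (w j * (x j \<bullet> R j (x j)))" if j: "j \<in> {1..n}" for j
  proof -
    define q where "q = x j \<bullet> R (j - 1) (x j)"
    have j': "Suc (j - 1) = j" and "1 \<le> j" using j by auto
    have q0: "0 \<le> q" by (simp add: q_def R_nonneg)
    have "(norm (x j))\<^sup>2 \<le> 1" using x_le[OF \<open>1 \<le> j\<close>] by (simp add: power_le_one)
    then have "x j \<bullet> x j / \<rho> \<le> 1" using \<rho>1 by (simp add: power2_norm_eq_inner divide_le_eq)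
    then have "q \<le> 1" using R_upper[of "x j" "j - 1"] by (simp add: q_def)
    then have wq: "w j * q \<le> 1 / 4"
      using mult_mono[OF logistic_var_le[of "fstar \<bullet> x j"] \<open>q \<le> 1\<close>] q0 by simp
    have pos: "0 < 1 + w j * q" using w_nonneg[of j] q0 by (simp add: add_pos_nonneg)
    have "x j \<bullet> R j (x j) = q / (1 + w j * q)"
      using R_Suc_apply[of "j - 1"] unfolding j' by (simp add: q_def divide_inverse mult.commute)
    moreover have "q \<le> 5 / 4 * (q / (1 + w j * q))"
      using pos mult_left_mono[OF wq q0] by (simp add: field_simps)
    ultimately have "w j * q \<le> w j * (5 / 4 * (x j \<bullet> R j (x j)))"
      using w_nonneg[of j] by (intro mult_left_mono) simp_all
    then show ?thesis by (simp add: q_def mult_ac)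
  qed
  then have "(\<Sum>j=1..n. w j * (x j \<bullet> R (j - 1) (x j))) \<le> 5 / 4 * (\<Sum>j=1..n. w j * (x j \<bullet> R j (x j)))"
    unfolding sum_distrib_left by (rule sum_mono)
  then show ?thesis
    using elliptical_potential[of n] by (simp add: hess_op_eq_wdesign)
qed

theorem regret_bound_path:
  assumes n: "1 \<le> n"
  shows "regret_bound \<rho> b fstar xstar x \<beta> n"
proof -
  define g where "g = info_gain (inverse \<rho> *\<^sub>R hess_op x n fstar)"
  define c where "c = 27 / 10 * ob n"
  define \<nu> where "\<nu> = logistic_var (fstar \<bullet> xstar)"
  define \<delta> where "\<delta> j = fstar \<bullet> xstar - fstar \<bullet> x j" for j
  define q where "q j = x j \<bullet> R (j - 1) (x j)" for j
  define r where "r j = logistic (fstar \<bullet> xstar) - logistic (fstar \<bullet> x j)" for j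
  define \<R> where "\<R> = (\<Sum>j=1..n. r j)"
  have g0: "0 \<le> g" unfolding g_def hess_op_eq_wdesign by (rule info_gain_wdesign_nonneg)
  have c0: "0 \<le> c" using omega_bar_pos[OF n] by (simp add: c_def)
  have \<nu>0: "0 \<le> \<nu>" by (simp add: \<nu>_def logistic_var_pos less_imp_le)
  have q0: "0 \<le> q j" for j by (simp add: q_def R_nonneg)
  have \<delta>0: "0 \<le> \<delta> j" and r0: "0 \<le> r j" if "j \<in> {1..n}" for j
    using best[of j] that logistic_mono by (auto simp: \<delta>_def r_def)
  have \<delta>_le: "\<delta> j \<le> c * sqrt (q j)" if "j \<in> {1..n}" for j
    using prediction_gap[of j n] that by (simp add: \<delta>_def c_def q_def)
  have R0: "0 \<le> \<R>" unfolding \<R>_def by (intro sum_nonneg r0)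
  have wq: "(\<Sum>j=1..n. w j * q j) \<le> 5 / 2 * g"
    unfolding q_def g_def by (rule elliptical_potential_predictable)
  have "(\<Sum>j=1..n. w j) \<le> (\<Sum>j=1..n. \<nu> + r j)"
  proof (rule sum_mono)
    fix j assume "j \<in> {1..n}"
    then show "w j \<le> \<nu> + r j"
      using logistic_var_diff[of "fstar \<bullet> x j" "fstar \<bullet> xstar"] r0[of j] by (simp add: \<nu>_def r_def)
  qed
  then have wsum: "(\<Sum>j=1..n. w j) \<le> n * \<nu> + \<R>"
    by (simp add: sum.distrib \<R>_def)
  \<comment> \<open>The second order terms carry no variance weight; inserting one costs the inverse
    of the smallest variance on [-b,b]. This is the origin of \<open>exp b\<close>, and 10 is 4 *
    5/2.\<close>
  have qsum: "(\<Sum>j=1..n. q j) \<le> 10 * exp b * g"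
  proof -
    have "exp (- b) / 4 \<le> w j" if "j \<in> {1..n}" for j
    proof (rule logistic_var_ge)
      show "\<bar>fstar \<bullet> x j\<bar> \<le> b"
        using Cauchy_Schwarz_ineq2[of fstar "x j"] mult_mono[OF fstar_le x_le[of j]] that b_pos by simp
    qed
    then have "(\<Sum>j=1..n. exp (- b) / 4 * q j) \<le> (\<Sum>j=1..n. w j * q j)"
      by (intro sum_mono mult_right_mono q0)
    then have "exp (- b) / 4 * (\<Sum>j=1..n. q j) \<le> 5 / 2 * g"
      using wq by (simp add: sum_distrib_left)
    then show ?thesis by (simp add: exp_minus field_simps)
  qed
  \<comment> \<open>Each variance is split evenly between the two Cauchy-Schwarz factors: one
    becomes the total variance, the other the potential.\<close>
  have first: "(\<Sum>j=1..n. w j * \<delta> j) \<le> c * (sqrt (n * \<nu> + \<R>) * sqrt (5 / 2 * g))"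
  proof -
    have "(\<Sum>j=1..n. w j * \<delta> j) \<le> (\<Sum>j=1..n. w j * (c * sqrt (q j)))"
      by (intro sum_mono mult_left_mono \<delta>_le w_nonneg)
    also have "\<dots> = c * (\<Sum>j=1..n. \<bar>sqrt (w j)\<bar> * \<bar>sqrt (w j) * sqrt (q j)\<bar>)"
      unfolding sum_distrib_left
      by (intro sum.cong refl) (simp add: abs_mult w_nonneg q0 mult.assoc[symmetric])
    also have "\<dots> \<le> c * (L2_set (\<lambda>j. sqrt (w j)) {1..n} * L2_set (\<lambda>j. sqrt (w j) * sqrt (q j)) {1..n})"
      by (intro mult_left_mono L2_set_mult_ineq c0)
    also have "\<dots> = c * (sqrt (\<Sum>j=1..n. w j) * sqrt (\<Sum>j=1..n. w j * q j))"
      by (simp add: L2_set_def power_mult_distrib w_nonneg q0)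
    also have "\<dots> \<le> c * (sqrt (n * \<nu> + \<R>) * sqrt (5 / 2 * g))"
      using wsum wq by (intro mult_left_mono mult_mono real_sqrt_le_mono c0)
        (auto intro!: sum_nonneg mult_nonneg_nonneg simp: w_nonneg q0 \<nu>0 R0)
    finally show ?thesis .
  qed
  have second: "(\<Sum>j=1..n. (\<delta> j)\<^sup>2 / 4) \<le> 5 / 2 * c\<^sup>2 * exp b * g"
  proof -
    have "(\<delta> j)\<^sup>2 \<le> c\<^sup>2 * q j" if j: "j \<in> {1..n}" for j
      using power_mono[OF \<delta>_le[OF j] \<delta>0[OF j], of 2] q0[of j] by (simp add: power_mult_distrib)
    then have "(\<Sum>j=1..n. (\<delta> j)\<^sup>2 / 4) \<le> (\<Sum>j=1..n. c\<^sup>2 / 4 * q j)"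
      by (intro sum_mono) auto
    also have "\<dots> \<le> c\<^sup>2 / 4 * (10 * exp b * g)"
      unfolding sum_distrib_left[symmetric] by (intro mult_left_mono qsum) auto
    finally show ?thesis by (simp add: mult_ac)
  qed
  have "\<R> \<le> (\<Sum>j=1..n. w j * \<delta> j + (\<delta> j)\<^sup>2 / 4)"
    unfolding \<R>_def
  proof (rule sum_mono)
    fix j assume "j \<in> {1..n}"
    then show "r j \<le> w j * \<delta> j + (\<delta> j)\<^sup>2 / 4"
      using logistic_taylor[OF \<delta>0, of j "fstar \<bullet> x j"] by (simp add: r_def \<delta>_def)
  qed
  then have main: "\<R> \<le> c * (sqrt (n * \<nu> + \<R>) * sqrt (5 / 2 * g)) + 5 / 2 * c\<^sup>2 * exp b * g"
    using first second by (simp add: sum.distrib)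
  define s where "s = c * sqrt (5 / 2 * g)"
  have s0: "0 \<le> s" and s2: "s\<^sup>2 = 5 / 2 * c\<^sup>2 * g"
    using c0 g0 by (simp_all add: s_def power_mult_distrib)
  have "sqrt (n * \<nu> + \<R>) \<le> sqrt (n * \<nu>) + sqrt \<R>"
    using \<nu>0 R0 by (intro sqrt_add_le_add_sqrt) auto
  then have "s * sqrt (n * \<nu> + \<R>) \<le> s * sqrt (n * \<nu>) + s * sqrt \<R>"
    using s0 by (metis distrib_left mult_left_mono)
  \<comment> \<open>By AM-GM half of the regret is left on the right; moving it over doubles all
    other terms.\<close>
  moreover have "s * sqrt \<R> \<le> s\<^sup>2 / 2 + \<R> / 2"
    using sum_squares_bound[of s "sqrt \<R>"] R0 by simp
  ultimately have R_le: "\<R> \<le> 2 * s * sqrt (n * \<nu>) + s\<^sup>2 + 5 * c\<^sup>2 * exp b * g"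
    using main by (simp add: s_def mult_ac)
  have "2 * s * sqrt (n * \<nu>) \<le> 12 * ob n * sqrt (\<nu> * n * g)"
  proof -
    \<comment> \<open>This is \<open>sqrt (5 / 2) \<le> 20 / 9\<close>, the largest value for which
      \<open>2 * (27 / 10)\<close> times it stays within 12.\<close>
    have "sqrt (5 / 2) \<le> 2 * (20 / 27 :: real) * (3 / 2)"
      by (rule real_le_lsqrt) (auto simp: power2_eq_square)
    then have "2 * (27 / 10) * sqrt (5 / 2) \<le> (12 :: real)" by simp
    then have "2 * (27 / 10) * sqrt (5 / 2) * (ob n * (sqrt g * sqrt (n * \<nu>)))
        \<le> 12 * (ob n * (sqrt g * sqrt (n * \<nu>)))"
      using omega_bar_pos[OF n] g0 \<nu>0 by (intro mult_right_mono) auto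
    moreover have "sqrt (5 / 2 * g) = sqrt (5 / 2) * sqrt g" by (rule real_sqrt_mult)
    moreover have "sqrt (\<nu> * n * g) = sqrt g * sqrt (n * \<nu>)" by (simp add: real_sqrt_mult)
    ultimately show ?thesis
      unfolding s_def c_def by (simp only: mult_ac)
  qed
  moreover have "s\<^sup>2 + 5 * c\<^sup>2 * exp b * g \<le> 64 * exp b * (ob n)\<^sup>2 * g"
  proof -
    define t where "t = (ob n)\<^sup>2 * g"
    have t0: "0 \<le> t" using g0 by (simp add: t_def)
    have e: "1 \<le> exp b" using b_pos by simp
    \<comment> \<open>The fractions are 5/2 and 5 times (27/10)^2; their sum 54.675 is below
      64.\<close>
    have "s\<^sup>2 + 5 * c\<^sup>2 * exp b * g = 729 / 40 * t + 729 / 20 * (exp b * t)"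
      unfolding s2 c_def t_def power_mult_distrib by (simp add: mult_ac power_divide)
    also have "\<dots> \<le> 729 / 40 * (exp b * t) + 729 / 20 * (exp b * t)"
      using mult_right_mono[OF e t0] by (simp only: mult_1)
    also have "\<dots> \<le> 64 * (exp b * t)" using t0 by simp
    finally show ?thesis by (simp add: t_def mult_ac)
  qed
  ultimately have "\<R> \<le> 12 * ob n * sqrt (\<nu> * n * g) + 64 * exp b * (ob n)\<^sup>2 * g"
    using R_le by linarith
  then show ?thesis
    by (simp add: regret_bound_def regret_def Let_def \<R>_def r_def g_def \<nu>_def)
qed

end

section \<open>Sign and monotonicity of the explicit radius\<close>

lemma design_info_gain:
  fixes x :: "nat \<Rightarrow> 'h::real_inner"
  assumes \<rho>: "1 \<le> \<rho>"
  shows "0 \<le> info_gain (inverse \<rho> *\<^sub>R design_op x n)"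
  "m \<le> n \<Longrightarrow> info_gain (inverse \<rho> *\<^sub>R design_op x m) \<le> info_gain (inverse \<rho> *\<^sub>R design_op x n)"
proof -
  interpret regularized_design \<rho> "\<lambda>_. 1" x by unfold_locales (use \<rho> in auto)
  show "0 \<le> info_gain (inverse \<rho> *\<^sub>R design_op x n)"
    unfolding design_op_eq_wdesign by (rule info_gain_wdesign_nonneg)
  show "m \<le> n \<Longrightarrow> info_gain (inverse \<rho> *\<^sub>R design_op x m) \<le> info_gain (inverse \<rho> *\<^sub>R design_op x n)"
    unfolding design_op_eq_wdesign using \<rho> by (intro info_gain_wdesign_mono) auto
qed

lemma beta_explicit_nonneg:
  assumes "1 \<le> \<rho>" "0 < y"
  shows "0 \<le> beta_explicit \<rho> y x n"
  using design_info_gain(1)[OF assms(1), of x n] assms by (simp add: beta_explicit_def Let_def)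

lemma beta_explicit_mono:
  assumes \<rho>: "1 \<le> \<rho>" and "m \<le> n"
  shows "beta_explicit \<rho> y x m \<le> beta_explicit \<rho> y x n"
  unfolding beta_explicit_def Let_def using design_info_gain(2)[OF assms, of x] \<rho>
  by (intro add_mono divide_right_mono real_sqrt_le_mono mult_left_mono) auto


section \<open>Concentration of the noise martingale\<close>

lemma exp_le_quadratic:
  fixes z :: real
  assumes "z \<le> 1"
  shows "exp z \<le> 1 + z + z\<^sup>2"
proof (cases "0 \<le> z")
  case True
  then show ?thesis using exp_bound assms by simp
next
  case False
  have p: "0 < 1 - z" using False by simp
  have "1 - z \<le> exp (- z)" using exp_ge_add_one_self[of "- z"] by simp
  then have "exp z * (1 - z) \<le> exp z * exp (- z)" by (intro mult_left_mono) auto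
  also have "\<dots> = 1" by (simp add: exp_minus)
  \<comment> \<open>The product is 1 - z^3.\<close>
  also have "1 \<le> (1 + z + z\<^sup>2) * (1 - z)"
  proof -
    have "z * z\<^sup>2 \<le> 0" using False by (intro mult_nonpos_nonneg) auto
    then show ?thesis by (simp add: algebra_simps power2_eq_square)
  qed
  finally show ?thesis using p by (simp only: mult_le_cancel_right_pos)
qed

text \<open>One step of the exponential supermartingale for \<open>sqrt (\<rho> + s)\<close>, where \<open>s\<close> is the squared
  self-normalised norm: concavity of the square root bounds the increment linearly, with slope
  \<open>t / 2\<close>, and \<open>exp z \<le> 1 + z + z\<^sup>2\<close> makes the dependence on the noise \<open>e\<close> quadratic.\<close>

lemma exp_sqrt_step:
  fixes \<rho> s s' a q w e :: real
  assumes \<rho>: "1 \<le> \<rho>" and s: "0 \<le> s" and s': "s' \<le> s + 2 * e * a + e\<^sup>2 * q - w * a\<^sup>2"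
    and e: "\<bar>e\<bar> \<le> 1" and w: "0 \<le> w" and q: "0 \<le> q" "q \<le> 1" and a: "\<rho> * a\<^sup>2 \<le> s" and s'0: "0 \<le> s'"
  defines "t \<equiv> sqrt \<rho> / (4 * sqrt (\<rho> + s))"
  defines "c \<equiv> t * q / 2 + 2 * t\<^sup>2 * a\<^sup>2 + t\<^sup>2 * q\<^sup>2 / 2"
  shows "exp (sqrt \<rho> / 4 * sqrt (\<rho> + s'))
      \<le> exp (sqrt \<rho> / 4 * sqrt (\<rho> + s)) * exp (- t * w * a\<^sup>2 / 2) * (1 + t * a * e + c * e\<^sup>2)"
    and "c * w \<le> t * w * a\<^sup>2 / 2 + 5 / 32 * (w * q)"
    and "\<bar>t * a\<bar> \<le> 1" and "0 \<le> c" and "c \<le> 1" and "0 \<le> t"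
proof -
  define r where "r = sqrt (\<rho> + s)"
  have r2: "r\<^sup>2 = \<rho> + s" using \<rho> s by (simp add: r_def)
  have r_ge: "sqrt \<rho> \<le> r" using s by (simp add: r_def)
  have r0: "0 < r" using r_ge \<rho> by (smt (verit) real_sqrt_gt_zero)
  show t0: "0 \<le> t" using \<rho> s by (simp add: t_def)
  have t4: "t \<le> 1 / 4"
    using r_ge r0 by (simp add: t_def r_def[symmetric] divide_le_eq)
  have t2: "t\<^sup>2 = \<rho> / (16 * (\<rho> + s))"
    using \<rho> s by (simp add: t_def power_divide power_mult_distrib)
  \<comment> \<open>The decisive bound: the slope cancels the growth of \<open>a\<close> with
    \<open>s\<close>, uniformly in \<open>s\<close>.\<close>
  have ta2: "t\<^sup>2 * a\<^sup>2 \<le> 1 / 16"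
    unfolding t2 using a \<rho> s by (simp add: field_simps)
  then have "(t * a)\<^sup>2 \<le> (1 / 4)\<^sup>2" by (simp add: power_mult_distrib power_divide)
  then have ta: "\<bar>t * a\<bar> \<le> 1 / 4" by (simp add: power2_le_iff_abs_le)
  then show "\<bar>t * a\<bar> \<le> 1" by simp
  show c0: "0 \<le> c" using t0 q by (simp add: c_def)
  have tq: "t * q \<le> 1 / 4" using mult_mono[OF t4 q(2)] q t0 by simp
  have tq0: "0 \<le> t * q" using t0 q by simp
  have tq2: "t\<^sup>2 * q\<^sup>2 \<le> 1 / 16"
    using power_mono[OF tq tq0, of 2] by (simp add: power_mult_distrib power_divide)
  show "c \<le> 1" using tq ta2 tq2 by (simp add: c_def)
  \<comment> \<open>As t \<le> 1/4, the term in \<open>a\<^sup>2\<close> fits into the drift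
    \<open>t * w * a\<^sup>2 / 2\<close>; the two terms in \<open>q\<close> contribute 1/8 and 1/32,
    hence 5/32.\<close>
  show "c * w \<le> t * w * a\<^sup>2 / 2 + 5 / 32 * (w * q)"
  proof -
    have "t\<^sup>2 * q\<^sup>2 \<le> q / 16"
    proof -
      have "t\<^sup>2 * q\<^sup>2 = (t * t) * (q * q)" by (simp add: power2_eq_square)
      also have "\<dots> \<le> (1 / 4 * (1 / 4)) * (q * 1)"
        using t0 t4 q by (intro mult_mono) auto
      finally show ?thesis by simp
    qed
    moreover have "t * q \<le> q / 4" using mult_right_mono[OF t4 q(1)] by simp
    moreover have "2 * (t\<^sup>2 * a\<^sup>2) \<le> t * a\<^sup>2 / 2"
    proof -
      have "t * (t * a\<^sup>2) \<le> 1 / 4 * (t * a\<^sup>2)"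
        using t4 t0 by (intro mult_right_mono) auto
      then show ?thesis by (simp add: power2_eq_square mult_ac)
    qed
    ultimately have "c \<le> t * a\<^sup>2 / 2 + 5 / 32 * q"
      unfolding c_def by linarith
    then have "c * w \<le> (t * a\<^sup>2 / 2 + 5 / 32 * q) * w" using w by (rule mult_right_mono)
    also have "\<dots> = t * w * a\<^sup>2 / 2 + 5 / 32 * (w * q)" by (simp add: algebra_simps)
    finally show ?thesis .
  qed
  define z where "z = t * (e * a + e\<^sup>2 * q / 2)"
  have e2: "e\<^sup>2 \<le> 1" using e by (simp add: abs_square_le_1)
  have "t * a * e \<le> 1 / 4"
  proof -
    have "\<bar>t * a * e\<bar> \<le> 1 / 4 * 1"
      unfolding abs_mult[of "t * a" e] using ta e by (intro mult_mono) auto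
    then show ?thesis by simp
  qed
  moreover have "t * q * e\<^sup>2 \<le> 1 / 4 * 1"
    using tq tq0 e2 by (intro mult_mono) auto
  ultimately have z1: "z \<le> 1" by (simp add: z_def algebra_simps)
  have "sqrt (\<rho> + s') \<le> r + (s' - s) / (2 * r)"
  proof -
    have "0 \<le> (sqrt (\<rho> + s') - r)\<^sup>2" by simp
    also have "\<dots> = \<rho> + s' - 2 * r * sqrt (\<rho> + s') + r\<^sup>2"
      using \<rho> s'0 by (simp add: power2_diff)
    finally have "2 * r * sqrt (\<rho> + s') \<le> 2 * r\<^sup>2 + (s' - s)" using r2 by simp
    then show ?thesis using r0 by (simp add: field_simps power2_eq_square)
  qed
  then have "sqrt \<rho> / 4 * sqrt (\<rho> + s') \<le> sqrt \<rho> / 4 * (r + (s' - s) / (2 * r))"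
    using \<rho> by (intro mult_left_mono) auto
  also have "\<dots> = sqrt \<rho> / 4 * r + t * ((s' - s) / 2)"
    using r0 by (simp add: t_def r_def[symmetric] field_simps)
  also have "t * ((s' - s) / 2) \<le> t * ((2 * e * a + e\<^sup>2 * q - w * a\<^sup>2) / 2)"
    using s' t0 by (intro mult_left_mono) auto
  also have "\<dots> = - t * w * a\<^sup>2 / 2 + z" by (simp add: z_def field_simps)
  finally have "exp (sqrt \<rho> / 4 * sqrt (\<rho> + s')) \<le> exp (sqrt \<rho> / 4 * r + (- t * w * a\<^sup>2 / 2 + z))"
    by simp
  also have "\<dots> = exp (sqrt \<rho> / 4 * r) * exp (- t * w * a\<^sup>2 / 2) * exp z"
    by (simp only: exp_add mult.assoc)
  also have "\<dots> \<le> exp (sqrt \<rho> / 4 * r) * exp (- t * w * a\<^sup>2 / 2) * (1 + t * a * e + c * e\<^sup>2)"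
  proof (intro mult_left_mono)
    have "(e * a + e\<^sup>2 * q / 2)\<^sup>2 \<le> 2 * (e * a)\<^sup>2 + 2 * (e\<^sup>2 * q / 2)\<^sup>2"
      using zero_le_power2[of "e * a - e\<^sup>2 * q / 2"] by (simp add: power2_eq_square algebra_simps)
    also have "2 * (e\<^sup>2 * q / 2)\<^sup>2 = e\<^sup>2 * (e\<^sup>2 * q\<^sup>2 / 2)"
      by (simp add: power2_eq_square)
    also have "\<dots> \<le> e\<^sup>2 * (q\<^sup>2 / 2)"
      using mult_right_mono[OF e2, of "q\<^sup>2"] by (intro mult_left_mono) auto
    finally have "(e * a + e\<^sup>2 * q / 2)\<^sup>2 \<le> e\<^sup>2 * (2 * a\<^sup>2 + q\<^sup>2 / 2)"
      by (simp add: power_mult_distrib distrib_left)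
    then have "z\<^sup>2 \<le> t\<^sup>2 * (e\<^sup>2 * (2 * a\<^sup>2 + q\<^sup>2 / 2))"
      unfolding z_def power_mult_distrib by (intro mult_left_mono) auto
    moreover have "1 + z + t\<^sup>2 * (e\<^sup>2 * (2 * a\<^sup>2 + q\<^sup>2 / 2)) = 1 + t * a * e + c * e\<^sup>2"
      by (simp add: z_def c_def algebra_simps)
    ultimately show "exp z \<le> 1 + t * a * e + c * e\<^sup>2"
      using exp_le_quadratic[OF z1] by linarith
  qed auto
  finally show "exp (sqrt \<rho> / 4 * sqrt (\<rho> + s'))
      \<le> exp (sqrt \<rho> / 4 * sqrt (\<rho> + s)) * exp (- t * w * a\<^sup>2 / 2) * (1 + t * a * e + c * e\<^sup>2)"
    by (simp add: r_def)
qed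

section \<open>The self-normalised norm over one round\<close>

context regularized_design
begin

text \<open>Updating the resolvent gains \<open>w (Suc n) * a\<^sup>2\<close>, the drift that later
  absorbs the second order term in \<open>a\<close>. The bound on \<open>a\<^sup>2\<close> is what
  the slope of the square root has to cancel.\<close>

lemma resolvent_quad_Suc:
  fixes n :: nat and m :: "'h" and e :: real
  defines "a \<equiv> x (Suc n) \<bullet> R (Suc n) m" and "q \<equiv> x (Suc n) \<bullet> R (Suc n) (x (Suc n))"
  shows "(m + e *\<^sub>R x (Suc n)) \<bullet> R (Suc n) (m + e *\<^sub>R x (Suc n))
      \<le> m \<bullet> R n m + 2 * e * a + e\<^sup>2 * q - w (Suc n) * a\<^sup>2"
    and "a\<^sup>2 \<le> q * (m \<bullet> R n m)"
proof -
  let ?x = "x (Suc n)" and ?f = "R (Suc n) m"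
  have "m \<bullet> ?f = ?f \<bullet> Z (Suc n) ?f" by (simp only: Z_R inner_commute)
  also have "\<dots> = ?f \<bullet> Z n ?f + w (Suc n) * a\<^sup>2"
    by (simp add: resolvent_arg_Suc inner_add a_def power2_eq_square inner_commute del: resolvent.simps)
  finally have le: "m \<bullet> ?f \<le> m \<bullet> R n m - w (Suc n) * a\<^sup>2"
    using R_variational[of m ?f n] by linarith
  have "(m + e *\<^sub>R ?x) \<bullet> R (Suc n) (m + e *\<^sub>R ?x) = m \<bullet> ?f + 2 * e * a + e\<^sup>2 * q"
    using R_symmetric[of "Suc n" m ?x]
    by (simp add: blinfun.add_right blinfun.scaleR_right inner_add a_def q_def power2_eq_square
        inner_commute algebra_simps del: resolvent.simps)
  then show "(m + e *\<^sub>R ?x) \<bullet> R (Suc n) (m + e *\<^sub>R ?x)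
      \<le> m \<bullet> R n m + 2 * e * a + e\<^sup>2 * q - w (Suc n) * a\<^sup>2"
    using le by linarith
  have "a\<^sup>2 \<le> (?f \<bullet> Z (Suc n) ?f) * q"
    unfolding a_def q_def by (rule dual_cauchy_schwarz)
  also have "?f \<bullet> Z (Suc n) ?f = m \<bullet> ?f" by (simp only: Z_R inner_commute)
  also have "m \<bullet> ?f * q \<le> m \<bullet> R n m * q"
  proof (rule mult_right_mono)
    have "0 \<le> w (Suc n) * a\<^sup>2" using w_nonneg by simp
    then show "m \<bullet> ?f \<le> m \<bullet> R n m" using le by linarith
    show "0 \<le> q" unfolding q_def by (rule R_nonneg)
  qed
  finally show "a\<^sup>2 \<le> q * (m \<bullet> R n m)" by (simp add: mult.commute)
qed

end

text \<open>Stated for the resolvent applied to a random vector, which avoids measurability in the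
  operator space, not second countable in general. \<open>v\<close> is generalised because the
  recursion also applies the previous resolvent to the new arm.\<close>

lemma measurable_resolvent:
  fixes X :: "nat \<Rightarrow> 'w \<Rightarrow> 'h::{real_inner, second_countable_topology}"
  assumes "\<And>j. j \<in> {1..n} \<Longrightarrow> X j \<in> borel_measurable N"
    and "\<And>j. j \<in> {1..n} \<Longrightarrow> w j \<in> borel_measurable N"
    and "v \<in> borel_measurable N"
  shows "(\<lambda>\<omega>. resolvent \<rho> (\<lambda>j. w j \<omega>) (\<lambda>j. X j \<omega>) n (v \<omega>)) \<in> borel_measurable N"
  using assms
proof (induction n arbitrary: v)
  case 0
  then show ?case by (simp add: blinfun.scaleR_left)
next
  case (Suc n)
  have [measurable]: "X (Suc n) \<in> borel_measurable N" "w (Suc n) \<in> borel_measurable N"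
    "v \<in> borel_measurable N"
    using Suc.prems by auto
  have [measurable]: "(\<lambda>\<omega>. resolvent \<rho> (\<lambda>j. w j \<omega>) (\<lambda>j. X j \<omega>) n (u \<omega>)) \<in> borel_measurable N"
    if "u \<in> borel_measurable N" for u
    using Suc that by auto
  show ?case
    by (simp add: blinfun.diff_left blinfun.scaleR_left rank_one_apply) measurable
qed

text \<open>Freezing the process at \<open>c\<close> after a crossing gives means
  \<open>H n n\<close> that do not increase and dominate \<open>c\<close> times the probability of a
  crossing up to \<open>n\<close>; continuity from below removes the horizon.\<close>

lemma (in prob_space) ville_maximal_inequality:
  fixes E :: "nat \<Rightarrow> 'a \<Rightarrow> real"
  assumes sub: "\<And>n. subalgebra M (F n)" and F_mono: "\<And>m n. m \<le> n \<Longrightarrow> sets (F m) \<subseteq> sets (F n)"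
    and E_meas: "\<And>n. E n \<in> borel_measurable (F n)"
    and E_int: "\<And>n. integrable M (E n)" and E_nonneg: "\<And>n \<omega>. \<omega> \<in> space M \<Longrightarrow> 0 \<le> E n \<omega>"
    and super: "\<And>n A. A \<in> sets (F n) \<Longrightarrow>
      (\<integral>\<omega>. indicator A \<omega> * E (Suc n) \<omega> \<partial>M) \<le> (\<integral>\<omega>. indicator A \<omega> * E n \<omega> \<partial>M)"
    and c: "0 < c"
  shows "{\<omega> \<in> space M. \<exists>n. c \<le> E n \<omega>} \<in> sets M"
    "c * prob {\<omega> \<in> space M. \<exists>n. c \<le> E n \<omega>} \<le> (\<integral>\<omega>. E 0 \<omega> \<partial>M)"
proof -
  have space: "space (F n) = space M" for n using sub by (simp add: subalgebra_def)
  have [measurable]: "E n \<in> borel_measurable M" for n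
    using measurable_from_subalg[OF sub E_meas] .
  show "{\<omega> \<in> space M. \<exists>n. c \<le> E n \<omega>} \<in> sets M" by measurable
  define G where "G n = {\<omega> \<in> space M. \<forall>k\<le>n. E k \<omega> < c}" for n
  have E_le: "E k \<in> borel_measurable (F n)" if "k \<le> n" for k n
    by (rule measurable_from_subalg[OF _ E_meas[of k]]) (simp add: subalgebra_def space F_mono[OF that])
  have G_F: "G n \<in> sets (F n)" for n
  proof -
    have "G n = (\<Inter>k\<in>{..n}. {\<omega> \<in> space (F n). E k \<omega> < c})"
      by (auto simp: G_def space)
    also have "\<dots> \<in> sets (F n)"
      by (intro sets.finite_INT borel_measurable_less E_le) auto
    finally show ?thesis .
  qed
  then have [measurable]: "G n \<in> sets M" for n
    using sub by (auto simp: subalgebra_def)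
  have int: "integrable M (\<lambda>\<omega>. indicator (G n) \<omega> * E m \<omega>)" for n m
    by (rule integrable_mult_indicator[of "G n" M "E m", simplified real_scaleR_def]) (auto intro: E_int)
  have int_c: "integrable M (\<lambda>\<omega>. c * indicator (space M - G n) \<omega>)" for n
    by (rule integrable_mult_right) (simp add: integrable_real_indicator emeasure_eq_measure)
  define H where "H n m = (\<integral>\<omega>. c * indicator (space M - G n) \<omega> + indicator (G n) \<omega> * E m \<omega> \<partial>M)" for n m
  have H: "H n n \<le> (\<integral>\<omega>. E 0 \<omega> \<partial>M)" for n
  proof (induction n)
    case 0
    show ?case unfolding H_def
      by (intro integral_mono Bochner_Integration.integrable_add int int_c E_int)
         (auto simp: G_def indicator_def not_less)
  next
    case (Suc n)
    \<comment> \<open>At a first crossing the value is at least \<open>c\<close>, so charging only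
      \<open>c\<close> lowers the integral.\<close>
    have "H (Suc n) (Suc n) \<le> H n (Suc n)" unfolding H_def
    proof (intro integral_mono Bochner_Integration.integrable_add int int_c)
      fix \<omega> assume \<omega>: "\<omega> \<in> space M"
      have G: "\<omega> \<in> G (Suc n) \<longleftrightarrow> \<omega> \<in> G n \<and> E (Suc n) \<omega> < c"
        using \<omega> by (auto simp: G_def le_Suc_eq)
      show "c * indicator (space M - G (Suc n)) \<omega> + indicator (G (Suc n)) \<omega> * E (Suc n) \<omega>
          \<le> c * indicator (space M - G n) \<omega> + indicator (G n) \<omega> * E (Suc n) \<omega>"
        using \<omega> G by (auto simp: indicator_def)
    qed
    also have "H n (Suc n) \<le> H n n"
      unfolding H_def Bochner_Integration.integral_add[OF int_c int]
      using super[OF G_F] by simp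
    finally show ?case using Suc by simp
  qed
  have le: "c * prob (space M - G n) \<le> (\<integral>\<omega>. E 0 \<omega> \<partial>M)" for n
  proof -
    have "c * prob (space M - G n) = (\<integral>\<omega>. c * indicator (space M - G n) \<omega> \<partial>M)"
      by simp
    also have "\<dots> \<le> H n n"
      unfolding H_def by (intro integral_mono Bochner_Integration.integrable_add int int_c)
        (auto simp: indicator_def E_nonneg)
    finally show ?thesis using H[of n] by simp
  qed
  have "incseq (\<lambda>n. space M - G n)"
    unfolding incseq_def by (auto simp: G_def)
  then have "(\<lambda>n. prob (space M - G n)) \<longlonglongrightarrow> prob (\<Union>n. space M - G n)"
    by (intro finite_Lim_measure_incseq) auto
  also have "(\<Union>n. space M - G n) = {\<omega> \<in> space M. \<exists>n. c \<le> E n \<omega>}"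
  proof
    show "(\<Union>n. space M - G n) \<subseteq> {\<omega> \<in> space M. \<exists>n. c \<le> E n \<omega>}"
      by (auto simp: G_def not_less)
    show "{\<omega> \<in> space M. \<exists>n. c \<le> E n \<omega>} \<subseteq> (\<Union>n. space M - G n)"
    proof clarify
      fix \<omega> n assume "\<omega> \<in> space M" "c \<le> E n \<omega>"
      then have "\<omega> \<in> space M - G n" by (auto simp: G_def not_less)
      then show "\<omega> \<in> (\<Union>n. space M - G n)" by blast
    qed
  qed
  finally have "(\<lambda>n. c * prob (space M - G n)) \<longlonglongrightarrow> c * prob {\<omega> \<in> space M. \<exists>n. c \<le> E n \<omega>}"
    by (intro tendsto_intros)
  then show "c * prob {\<omega> \<in> space M. \<exists>n. c \<le> E n \<omega>} \<le> (\<integral>\<omega>. E 0 \<omega> \<partial>M)"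
    using le by (intro LIMSEQ_le_const2) auto
qed

section \<open>Measurability and conditional moments of the noise\<close>

context logistic_bandit
begin

abbreviation \<epsilon> :: "nat \<Rightarrow> 'w \<Rightarrow> real" where "\<epsilon> \<equiv> noise fstar X Y"
abbreviation arm_var :: "nat \<Rightarrow> 'w \<Rightarrow> real" where "arm_var j \<omega> \<equiv> logistic_var (fstar \<bullet> X j \<omega>)"
abbreviation cond_var :: "nat \<Rightarrow> 'w \<Rightarrow> real" where
  "cond_var j \<equiv> real_cond_exp M (F (j - 1)) (\<lambda>\<omega>. (\<epsilon> j \<omega>)\<^sup>2)"

text \<open>Clipping the conditional variance changes it only on a null set, and makes the operator bounds
  hold everywhere instead of almost surely.\<close>

definition wt :: "nat \<Rightarrow> 'w \<Rightarrow> real" where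
  "wt j \<omega> = min (arm_var j \<omega>) (max 0 (cond_var j \<omega>))"

lemma sub_F: "m \<le> n \<Longrightarrow> subalgebra (F n) (F m)"
  using space_F sets_F_mono by (simp add: subalgebra_def)

lemma F_M: "f \<in> borel_measurable (F n) \<Longrightarrow> f \<in> borel_measurable M"
  using measurable_from_subalg[OF subalg] .

lemma F_le: "f \<in> borel_measurable (F m) \<Longrightarrow> m \<le> n \<Longrightarrow> f \<in> borel_measurable (F n)"
  using measurable_from_subalg[OF sub_F] .

lemma X_F: "1 \<le> j \<Longrightarrow> j \<le> Suc n \<Longrightarrow> X j \<in> borel_measurable (F n)"
  by (rule F_le[OF X_predictable]) auto

lemma logistic_measurable [measurable]: "logistic \<in> borel_measurable borel"
  unfolding logistic_def[abs_def] by measurable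

lemma logistic_var_measurable [measurable]: "logistic_var \<in> borel_measurable borel"
  unfolding logistic_var_def[abs_def] by measurable

lemma noise_F: "1 \<le> j \<Longrightarrow> j \<le> n \<Longrightarrow> \<epsilon> j \<in> borel_measurable (F n)"
proof -
  assume j: "1 \<le> j" "j \<le> n"
  have [measurable]: "Y j \<in> borel_measurable (F n)" "X j \<in> borel_measurable (F n)"
    using F_le[OF Y_adapted] X_F j by auto
  show ?thesis unfolding noise_def[abs_def] by measurable
qed

lemma wt_F: "1 \<le> j \<Longrightarrow> j \<le> Suc n \<Longrightarrow> wt j \<in> borel_measurable (F n)"
proof -
  assume j: "1 \<le> j" "j \<le> Suc n"
  have [measurable]: "cond_var j \<in> borel_measurable (F n)" "X j \<in> borel_measurable (F n)"
    using F_le[OF borel_measurable_cond_exp, of "j - 1" n] X_F j by auto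
  show ?thesis unfolding wt_def[abs_def] by measurable
qed

lemma wt_nonneg: "0 \<le> wt j \<omega>" and wt_le: "wt j \<omega> \<le> arm_var j \<omega>"
  using logistic_var_pos[of "fstar \<bullet> X j \<omega>"] by (auto simp: wt_def)

lemma wt_le_one: "wt j \<omega> \<le> 1"
  using wt_le[of j \<omega>] logistic_var_le[of "fstar \<bullet> X j \<omega>"] by linarith

lemma noise_le_one: "1 \<le> j \<Longrightarrow> \<omega> \<in> space M \<Longrightarrow> \<bar>\<epsilon> j \<omega>\<bar> \<le> 1"
  using Y_range[of j \<omega>] logistic_pos[of "fstar \<bullet> X j \<omega>"] logistic_less_one[of "fstar \<bullet> X j \<omega>"]
  by (auto simp: noise_def abs_le_iff)

lemma X_norm_le: "1 \<le> j \<Longrightarrow> \<omega> \<in> space M \<Longrightarrow> norm (X j \<omega>) \<le> 1"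
  using X_arm[of j \<omega>] arms_ball by (auto simp: subset_iff)

lemma bounded_integrable:
  assumes "f \<in> borel_measurable M" "\<And>\<omega>. \<omega> \<in> space M \<Longrightarrow> \<bar>f \<omega>\<bar> \<le> B"
  shows "integrable M (f :: 'w \<Rightarrow> real)"
  by (rule integrable_const_bound[where B = B]) (use assms in auto)

text \<open>By Y^2 \<le> Y the squared noise is dominated by an expression affine in
  \<open>Y\<close> with conditional mean \<mu> (1 - \<mu>). So the conditional variance lies almost
  surely in the clipping range.\<close>

lemma cond_var_eq_wt:
  assumes "1 \<le> j"
  shows "AE \<omega> in M. cond_var j \<omega> = wt j \<omega>"
proof -
  interpret sub: finite_measure_subalgebra M "F (j - 1)"
    by unfold_locales (rule subalg)
  have [measurable]: "\<epsilon> j \<in> borel_measurable M" "X j \<in> borel_measurable M" "Y j \<in> borel_measurable M"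
    "X j \<in> borel_measurable (F (j - 1))"
    using F_M noise_F Y_adapted X_predictable assms by blast+
  define \<mu> where "\<mu> \<omega> = logistic (fstar \<bullet> X j \<omega>)" for \<omega>
  have \<mu>F [measurable]: "\<mu> \<in> borel_measurable (F (j - 1))" unfolding \<mu>_def[abs_def] by measurable
  have [measurable]: "\<mu> \<in> borel_measurable M" by (rule F_M[OF \<mu>F])
  have \<mu>01: "0 \<le> \<mu> \<omega>" "\<mu> \<omega> \<le> 1" for \<omega>
    using logistic_pos[of "fstar \<bullet> X j \<omega>"] logistic_less_one[of "fstar \<bullet> X j \<omega>"] by (auto simp: \<mu>_def)
  have Y01: "0 \<le> Y j \<omega>" "Y j \<omega> \<le> 1" if "\<omega> \<in> space M" for \<omega>
    using Y_range[OF assms that] by auto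
  have int1: "integrable M (\<lambda>\<omega>. (\<epsilon> j \<omega>)\<^sup>2)"
    using noise_le_one[OF assms] by (intro bounded_integrable[of _ 1]) (auto simp: abs_square_le_1)
  have int2: "integrable M (\<lambda>\<omega>. (1 - 2 * \<mu> \<omega>) * Y j \<omega>)"
  proof (rule bounded_integrable[of _ 1])
    fix \<omega> assume "\<omega> \<in> space M"
    then show "\<bar>(1 - 2 * \<mu> \<omega>) * Y j \<omega>\<bar> \<le> 1"
      unfolding abs_mult using \<mu>01[of \<omega>] Y01[of \<omega>] by (intro mult_le_one) auto
  qed measurable
  have int3: "integrable M (\<lambda>\<omega>. (\<mu> \<omega>)\<^sup>2)"
    using \<mu>01 by (intro bounded_integrable[of _ 1]) (auto simp: power_le_one)
  have "AE \<omega> in M. cond_var j \<omega> \<le> real_cond_exp M (F (j - 1)) (\<lambda>\<omega>. (1 - 2 * \<mu> \<omega>) * Y j \<omega> + (\<mu> \<omega>)\<^sup>2) \<omega>"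
  proof (rule sub.real_cond_exp_mono)
    show "AE \<omega> in M. (\<epsilon> j \<omega>)\<^sup>2 \<le> (1 - 2 * \<mu> \<omega>) * Y j \<omega> + (\<mu> \<omega>)\<^sup>2"
    proof (rule AE_I2)
      fix \<omega> assume "\<omega> \<in> space M"
      then have "Y j \<omega> * Y j \<omega> \<le> Y j \<omega> * 1" using Y01 by (intro mult_left_mono) auto
      then show "(\<epsilon> j \<omega>)\<^sup>2 \<le> (1 - 2 * \<mu> \<omega>) * Y j \<omega> + (\<mu> \<omega>)\<^sup>2"
        by (simp add: noise_def \<mu>_def power2_eq_square algebra_simps)
    qed
  qed (intro int1 int2 int3 Bochner_Integration.integrable_add)+
  moreover have "AE \<omega> in M. real_cond_exp M (F (j - 1)) (\<lambda>\<omega>. (1 - 2 * \<mu> \<omega>) * Y j \<omega> + (\<mu> \<omega>)\<^sup>2) \<omega>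
      = real_cond_exp M (F (j - 1)) (\<lambda>\<omega>. (1 - 2 * \<mu> \<omega>) * Y j \<omega>) \<omega>
        + real_cond_exp M (F (j - 1)) (\<lambda>\<omega>. (\<mu> \<omega>)\<^sup>2) \<omega>"
    by (rule sub.real_cond_exp_add[OF int2 int3])
  moreover have "AE \<omega> in M. real_cond_exp M (F (j - 1)) (\<lambda>\<omega>. (1 - 2 * \<mu> \<omega>) * Y j \<omega>) \<omega>
      = (1 - 2 * \<mu> \<omega>) * real_cond_exp M (F (j - 1)) (Y j) \<omega>"
    by (rule sub.real_cond_exp_mult[OF _ _ int2]) measurable
  moreover have "AE \<omega> in M. real_cond_exp M (F (j - 1)) (\<lambda>\<omega>. (\<mu> \<omega>)\<^sup>2) \<omega> = (\<mu> \<omega>)\<^sup>2"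
    by (rule sub.real_cond_exp_F_meas[OF int3]) measurable
  moreover have "AE \<omega> in M. real_cond_exp M (F (j - 1)) (Y j) \<omega> = \<mu> \<omega>"
    using Y_cond_mean[OF assms] by (simp add: \<mu>_def)
  moreover have "AE \<omega> in M. 0 \<le> cond_var j \<omega>"
    by (rule sub.real_cond_exp_pos) auto
  ultimately show ?thesis
  proof eventually_elim
    case (elim \<omega>)
    have "(1 - 2 * \<mu> \<omega>) * \<mu> \<omega> + (\<mu> \<omega>)\<^sup>2 = arm_var j \<omega>"
      by (simp add: logistic_var_def \<mu>_def power2_eq_square algebra_simps)
    then have "cond_var j \<omega> \<le> arm_var j \<omega>"
      using elim(1-5) by simp
    then show ?case using elim(6) by (simp add: wt_def)
  qed
qed

text \<open>Conditional mean and variance in integrated form, against bounded multipliers known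
  before the round; this is all that the supermartingale step needs.\<close>

lemma noise_conditional_moments:
  assumes g [measurable]: "g \<in> borel_measurable (F k)" and B: "\<And>\<omega>. \<omega> \<in> space M \<Longrightarrow> \<bar>g \<omega>\<bar> \<le> B"
  shows "(\<integral>\<omega>. g \<omega> * \<epsilon> (Suc k) \<omega> \<partial>M) = 0"
    and "(\<integral>\<omega>. g \<omega> * (\<epsilon> (Suc k) \<omega>)\<^sup>2 \<partial>M) = (\<integral>\<omega>. g \<omega> * wt (Suc k) \<omega> \<partial>M)"
    and "integrable M (\<lambda>\<omega>. g \<omega> * \<epsilon> (Suc k) \<omega>)"
    and "integrable M (\<lambda>\<omega>. g \<omega> * (\<epsilon> (Suc k) \<omega>)\<^sup>2)"
    and "integrable M (\<lambda>\<omega>. g \<omega> * wt (Suc k) \<omega>)"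
proof -
  let ?j = "Suc k"
  interpret sub: finite_measure_subalgebra M "F k"
    by unfold_locales (rule subalg)
  have [measurable]: "\<epsilon> ?j \<in> borel_measurable M" "X ?j \<in> borel_measurable M" "Y ?j \<in> borel_measurable M"
    "g \<in> borel_measurable M" "wt ?j \<in> borel_measurable M"
    using F_M[OF noise_F[of ?j ?j]] F_M[OF Y_adapted[of ?j]] F_M[OF X_F[of ?j k]] F_M[OF g]
      F_M[OF wt_F[of ?j k]] by auto
  have int: "integrable M (\<lambda>\<omega>. g \<omega> * h \<omega>)"
    if "h \<in> borel_measurable M" "\<And>\<omega>. \<omega> \<in> space M \<Longrightarrow> \<bar>h \<omega>\<bar> \<le> 1" for h :: "'w \<Rightarrow> real"
  proof (rule bounded_integrable[of _ "B * 1"])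
    fix \<omega> assume \<omega>: "\<omega> \<in> space M"
    show "\<bar>g \<omega> * h \<omega>\<bar> \<le> B * 1"
      unfolding abs_mult using B[OF \<omega>] that(2)[OF \<omega>] abs_ge_zero[of "g \<omega>"] by (intro mult_mono) linarith+
  qed (use that(1) in measurable)
  define \<mu> where "\<mu> \<omega> = logistic (fstar \<bullet> X ?j \<omega>)" for \<omega>
  have [measurable]: "\<mu> \<in> borel_measurable M" unfolding \<mu>_def[abs_def] by measurable
  have intY: "integrable M (\<lambda>\<omega>. g \<omega> * Y ?j \<omega>)"
    using Y_range[of ?j] by (intro int) auto
  have int\<mu>: "integrable M (\<lambda>\<omega>. g \<omega> * \<mu> \<omega>)"
    using logistic_pos less_imp_le[OF logistic_less_one] by (intro int) (auto simp: \<mu>_def abs_of_pos)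
  show int1: "integrable M (\<lambda>\<omega>. g \<omega> * \<epsilon> ?j \<omega>)"
    using noise_le_one[of ?j] by (intro int) auto
  show int2: "integrable M (\<lambda>\<omega>. g \<omega> * (\<epsilon> ?j \<omega>)\<^sup>2)"
    using noise_le_one[of ?j] by (intro int) (auto simp: abs_square_le_1)
  show "integrable M (\<lambda>\<omega>. g \<omega> * wt ?j \<omega>)"
    using wt_nonneg wt_le_one by (intro int) auto
  have "(\<integral>\<omega>. g \<omega> * Y ?j \<omega> \<partial>M) = (\<integral>\<omega>. g \<omega> * real_cond_exp M (F k) (Y ?j) \<omega> \<partial>M)"
    by (rule sub.real_cond_exp_intg(2)[symmetric, OF intY]) measurable
  also have "\<dots> = (\<integral>\<omega>. g \<omega> * \<mu> \<omega> \<partial>M)"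
    by (rule integral_cong_AE) (use Y_cond_mean[of ?j] in \<open>auto simp: \<mu>_def\<close>)
  finally have "(\<integral>\<omega>. g \<omega> * Y ?j \<omega> - g \<omega> * \<mu> \<omega> \<partial>M) = 0"
    using intY int\<mu> by simp
  then show "(\<integral>\<omega>. g \<omega> * \<epsilon> ?j \<omega> \<partial>M) = 0"
    by (simp add: noise_def \<mu>_def right_diff_distrib)
  have "(\<integral>\<omega>. g \<omega> * (\<epsilon> ?j \<omega>)\<^sup>2 \<partial>M) = (\<integral>\<omega>. g \<omega> * cond_var ?j \<omega> \<partial>M)"
    using sub.real_cond_exp_intg(2)[symmetric, OF int2] by simp
  also have "\<dots> = (\<integral>\<omega>. g \<omega> * wt ?j \<omega> \<partial>M)"
    by (rule integral_cong_AE) (use cond_var_eq_wt[of ?j] in auto)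
  finally show "(\<integral>\<omega>. g \<omega> * (\<epsilon> ?j \<omega>)\<^sup>2 \<partial>M) = (\<integral>\<omega>. g \<omega> * wt ?j \<omega> \<partial>M)" .
qed

section \<open>The exponential supermartingale\<close>

definition res :: "real \<Rightarrow> nat \<Rightarrow> 'w \<Rightarrow> ('h \<Rightarrow>\<^sub>L 'h)" where
  "res \<rho> n \<omega> = resolvent \<rho> (\<lambda>j. wt j \<omega>) (\<lambda>j. X j \<omega>) n"

abbreviation mart :: "nat \<Rightarrow> 'w \<Rightarrow> 'h" where "mart \<equiv> noise_mart fstar X Y"

definition self_norm :: "real \<Rightarrow> nat \<Rightarrow> 'w \<Rightarrow> real" where
  "self_norm \<rho> n \<omega> = mart n \<omega> \<bullet> res \<rho> n \<omega> (mart n \<omega>)"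

definition arm_norm :: "real \<Rightarrow> nat \<Rightarrow> 'w \<Rightarrow> real" where
  "arm_norm \<rho> j \<omega> = X j \<omega> \<bullet> res \<rho> j \<omega> (X j \<omega>)"

text \<open>The factor \<open>sqrt \<rho> / 4\<close> keeps the slope at most 1/4, and
  \<open>- \<rho> / 4\<close> makes the initial value 1.\<close>

definition exp_process :: "real \<Rightarrow> nat \<Rightarrow> 'w \<Rightarrow> real" where
  "exp_process \<rho> n \<omega> = exp (sqrt \<rho> / 4 * sqrt (\<rho> + self_norm \<rho> n \<omega>))
     * exp (- \<rho> / 4 - 5 / 32 * (\<Sum>j=1..n. wt j \<omega> * arm_norm \<rho> j \<omega>))"

lemma res_measurable:
  "v \<in> borel_measurable (F n) \<Longrightarrow> (\<lambda>\<omega>. res \<rho> n \<omega> (v \<omega>)) \<in> borel_measurable (F n)"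
  unfolding res_def by (rule measurable_resolvent) (auto intro: X_F wt_F)

text \<open>Predictability: arm and weight of round \<open>Suc n\<close> are known at time
  \<open>n\<close>, so the updated resolvent acts as a constant when the noise of that round is
  integrated out.\<close>

lemma res_Suc_measurable:
  "v \<in> borel_measurable (F n) \<Longrightarrow> (\<lambda>\<omega>. res \<rho> (Suc n) \<omega> (v \<omega>)) \<in> borel_measurable (F n)"
  unfolding res_def by (rule measurable_resolvent) (auto intro: X_F wt_F)

lemma mart_F: "mart n \<in> borel_measurable (F n)"
proof -
  have [measurable]: "\<epsilon> j \<in> borel_measurable (F n)" "X j \<in> borel_measurable (F n)" if "j \<in> {1..n}" for j
    using that by (auto intro: noise_F X_F)
  show ?thesis unfolding noise_mart_def[abs_def] by measurable
qed

lemma arm_norm_F: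
  assumes "1 \<le> j" "j \<le> Suc n"
  shows "arm_norm \<rho> j \<in> borel_measurable (F n)"
proof -
  obtain k where j: "j = Suc k" using assms(1) by (cases j) auto
  have [measurable]: "X j \<in> borel_measurable (F k)" using j by (intro X_F) auto
  have [measurable]: "(\<lambda>\<omega>. res \<rho> j \<omega> (X j \<omega>)) \<in> borel_measurable (F k)"
    unfolding j by (rule res_Suc_measurable) (simp add: j[symmetric])
  have "arm_norm \<rho> j \<in> borel_measurable (F k)" unfolding arm_norm_def[abs_def] by measurable
  then show ?thesis by (rule F_le) (use j assms in simp)
qed

lemma self_norm_F: "self_norm \<rho> n \<in> borel_measurable (F n)"
proof -
  note [measurable] = mart_F res_measurable[OF mart_F]
  show ?thesis unfolding self_norm_def[abs_def] by measurable
qed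

lemma exp_process_F: "exp_process \<rho> n \<in> borel_measurable (F n)"
proof -
  note [measurable] = self_norm_F
  have [measurable]: "arm_norm \<rho> j \<in> borel_measurable (F n)" "wt j \<in> borel_measurable (F n)"
    if "j \<in> {1..n}" for j
    using that by (auto intro: arm_norm_F wt_F)
  show ?thesis unfolding exp_process_def[abs_def] by measurable
qed

context
  fixes \<rho> :: real
  assumes \<rho>: "1 \<le> \<rho>"
begin

lemma regularized: "regularized_design \<rho> (\<lambda>j. wt j \<omega>)"
  by unfold_locales (use \<rho> wt_nonneg in auto)

lemma self_norm_nonneg: "0 \<le> self_norm \<rho> n \<omega>"
  unfolding self_norm_def res_def by (rule regularized_design.R_nonneg[OF regularized])

lemma arm_norm_nonneg: "0 \<le> arm_norm \<rho> n \<omega>"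
  unfolding arm_norm_def res_def by (rule regularized_design.R_nonneg[OF regularized])

lemma arm_norm_le:
  assumes "1 \<le> j" "\<omega> \<in> space M"
  shows "arm_norm \<rho> j \<omega> \<le> 1 / \<rho>"
proof -
  have "(norm (X j \<omega>))\<^sup>2 \<le> 1" using X_norm_le[OF assms] by (simp add: power_le_one)
  then have "X j \<omega> \<bullet> X j \<omega> / \<rho> \<le> 1 / \<rho>"
    using \<rho> by (intro divide_right_mono) (auto simp: power2_norm_eq_inner)
  then show ?thesis
    unfolding arm_norm_def res_def using regularized_design.R_upper[OF regularized] order_trans by blast
qed

lemma exp_process_pos: "0 < exp_process \<rho> n \<omega>"
  by (simp add: exp_process_def)

lemma exp_process_bound:
  assumes \<omega>: "\<omega> \<in> space M"
  shows "exp_process \<rho> n \<omega> \<le> exp (sqrt \<rho> / 4 * sqrt (\<rho> + (real n)\<^sup>2 / \<rho>))"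
proof -
  have "norm (mart n \<omega>) \<le> (\<Sum>j=1..n. 1)"
    unfolding noise_mart_def
  proof (rule sum_norm_le)
    fix j assume "j \<in> {1..n}"
    then show "norm (\<epsilon> j \<omega> *\<^sub>R X j \<omega>) \<le> 1"
      using noise_le_one[OF _ \<omega>, of j] X_norm_le[OF _ \<omega>, of j] by (auto intro: mult_le_one)
  qed
  then have "(norm (mart n \<omega>))\<^sup>2 \<le> (real n)\<^sup>2" by (intro power_mono) auto
  then have "mart n \<omega> \<bullet> mart n \<omega> / \<rho> \<le> (real n)\<^sup>2 / \<rho>"
    using \<rho> by (intro divide_right_mono) (auto simp: power2_norm_eq_inner)
  then have "self_norm \<rho> n \<omega> \<le> (real n)\<^sup>2 / \<rho>"
    unfolding self_norm_def res_def using regularized_design.R_upper[OF regularized] order_trans by blast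
  then have "exp (sqrt \<rho> / 4 * sqrt (\<rho> + self_norm \<rho> n \<omega>)) \<le> exp (sqrt \<rho> / 4 * sqrt (\<rho> + (real n)\<^sup>2 / \<rho>))"
    using \<rho> by (simp add: mult_left_mono)
  moreover have "exp (- \<rho> / 4 - 5 / 32 * (\<Sum>j=1..n. wt j \<omega> * arm_norm \<rho> j \<omega>)) \<le> 1"
  proof -
    have "0 \<le> (\<Sum>j=1..n. wt j \<omega> * arm_norm \<rho> j \<omega>)"
      by (intro sum_nonneg mult_nonneg_nonneg wt_nonneg arm_norm_nonneg)
    then show ?thesis using \<rho> by simp
  qed
  ultimately have "exp_process \<rho> n \<omega> \<le> exp (sqrt \<rho> / 4 * sqrt (\<rho> + (real n)\<^sup>2 / \<rho>)) * 1"
    unfolding exp_process_def by (intro mult_mono) auto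
  then show ?thesis by simp
qed

lemma exp_process_integrable: "integrable M (exp_process \<rho> n)"
  by (rule bounded_integrable[OF F_M[OF exp_process_F]])
     (use exp_process_bound exp_process_pos in \<open>simp add: abs_of_pos\<close>)

text \<open>Factors known at time \<open>k\<close> are collected in \<open>f\<close>. The term
  linear in the noise integrates to 0, the squared noise becomes \<open>w\<close>, and the
  compensator inside \<open>f\<close> outweighs the remaining factor
  \<open>1 + c * w\<close>.\<close>

lemma exp_process_super:
  assumes A: "A \<in> sets (F k)"
  shows "(\<integral>\<omega>. indicator A \<omega> * exp_process \<rho> (Suc k) \<omega> \<partial>M) \<le> (\<integral>\<omega>. indicator A \<omega> * exp_process \<rho> k \<omega> \<partial>M)"
proof -
  let ?j = "Suc k" and ?E = "exp_process \<rho>"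
  define a where "a \<omega> = X ?j \<omega> \<bullet> res \<rho> ?j \<omega> (mart k \<omega>)" for \<omega>
  define q where "q = arm_norm \<rho> ?j"
  define w where "w = wt ?j"
  define t where "t \<omega> = sqrt \<rho> / (4 * sqrt (\<rho> + self_norm \<rho> k \<omega>))" for \<omega>
  define c where "c \<omega> = t \<omega> * q \<omega> / 2 + 2 * (t \<omega>)\<^sup>2 * (a \<omega>)\<^sup>2 + (t \<omega>)\<^sup>2 * (q \<omega>)\<^sup>2 / 2" for \<omega>
  define f where "f \<omega> = indicator A \<omega> * ?E k \<omega> * exp (- t \<omega> * w \<omega> * (a \<omega>)\<^sup>2 / 2 - 5 / 32 * (w \<omega> * q \<omega>))"
    for \<omega> :: 'w
  have mart_Suc: "mart ?j \<omega> = mart k \<omega> + \<epsilon> ?j \<omega> *\<^sub>R X ?j \<omega>" for \<omega>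
    by (simp add: noise_mart_def)
  have step: "exp (sqrt \<rho> / 4 * sqrt (\<rho> + self_norm \<rho> ?j \<omega>))
        \<le> exp (sqrt \<rho> / 4 * sqrt (\<rho> + self_norm \<rho> k \<omega>)) * exp (- t \<omega> * w \<omega> * (a \<omega>)\<^sup>2 / 2)
          * (1 + t \<omega> * a \<omega> * \<epsilon> ?j \<omega> + c \<omega> * (\<epsilon> ?j \<omega>)\<^sup>2)"
    "c \<omega> * w \<omega> \<le> t \<omega> * w \<omega> * (a \<omega>)\<^sup>2 / 2 + 5 / 32 * (w \<omega> * q \<omega>)"
    "\<bar>t \<omega> * a \<omega>\<bar> \<le> 1" "0 \<le> c \<omega>" "c \<omega> \<le> 1" "0 \<le> t \<omega>" if \<omega>: "\<omega> \<in> space M" for \<omega>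
  proof -
    interpret regularized_design \<rho> "\<lambda>j. wt j \<omega>" "\<lambda>j. X j \<omega>" by (rule regularized)
    \<comment> \<open>The sharp form 1/\<rho> yields \<open>\<rho> * a\<^sup>2 \<le> s\<close>;
      elsewhere \<open>q \<le> 1\<close> suffices.\<close>
    have q\<rho>: "q \<omega> \<le> 1 / \<rho>" unfolding q_def using \<omega> by (intro arm_norm_le) auto
    moreover have "1 / \<rho> \<le> 1" using \<rho> by simp
    ultimately have q1: "q \<omega> \<le> 1" by simp
    have s0: "0 \<le> self_norm \<rho> k \<omega>" by (rule self_norm_nonneg)
    have "(a \<omega>)\<^sup>2 \<le> q \<omega> * self_norm \<rho> k \<omega>"
      using resolvent_quad_Suc(2)[where n = k and m = "mart k \<omega>"]
      by (simp only: a_def q_def arm_norm_def self_norm_def res_def)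
    also have "\<dots> \<le> 1 / \<rho> * self_norm \<rho> k \<omega>" using q\<rho> s0 by (rule mult_right_mono)
    finally have a2: "\<rho> * (a \<omega>)\<^sup>2 \<le> self_norm \<rho> k \<omega>"
      using \<rho> by (simp add: field_simps)
    have s': "self_norm \<rho> ?j \<omega> \<le> self_norm \<rho> k \<omega> + 2 * \<epsilon> ?j \<omega> * a \<omega> + (\<epsilon> ?j \<omega>)\<^sup>2 * q \<omega> - w \<omega> * (a \<omega>)\<^sup>2"
      using resolvent_quad_Suc(1)[where n = k and m = "mart k \<omega>" and e = "\<epsilon> ?j \<omega>"]
      by (simp only: a_def q_def w_def arm_norm_def self_norm_def res_def mart_Suc)
    note st = exp_sqrt_step[OF \<rho> s0 s' noise_le_one[OF _ \<omega>] wt_nonneg[of ?j \<omega>, folded w_def]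
        arm_norm_nonneg[of ?j \<omega>, folded q_def] q1 a2 self_norm_nonneg, folded t_def, folded c_def]
    show "exp (sqrt \<rho> / 4 * sqrt (\<rho> + self_norm \<rho> ?j \<omega>))
        \<le> exp (sqrt \<rho> / 4 * sqrt (\<rho> + self_norm \<rho> k \<omega>)) * exp (- t \<omega> * w \<omega> * (a \<omega>)\<^sup>2 / 2)
          * (1 + t \<omega> * a \<omega> * \<epsilon> ?j \<omega> + c \<omega> * (\<epsilon> ?j \<omega>)\<^sup>2)"
      "c \<omega> * w \<omega> \<le> t \<omega> * w \<omega> * (a \<omega>)\<^sup>2 / 2 + 5 / 32 * (w \<omega> * q \<omega>)"
      "\<bar>t \<omega> * a \<omega>\<bar> \<le> 1" "0 \<le> c \<omega>" "c \<omega> \<le> 1" "0 \<le> t \<omega>"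
      by (rule st; simp)+
  qed
  have [measurable]: "a \<in> borel_measurable (F k)" "q \<in> borel_measurable (F k)" "w \<in> borel_measurable (F k)"
    "t \<in> borel_measurable (F k)" "?E k \<in> borel_measurable (F k)" "A \<in> sets (F k)"
  proof -
    note [measurable] = res_Suc_measurable[OF mart_F] X_F[of ?j k] self_norm_F
    have [measurable]: "X ?j \<in> borel_measurable (F k)" by (rule X_F) auto
    show "a \<in> borel_measurable (F k)" unfolding a_def[abs_def] by measurable
    show "q \<in> borel_measurable (F k)" unfolding q_def by (rule arm_norm_F) auto
    show "w \<in> borel_measurable (F k)" unfolding w_def by (rule wt_F) auto
    show "t \<in> borel_measurable (F k)" unfolding t_def[abs_def] by measurable
  qed (use A exp_process_F in auto)
  have [measurable]: "c \<in> borel_measurable (F k)" unfolding c_def[abs_def] by measurable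
  have [measurable]: "f \<in> borel_measurable (F k)" unfolding f_def[abs_def] by measurable
  obtain B where B: "\<And>\<omega>. \<omega> \<in> space M \<Longrightarrow> ?E k \<omega> \<le> B" using exp_process_bound by blast
  have f0: "0 \<le> f \<omega>" for \<omega> using exp_process_pos[of k \<omega>] by (simp add: f_def)
  have fB: "\<bar>f \<omega>\<bar> \<le> B" if \<omega>: "\<omega> \<in> space M" for \<omega>
  proof -
    have "0 \<le> t \<omega> * w \<omega> * (a \<omega>)\<^sup>2 / 2 + 5 / 32 * (w \<omega> * q \<omega>)"
      using step(6)[OF \<omega>] wt_nonneg arm_norm_nonneg by (simp add: w_def q_def)
    then have "exp (- t \<omega> * w \<omega> * (a \<omega>)\<^sup>2 / 2 - 5 / 32 * (w \<omega> * q \<omega>)) \<le> 1" by simp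
    moreover have "indicator A \<omega> * ?E k \<omega> \<le> B"
      using B[OF \<omega>] exp_process_pos[of k \<omega>] by (auto simp: indicator_def)
    ultimately have "f \<omega> \<le> B * 1"
      unfolding f_def using B[OF \<omega>] exp_process_pos[of k \<omega>] by (intro mult_mono) auto
    then show ?thesis using f0[of \<omega>] by simp
  qed
  have fh: "\<bar>f \<omega> * h\<bar> \<le> B" if "\<omega> \<in> space M" "\<bar>h\<bar> \<le> 1" for \<omega> h
    using mult_mono[OF fB[OF that(1)] that(2)] fB[OF that(1)] by (simp add: abs_mult)
  have c1: "\<bar>c \<omega>\<bar> \<le> 1" if "\<omega> \<in> space M" for \<omega> using step(4,5)[OF that] by simp
  have b1: "(\<lambda>\<omega>. f \<omega> * (t \<omega> * a \<omega>)) \<in> borel_measurable (F k)" by measurable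
  have b2: "(\<lambda>\<omega>. f \<omega> * c \<omega>) \<in> borel_measurable (F k)" by measurable
  note m1 = noise_conditional_moments[OF b1 fh[OF _ step(3)]]
  note m2 = noise_conditional_moments[OF b2 fh[OF _ c1]]
  have f_int: "integrable M f"
    by (rule bounded_integrable[OF F_M fB]) measurable
  have ind_int: "integrable M (\<lambda>\<omega>. indicator A \<omega> * ?E n \<omega>)" for n
  proof -
    have "A \<in> sets M" using A subalg[of k] by (auto simp: subalgebra_def)
    then show ?thesis
      using integrable_mult_indicator[OF _ exp_process_integrable, of A n] by simp
  qed
  have "(\<integral>\<omega>. indicator A \<omega> * ?E ?j \<omega> \<partial>M)
      \<le> (\<integral>\<omega>. f \<omega> + f \<omega> * (t \<omega> * a \<omega>) * \<epsilon> ?j \<omega> + f \<omega> * c \<omega> * (\<epsilon> ?j \<omega>)\<^sup>2 \<partial>M)"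
  proof (intro integral_mono ind_int Bochner_Integration.integrable_add f_int m1 m2)
    fix \<omega> assume \<omega>: "\<omega> \<in> space M"
    define S where "S = (\<Sum>j=1..k. wt j \<omega> * arm_norm \<rho> j \<omega>)"
    have "?E ?j \<omega> = exp (sqrt \<rho> / 4 * sqrt (\<rho> + self_norm \<rho> ?j \<omega>)) * (exp (- \<rho> / 4 - 5 / 32 * S) * exp (- 5 / 32 * (w \<omega> * q \<omega>)))"
      by (simp add: exp_process_def S_def w_def q_def exp_add[symmetric] algebra_simps)
    also have "\<dots> \<le> exp (sqrt \<rho> / 4 * sqrt (\<rho> + self_norm \<rho> k \<omega>)) * exp (- t \<omega> * w \<omega> * (a \<omega>)\<^sup>2 / 2)
          * (1 + t \<omega> * a \<omega> * \<epsilon> ?j \<omega> + c \<omega> * (\<epsilon> ?j \<omega>)\<^sup>2) * (exp (- \<rho> / 4 - 5 / 32 * S) * exp (- 5 / 32 * (w \<omega> * q \<omega>)))"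
      using step(1)[OF \<omega>] by (intro mult_right_mono) auto
    also have "\<dots> = (exp (sqrt \<rho> / 4 * sqrt (\<rho> + self_norm \<rho> k \<omega>)) * exp (- \<rho> / 4 - 5 / 32 * S))
          * (exp (- t \<omega> * w \<omega> * (a \<omega>)\<^sup>2 / 2) * exp (- 5 / 32 * (w \<omega> * q \<omega>)))
          * (1 + t \<omega> * a \<omega> * \<epsilon> ?j \<omega> + c \<omega> * (\<epsilon> ?j \<omega>)\<^sup>2)"
      by (simp only: mult_ac)
    also have "exp (sqrt \<rho> / 4 * sqrt (\<rho> + self_norm \<rho> k \<omega>)) * exp (- \<rho> / 4 - 5 / 32 * S) = ?E k \<omega>"
      by (simp add: exp_process_def S_def)
    also have "exp (- t \<omega> * w \<omega> * (a \<omega>)\<^sup>2 / 2) * exp (- 5 / 32 * (w \<omega> * q \<omega>))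
        = exp (- t \<omega> * w \<omega> * (a \<omega>)\<^sup>2 / 2 - 5 / 32 * (w \<omega> * q \<omega>))"
      by (simp add: exp_add[symmetric])
    finally have "indicator A \<omega> * ?E ?j \<omega> \<le> indicator A \<omega> * (?E k \<omega>
        * exp (- t \<omega> * w \<omega> * (a \<omega>)\<^sup>2 / 2 - 5 / 32 * (w \<omega> * q \<omega>))
        * (1 + t \<omega> * a \<omega> * \<epsilon> ?j \<omega> + c \<omega> * (\<epsilon> ?j \<omega>)\<^sup>2))"
      by (intro mult_left_mono) auto
    also have "\<dots> = f \<omega> * (1 + t \<omega> * a \<omega> * \<epsilon> ?j \<omega> + c \<omega> * (\<epsilon> ?j \<omega>)\<^sup>2)"
      by (simp only: f_def mult.assoc)
    also have "\<dots> = f \<omega> + f \<omega> * (t \<omega> * a \<omega>) * \<epsilon> ?j \<omega> + f \<omega> * c \<omega> * (\<epsilon> ?j \<omega>)\<^sup>2"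
      by (simp add: distrib_left mult.assoc)
    finally show "indicator A \<omega> * ?E ?j \<omega>
        \<le> f \<omega> + f \<omega> * (t \<omega> * a \<omega>) * \<epsilon> ?j \<omega> + f \<omega> * c \<omega> * (\<epsilon> ?j \<omega>)\<^sup>2" .
  qed
  also have "\<dots> = (\<integral>\<omega>. f \<omega> \<partial>M) + (\<integral>\<omega>. f \<omega> * c \<omega> * w \<omega> \<partial>M)"
    using f_int m1(1,3) m2(2,4) by (simp add: w_def)
  also have "\<dots> = (\<integral>\<omega>. f \<omega> + f \<omega> * c \<omega> * w \<omega> \<partial>M)"
    using f_int m2(5) by (simp add: w_def)
  also have "\<dots> \<le> (\<integral>\<omega>. indicator A \<omega> * ?E k \<omega> \<partial>M)"
  proof (intro integral_mono ind_int Bochner_Integration.integrable_add f_int m2(5)[folded w_def])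
    fix \<omega> assume \<omega>: "\<omega> \<in> space M"
    \<comment> \<open>The compensation spent in this round: drift plus potential term.\<close>
    define z where "z = t \<omega> * w \<omega> * (a \<omega>)\<^sup>2 / 2 + 5 / 32 * (w \<omega> * q \<omega>)"
    have "c \<omega> * w \<omega> \<le> z" using step(2)[OF \<omega>] by (simp only: z_def)
    then have "1 + c \<omega> * w \<omega> \<le> exp z" using exp_ge_add_one_self[of z] by linarith
    then have "exp (- z) * (1 + c \<omega> * w \<omega>) \<le> exp (- z) * exp z"
      by (rule mult_left_mono) simp
    then have "exp (- z) * (1 + c \<omega> * w \<omega>) \<le> 1" by (simp add: exp_minus)
    then have "indicator A \<omega> * ?E k \<omega> * (exp (- z) * (1 + c \<omega> * w \<omega>)) \<le> indicator A \<omega> * ?E k \<omega> * 1"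
      using exp_process_pos[of k \<omega>] by (intro mult_left_mono) auto
    moreover have "f \<omega> + f \<omega> * c \<omega> * w \<omega> = indicator A \<omega> * ?E k \<omega> * (exp (- z) * (1 + c \<omega> * w \<omega>))"
      by (simp add: f_def z_def distrib_left mult.assoc)
    ultimately show "f \<omega> + f \<omega> * c \<omega> * w \<omega> \<le> indicator A \<omega> * ?E k \<omega>" by simp
  qed
  finally show ?thesis .
qed

lemma exp_process_maximal:
  "{\<omega> \<in> space M. \<exists>n. exp y \<le> exp_process \<rho> n \<omega>} \<in> sets M"
  "prob {\<omega> \<in> space M. \<exists>n. exp y \<le> exp_process \<rho> n \<omega>} \<le> exp (- y)"
proof -
  note V = ville_maximal_inequality[where F = F and E = "exp_process \<rho>" and c = "exp y", OF subalg sets_F_mono exp_process_F exp_process_integrable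
      less_imp_le[OF exp_process_pos] exp_process_super exp_gt_zero[of y]]
  show "{\<omega> \<in> space M. \<exists>n. exp y \<le> exp_process \<rho> n \<omega>} \<in> sets M" by (rule V(1))
  have "exp_process \<rho> 0 \<omega> = 1" for \<omega>
    using \<rho> by (simp add: exp_process_def self_norm_def noise_mart_def exp_add[symmetric])
  then have "exp y * prob {\<omega> \<in> space M. \<exists>n. exp y \<le> exp_process \<rho> n \<omega>} \<le> 1"
    using V(2) by (simp add: prob_space)
  then show "prob {\<omega> \<in> space M. \<exists>n. exp y \<le> exp_process \<rho> n \<omega>} \<le> exp (- y)"
    by (simp add: exp_minus field_simps)
qed

lemma self_norm_bound:
  assumes lt: "exp_process \<rho> n \<omega> < exp y" and y: "0 < y"
  shows "sqrt (self_norm \<rho> n \<omega>) \<le> beta_explicit \<rho> y (\<lambda>j. X j \<omega>) n"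
proof -
  interpret regularized_design \<rho> "\<lambda>j. wt j \<omega>" "\<lambda>j. X j \<omega>" by (rule regularized)
  define S where "S = (\<Sum>j=1..n. wt j \<omega> * arm_norm \<rho> j \<omega>)"
  define g where "g = info_gain (inverse \<rho> *\<^sub>R design_op (\<lambda>j. X j \<omega>) n)"
  define r where "r = sqrt \<rho>"
  have r: "0 < r" "r * r = \<rho>" using \<rho> by (auto simp: r_def)
  have g0: "0 \<le> g" unfolding g_def by (rule design_info_gain[OF \<rho>])
  have "S \<le> 2 * info_gain (inverse \<rho> *\<^sub>R wdesign (\<lambda>j. wt j \<omega>) (\<lambda>j. X j \<omega>) n)"
    unfolding S_def arm_norm_def res_def by (rule elliptical_potential)
  also have "info_gain (inverse \<rho> *\<^sub>R wdesign (\<lambda>j. wt j \<omega>) (\<lambda>j. X j \<omega>) n) \<le> g"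
    unfolding g_def design_op_eq_wdesign using \<rho> wt_nonneg wt_le_one by (intro info_gain_wdesign_mono) auto
  finally have S: "S \<le> 2 * g" by simp
  have "exp (r / 4 * sqrt (\<rho> + self_norm \<rho> n \<omega>) + (- \<rho> / 4 - 5 / 32 * S)) < exp y"
    using lt by (simp only: exp_process_def S_def exp_add r_def)
  then have "r / 4 * sqrt (\<rho> + self_norm \<rho> n \<omega>) < \<rho> / 4 + 5 / 32 * S + y" by simp
  \<comment> \<open>Multiplying by 4 turns 5/32 S into 5/8 S, at most 5/4 g since S \<le> 2
    g.\<close>
  then have "r * sqrt (\<rho> + self_norm \<rho> n \<omega>) \<le> r * r + (5 / 4 * g + 4 * y)"
    using S r by simp
  also have "\<dots> = r * (r + (5 / 4 * g + 4 * y) / r)"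
    using r by (simp add: field_simps)
  finally have "sqrt (\<rho> + self_norm \<rho> n \<omega>) \<le> r + (5 / 4 * g + 4 * y) / r"
    using r by simp
  moreover have "sqrt (self_norm \<rho> n \<omega>) \<le> sqrt (\<rho> + self_norm \<rho> n \<omega>)" using \<rho> by simp
  moreover have "(5 / 4 * g + 4 * y) / r \<le> (78 * g + 4 * y) / r"
    using g0 r by (intro divide_right_mono) auto
  moreover have "0 \<le> sqrt (18 * g + 6 * y)" using g0 y by simp
  ultimately have "sqrt (self_norm \<rho> n \<omega>) \<le> r + (78 * g + 4 * y) / r + sqrt (18 * g + 6 * y)"
    by linarith
  then show ?thesis
    by (simp only: beta_explicit_def Let_def g_def[symmetric] r_def[symmetric])
qed

text \<open>Two bounds on one event: the first with the true quadratic variation, as the definition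
  of the radius demands, the second with the larger logistic variances, as the confidence argument
  needs.\<close>

theorem concentration_event:
  assumes y: "0 < y"
  obtains \<Omega> where "\<Omega> \<in> sets M" "1 - exp (- y) \<le> prob \<Omega>"
    "\<And>\<omega> n. \<omega> \<in> \<Omega> \<Longrightarrow> norm (op_inv (op_sqrt (noise_qvar M F fstar X Y n \<omega> + \<rho> *\<^sub>R id_blinfun)) (mart n \<omega>))
        \<le> beta_explicit \<rho> y (\<lambda>j. X j \<omega>) n"
    "\<And>\<omega> n. \<omega> \<in> \<Omega> \<Longrightarrow> mart n \<omega> \<bullet> resolvent \<rho> (\<lambda>j. arm_var j \<omega>) (\<lambda>j. X j \<omega>) n (mart n \<omega>)
        \<le> (beta_explicit \<rho> y (\<lambda>j. X j \<omega>) n)\<^sup>2"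
proof -
  have "AE \<omega> in M. \<forall>j\<in>{1..}. cond_var j \<omega> = wt j \<omega>"
  proof (rule AE_ball_countable')
    fix j :: nat assume "j \<in> {1..}"
    then show "AE \<omega> in M. cond_var j \<omega> = wt j \<omega>" by (intro cond_var_eq_wt) simp
  qed simp
  \<comment> \<open>An explicit null set, outside which clipped and true conditional variances agree
    in all rounds at once.\<close>
  then obtain N where N: "{\<omega> \<in> space M. \<not> (\<forall>j\<in>{1..}. cond_var j \<omega> = wt j \<omega>)} \<subseteq> N"
      "emeasure M N = 0" "N \<in> sets M"
    by (rule AE_E)
  then have N_null: "N \<in> null_sets M" by (intro null_setsI)
  define D where "D = {\<omega> \<in> space M. \<exists>n. exp y \<le> exp_process \<rho> n \<omega>}"
  define \<Omega> where "\<Omega> = space M - D - N"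
  have D: "D \<in> sets M" "prob D \<le> exp (- y)"
    unfolding D_def by (rule exp_process_maximal)+
  have sets: "\<Omega> \<in> sets M" using D(1) N(3) by (auto simp: \<Omega>_def)
  have "prob \<Omega> = prob (space M - D)"
    unfolding \<Omega>_def using D(1) N_null by (intro measure_Diff_null_set) auto
  then have prob: "1 - exp (- y) \<le> prob \<Omega>"
    using D prob_compl by simp
  have bound: "sqrt (self_norm \<rho> n \<omega>) \<le> beta_explicit \<rho> y (\<lambda>j. X j \<omega>) n" if "\<omega> \<in> \<Omega>" for n \<omega>
    using that y by (intro self_norm_bound) (auto simp: \<Omega>_def D_def not_le)
  show ?thesis
  proof (rule that[OF sets prob])
    fix \<omega> n assume \<omega>: "\<omega> \<in> \<Omega>"
    interpret a: regularized_design \<rho> "\<lambda>j. wt j \<omega>" "\<lambda>j. X j \<omega>" by (rule regularized)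
    have "noise_qvar M F fstar X Y n \<omega> = wdesign (\<lambda>j. wt j \<omega>) (\<lambda>j. X j \<omega>) n"
      unfolding noise_qvar_def wdesign_def using \<omega> N(1) by (intro sum.cong) (auto simp: \<Omega>_def)
    then have "noise_qvar M F fstar X Y n \<omega> + \<rho> *\<^sub>R id_blinfun = a.Z n"
      by (simp add: resolvent_arg_def)
    then have "(norm (op_inv (op_sqrt (noise_qvar M F fstar X Y n \<omega> + \<rho> *\<^sub>R id_blinfun)) (mart n \<omega>)))\<^sup>2
        = self_norm \<rho> n \<omega>"
      by (simp add: a.norm_op_inv_op_sqrt self_norm_def res_def)
    then show "norm (op_inv (op_sqrt (noise_qvar M F fstar X Y n \<omega> + \<rho> *\<^sub>R id_blinfun)) (mart n \<omega>))
        \<le> beta_explicit \<rho> y (\<lambda>j. X j \<omega>) n"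
      using bound[OF \<omega>, of n] by (metis norm_ge_zero real_sqrt_unique)
    have "mart n \<omega> \<bullet> resolvent \<rho> (\<lambda>j. arm_var j \<omega>) (\<lambda>j. X j \<omega>) n (mart n \<omega>) \<le> self_norm \<rho> n \<omega>"
      unfolding self_norm_def res_def using \<rho> wt_nonneg wt_le by (intro resolvent_antimono) auto
    also have "\<dots> \<le> (beta_explicit \<rho> y (\<lambda>j. X j \<omega>) n)\<^sup>2"
      using bound[OF \<omega>, of n] sqrt_le_D by blast
    finally show "mart n \<omega> \<bullet> resolvent \<rho> (\<lambda>j. arm_var j \<omega>) (\<lambda>j. X j \<omega>) n (mart n \<omega>)
        \<le> (beta_explicit \<rho> y (\<lambda>j. X j \<omega>) n)\<^sup>2" .
  qed
qed

end

end

section \<open>From sample paths to probability\<close>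

lemma with_prob_ge_mono:
  assumes "with_prob_ge M p P" "\<And>\<omega>. \<omega> \<in> space M \<Longrightarrow> P \<omega> \<Longrightarrow> Q \<omega>"
  shows "with_prob_ge M p Q"
  using assms sets.sets_into_space unfolding with_prob_ge_def by blast

text \<open>In the second half the confidence inequalities are not assumed but derived, on the event
  that carries the concentration bound.\<close>

theorem mainTheorem4:
  fixes M :: "'w measure" and F :: "nat \<Rightarrow> 'w measure"
    and \<X> :: "'h::{real_inner, banach, second_countable_topology} set"
    and X :: "nat \<Rightarrow> 'w \<Rightarrow> 'h" and Y :: "nat \<Rightarrow> 'w \<Rightarrow> real"
    and fstar xstar :: 'h and fhat :: "nat \<Rightarrow> 'w \<Rightarrow> 'h"
    and b \<rho> y :: real
  assumes model: "logistic_bandit M F \<X> X Y fstar b"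
    and xstar: "is_arg_max (\<lambda>x. inner fstar x) (\<lambda>x. x \<in> \<X>) xstar"
    and y: "0 < y" and rho: "1 \<le> \<rho>"
    and fhat: "\<And>n \<omega>. 1 \<le> n \<Longrightarrow> \<omega> \<in> space M \<Longrightarrow>
      is_arg_min (ridge_loss \<rho> (\<lambda>j. X j \<omega>) (\<lambda>j. Y j \<omega>) n) (\<lambda>_. True) (fhat n \<omega>)"
  shows
    "(\<forall>C \<beta>.
        concentration_radius M F fstar X Y \<rho> y C \<beta> \<longrightarrow>
        optimistic_rule M \<X> X \<rho> b fhat \<beta> \<longrightarrow>
        with_prob_ge M (1 - C * exp (- y))
          (\<lambda>\<omega>. \<forall>n\<ge>1. conf_ineqs \<rho> b fstar (\<lambda>j. X j \<omega>) (\<lambda>j. fhat j \<omega>) (\<lambda>j. \<beta> j \<omega>) n) \<longrightarrow>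
        with_prob_ge M (1 - C * exp (- y))
          (\<lambda>\<omega>. \<forall>n\<ge>1. regret_bound \<rho> b fstar xstar (\<lambda>j. X j \<omega>) (\<lambda>j. \<beta> j \<omega>) n))
     \<and>
     (\<forall>\<beta>. \<beta> = (\<lambda>n \<omega>. beta_explicit \<rho> y (\<lambda>j. X j \<omega>) n) \<longrightarrow>
        optimistic_rule M \<X> X \<rho> b fhat \<beta> \<longrightarrow>
        concentration_radius M F fstar X Y \<rho> y 2 \<beta> \<and>
        with_prob_ge M (1 - 2 * exp (- y))
          (\<lambda>\<omega>. \<forall>n\<ge>1. conf_ineqs \<rho> b fstar (\<lambda>j. X j \<omega>) (\<lambda>j. fhat j \<omega>) (\<lambda>j. \<beta> j \<omega>) n) \<and>
        with_prob_ge M (1 - 2 * exp (- y))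
          (\<lambda>\<omega>. \<forall>n\<ge>1. regret_bound \<rho> b fstar xstar (\<lambda>j. X j \<omega>) (\<lambda>j. \<beta> j \<omega>) n))"
proof -
  interpret logistic_bandit M F \<X> X Y fstar b by (rule model)
  have \<rho>0: "0 < \<rho>" using rho by simp
  \<comment> \<open>Isolated for an arbitrary radius on a single path, because both halves use it
    with different radii.\<close>
  have regret: "regret_bound \<rho> b fstar xstar (\<lambda>j. X j \<omega>) (\<lambda>j. \<beta> j \<omega>) n"
    if \<omega>: "\<omega> \<in> space M" and n: "1 \<le> n"
      and \<beta>: "\<And>n. 1 \<le> n \<Longrightarrow> 0 \<le> \<beta> n \<omega>" "\<And>m n. 1 \<le> m \<Longrightarrow> m \<le> n \<Longrightarrow> \<beta> m \<omega> \<le> \<beta> n \<omega>"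
      and rule: "optimistic_rule M \<X> X \<rho> b fhat \<beta>"
      and conf: "\<forall>n\<ge>1. conf_ineqs \<rho> b fstar (\<lambda>j. X j \<omega>) (\<lambda>j. fhat j \<omega>) (\<lambda>j. \<beta> j \<omega>) n"
    for \<beta> :: "nat \<Rightarrow> 'w \<Rightarrow> real" and \<omega> n
  proof -
    interpret optimistic_path \<rho> b fstar xstar "\<lambda>j. X j \<omega>" "\<lambda>j. fhat j \<omega>" "\<lambda>j. \<beta> j \<omega>"
    proof
      show "1 \<le> \<rho>" "0 < b" "norm fstar \<le> b" by (fact rho b_pos fstar_bound)+
      show "norm (X j \<omega>) \<le> 1" if "1 \<le> j" for j by (rule X_norm_le[OF that \<omega>])
      show "0 \<le> \<beta> n \<omega>" if "1 \<le> n" for n by (rule \<beta>(1)[OF that])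
      show "\<beta> m \<omega> \<le> \<beta> n \<omega>" if "1 \<le> m" "m \<le> n" for m n by (rule \<beta>(2)[OF that])
      show "conf_ineqs \<rho> b fstar (\<lambda>j. X j \<omega>) (\<lambda>j. fhat j \<omega>) (\<lambda>j. \<beta> j \<omega>) n" if "1 \<le> n" for n
        using conf that by blast
      show "fstar \<bullet> X j \<omega> \<le> fstar \<bullet> xstar" if "1 \<le> j" for j
        using xstar X_arm[OF that \<omega>] by (auto simp: is_arg_max_def not_less)
      show "(SUP f\<in>conf_set \<rho> b (\<lambda>j. X j \<omega>) (\<lambda>j. fhat j \<omega>) (\<lambda>j. \<beta> j \<omega>) (n - 1). f \<bullet> xstar)
          \<le> (SUP f\<in>conf_set \<rho> b (\<lambda>j. X j \<omega>) (\<lambda>j. fhat j \<omega>) (\<lambda>j. \<beta> j \<omega>) (n - 1). f \<bullet> X n \<omega>)"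
        if "1 \<le> n" for n
      proof -
        have "is_arg_max (\<lambda>x. SUP f\<in>conf_set \<rho> b (\<lambda>j. X j \<omega>) (\<lambda>j. fhat j \<omega>) (\<lambda>j. \<beta> j \<omega>) (n - 1). f \<bullet> x)
            (\<lambda>x. x \<in> \<X>) (X n \<omega>)"
          using rule that \<omega> unfolding optimistic_rule_def by blast
        moreover have "xstar \<in> \<X>" using xstar by (simp add: is_arg_max_def)
        ultimately show ?thesis unfolding is_arg_max_def not_less[symmetric] by blast
      qed
    qed
    show ?thesis using n by (rule regret_bound_path)
  qed
  show ?thesis
  proof (intro conjI allI impI)
    fix C \<beta>
    assume \<beta>: "concentration_radius M F fstar X Y \<rho> y C \<beta>" and rule: "optimistic_rule M \<X> X \<rho> b fhat \<beta>"
      and conf: "with_prob_ge M (1 - C * exp (- y))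
        (\<lambda>\<omega>. \<forall>n\<ge>1. conf_ineqs \<rho> b fstar (\<lambda>j. X j \<omega>) (\<lambda>j. fhat j \<omega>) (\<lambda>j. \<beta> j \<omega>) n)"
    from conf show "with_prob_ge M (1 - C * exp (- y))
        (\<lambda>\<omega>. \<forall>n\<ge>1. regret_bound \<rho> b fstar xstar (\<lambda>j. X j \<omega>) (\<lambda>j. \<beta> j \<omega>) n)"
    proof (rule with_prob_ge_mono, intro allI impI)
      fix \<omega> n
      assume \<omega>: "\<omega> \<in> space M" and n: "1 \<le> (n :: nat)"
        and c: "\<forall>n\<ge>1. conf_ineqs \<rho> b fstar (\<lambda>j. X j \<omega>) (\<lambda>j. fhat j \<omega>) (\<lambda>j. \<beta> j \<omega>) n"
      have "\<forall>n\<ge>1. 0 \<le> \<beta> n \<omega>" "mono_on {1..} (\<lambda>n. \<beta> n \<omega>)"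
        using \<beta> \<omega> by (auto simp: concentration_radius_def)
      then show "regret_bound \<rho> b fstar xstar (\<lambda>j. X j \<omega>) (\<lambda>j. \<beta> j \<omega>) n"
        by (intro regret[OF \<omega> n _ _ rule c]) (auto simp: mono_on_def)
    qed
  next
    fix \<beta> :: "nat \<Rightarrow> 'w \<Rightarrow> real"
    assume \<beta>: "\<beta> = (\<lambda>n \<omega>. beta_explicit \<rho> y (\<lambda>j. X j \<omega>) n)" and rule: "optimistic_rule M \<X> X \<rho> b fhat \<beta>"
    have nn: "0 \<le> \<beta> n \<omega>" and mono: "m \<le> n \<Longrightarrow> \<beta> m \<omega> \<le> \<beta> n \<omega>" for m n \<omega>
      unfolding \<beta> using beta_explicit_nonneg[OF rho y] beta_explicit_mono[OF rho] by blast+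
    obtain \<Omega> where \<Omega>: "\<Omega> \<in> sets M" "1 - exp (- y) \<le> prob \<Omega>"
      and conc: "\<And>\<omega> n. \<omega> \<in> \<Omega> \<Longrightarrow> norm (op_inv (op_sqrt (noise_qvar M F fstar X Y n \<omega> + \<rho> *\<^sub>R id_blinfun))
          (mart n \<omega>)) \<le> \<beta> n \<omega>"
      and mart: "\<And>\<omega> n. \<omega> \<in> \<Omega> \<Longrightarrow>
          mart n \<omega> \<bullet> resolvent \<rho> (\<lambda>j. arm_var j \<omega>) (\<lambda>j. X j \<omega>) n (mart n \<omega>) \<le> (\<beta> n \<omega>)\<^sup>2"
      unfolding \<beta> by (rule concentration_event[OF rho y]) blast
    have \<Omega>_space: "\<omega> \<in> space M" if "\<omega> \<in> \<Omega>" for \<omega> using sets.sets_into_space[OF \<Omega>(1)] that by blast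
    \<comment> \<open>The event fails with probability at most \<open>exp (- y)\<close>, within the
      budget of \<open>C = 2\<close>; all three claims are read off from it.\<close>
    have prob: "1 - 2 * exp (- y) \<le> prob \<Omega>" using \<Omega>(2) exp_gt_zero[of "- y"] by linarith
    have likely: "with_prob_ge M (1 - 2 * exp (- y)) P" if "\<And>\<omega>. \<omega> \<in> \<Omega> \<Longrightarrow> P \<omega>" for P
      unfolding with_prob_ge_def using that \<Omega>(1) prob by blast
    have conf: "conf_ineqs \<rho> b fstar (\<lambda>j. X j \<omega>) (\<lambda>j. fhat j \<omega>) (\<lambda>j. \<beta> j \<omega>) n"
      if \<omega>: "\<omega> \<in> \<Omega>" and n: "1 \<le> n" for \<omega> n
    proof (rule conf_ineqs_of_noise_bound[OF \<rho>0 fstar_bound nn])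
      show "norm (X j \<omega>) \<le> 1" if "1 \<le> j" for j by (rule X_norm_le[OF that \<Omega>_space[OF \<omega>]])
      show "is_arg_min (ridge_loss \<rho> (\<lambda>j. X j \<omega>) (\<lambda>j. Y j \<omega>) n) (\<lambda>_. True) (fhat n \<omega>)"
        by (rule fhat[OF n \<Omega>_space[OF \<omega>]])
      show "mart n \<omega> \<bullet> resolvent \<rho> (\<lambda>j. arm_var j \<omega>) (\<lambda>j. X j \<omega>) n (mart n \<omega>) \<le> (\<beta> n \<omega>)\<^sup>2"
        by (rule mart[OF \<omega>])
      show "mart n \<omega> = (\<Sum>j=1..n. (Y j \<omega> - logistic (fstar \<bullet> X j \<omega>)) *\<^sub>R X j \<omega>)"
        by (simp add: noise_mart_def noise_def)
    qed
    show "concentration_radius M F fstar X Y \<rho> y 2 \<beta>"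
      unfolding concentration_radius_def using nn mono conc by (intro conjI likely) (auto simp: mono_on_def)
    show "with_prob_ge M (1 - 2 * exp (- y))
        (\<lambda>\<omega>. \<forall>n\<ge>1. conf_ineqs \<rho> b fstar (\<lambda>j. X j \<omega>) (\<lambda>j. fhat j \<omega>) (\<lambda>j. \<beta> j \<omega>) n)"
      by (intro likely allI impI conf)
    show "with_prob_ge M (1 - 2 * exp (- y))
        (\<lambda>\<omega>. \<forall>n\<ge>1. regret_bound \<rho> b fstar xstar (\<lambda>j. X j \<omega>) (\<lambda>j. \<beta> j \<omega>) n)"
      by (intro likely allI impI regret[OF \<Omega>_space _ nn mono rule] conf)
  qed
qed

end
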